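(* Let $R$ be a $\mathbb{Z}$-graded graded-commutative noetherian ring and let $\mathsf{S}$, $\mathsf{T}$ be Ext-finite graded $R$-linear triangulated categories. Suppose $\mathsf{S}$ is strongly generated and idempotent complete. Then every graded $R$-linear functor $\mathsf{f} \colon \mathsf{S} \to \mathsf{T}$ has a right adjoint.
   Context: A $\mathbb{Z}$-graded ring $R=\coprod_{d} R_d$ is graded-commutative if $rs=(-1)^{de}sr$ for $r\in R_d$, $s\in R_e$. Graded linear categories. Let $\mathsf{T}$ be a triangulated category with suspension $\Sigma$. Write $\operatorname{Ext}^*_{\mathsf{T}}(X,Y)=\coprod_{d\in\mathbb{Z}}\operatorname{Hom}_{\mathsf{T}}(X,\Sigma^d Y)$. The graded center is $\operatorname{Z}(\mathsf{T})=\coprod_{d}\{\eta\colon \operatorname{id}_{\mathsf{T}}\to\Sigma^d \mid \eta\Sigma=(-1)^d\Sigma\eta\}$. $\mathsf{T}$ is graded $R$-linear if it is equipped with a homomorphism of graded rings $\varphi\colon R\to \operatorname{Z}(\mathsf{T})$; then $\operatorname{Ext}^*_{\mathsf{T}}(X,Y)$ is a graded $R$-module via $r\cdot h=\varphi(r)_{\Sigma^eY}\circ h=(\Sigma^{|r|}h)\circ\varphi(r)_X$ for $h\in\operatorname{Hom}_{\mathsf{T}}(X,\Sigma^eY)$ and homogeneous $r$. $\mathsf{T}$ is Ext-finite if $\operatorname{Ext}^*_{\mathsf{T}}(X,Y)$ is a finitely generated graded $R$-module for all $X,Y\in\mathsf{T}$. A triangulated category is idempotent complete if every idempotent endomorphism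 in it splits. A functor $\mathsf{f}\colon\mathsf{S}\to\mathsf{T}$ between graded $R$-linear triangulated categories is graded $R$-linear if it is exact and the induced map $\operatorname{Ext}^*_{\mathsf{S}}(X,Y)\to\operatorname{Ext}^*_{\mathsf{T}}(\mathsf{f}(X),\mathsf{f}(Y))$ is a map of graded $R$-modules for all $X,Y\in\mathsf{S}$. Strong generation. For $G\in\mathsf{S}$ let $\operatorname{thick}^1(G)$ be the smallest full subcategory containing $G$ and closed under finite coproducts, retracts and (positive and negative) suspensions; for $n\ge2$ let $\operatorname{thick}^n(G)$ be the full subcategory of all $X$ for which there are $X'\in\mathsf{S}$ and an exact triangle $Y\to X\oplus X'\to Z\to\Sigma Y$ with $Y\in\operatorname{thick}^{n-1}(G)$ and $Z\in\operatorname{thick}^1(G)$. $\mathsf{S}$ is strongly generated if $\mathsf{S}=\operatorname{thick}^n(G)$ for some $G$ and some integer $n \geq 1$. *)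

theory Defs
  imports "HOL-Algebra.Ring_Divisibility" "HOL-Algebra.Module"
begin

section \<open>Graded-commutative rings and finitely generated modules\<close>

text \<open>A \<open>\<int>\<close>-graded ring is a ring that is the internal direct sum of its homogeneous
  parts \<open>Rd d\<close>. Noetherianity will be expressed by \<^locale>\<open>noetherian_ring\<close>, i.e. by two-sided
  ideals of the total ring; in a graded-commutative ring homogeneous left, right and two-sided
  ideals coincide, so this agrees with left and with right noetherianity.\<close>

locale graded_ring = ring R for R (structure) +
  fixes Rd :: "int \<Rightarrow> 'a set"
  assumes homogeneous_subgroup: "additive_subgroup (Rd d) R"
    and one_homogeneous: "\<one> \<in> Rd 0"
    and mult_homogeneous: "\<lbrakk>r \<in> Rd d; s \<in> Rd e\<rbrakk> \<Longrightarrow> r \<otimes> s \<in> Rd (d + e)"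
    and decomposition: "r \<in> carrier R \<Longrightarrow>
      \<exists>!c. (\<forall>d. c d \<in> Rd d) \<and> finite {d. c d \<noteq> \<zero>} \<and> r = (\<Oplus>d\<in>{d. c d \<noteq> \<zero>}. c d)"

locale graded_commutative_ring = graded_ring +
  assumes graded_commutative: "\<lbrakk>r \<in> Rd d; s \<in> Rd e\<rbrakk> \<Longrightarrow>
    r \<otimes> s = (if even (d * e) then s \<otimes> r else \<ominus> (s \<otimes> r))"

text \<open>The locale \<^locale>\<open>module\<close> requires a commutative base ring, so only the underlying record is
  reused here; its fields \<^const>\<open>mult\<close> and \<^const>\<open>one\<close> carry no meaning for modules.\<close>

definition finitely_generated ::
    "('r, 'x) ring_scheme \<Rightarrow> ('r, 'a, 'y) module_scheme \<Rightarrow> bool" where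
  "finitely_generated R M \<longleftrightarrow> (\<exists>A. finite A \<and> A \<subseteq> carrier M \<and>
     (\<forall>m\<in>carrier M. \<exists>c\<in>A \<rightarrow> carrier R. m = (\<Oplus>\<^bsub>M\<^esub>a\<in>A. c a \<odot>\<^bsub>M\<^esub> a)))"

definition is_module_map ::
    "('r, 'x) ring_scheme \<Rightarrow> ('r, 'a, 'y) module_scheme \<Rightarrow> ('r, 'b, 'z) module_scheme
      \<Rightarrow> ('a \<Rightarrow> 'b) \<Rightarrow> bool" where
  "is_module_map R M N u \<longleftrightarrow> u \<in> carrier M \<rightarrow> carrier N \<and>
     (\<forall>m\<in>carrier M. \<forall>m'\<in>carrier M. u (m \<oplus>\<^bsub>M\<^esub> m') = u m \<oplus>\<^bsub>N\<^esub> u m') \<and>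
     (\<forall>r\<in>carrier R. \<forall>m\<in>carrier M. u (r \<odot>\<^bsub>M\<^esub> m) = r \<odot>\<^bsub>N\<^esub> u m)"


section \<open>Categories and functors\<close>

record ('o, 'm) category =
  Obj :: "'o set"
  Arr :: "'m set"
  Dom :: "'m \<Rightarrow> 'o"
  Cod :: "'m \<Rightarrow> 'o"
  idt :: "'o \<Rightarrow> 'm"
  comp :: "'m \<Rightarrow> 'm \<Rightarrow> 'm"  (infixr \<open>\<cdot>\<index>\<close> 75)

definition Hom :: "('o, 'm, 'x) category_scheme \<Rightarrow> 'o \<Rightarrow> 'o \<Rightarrow> 'm set" where
  "Hom C X Y = {f \<in> Arr C. Dom C f = X \<and> Cod C f = Y}"

locale category =
  fixes C :: "('o, 'm, 'x) category_scheme" (structure)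
  assumes Dom_in_Obj: "f \<in> Arr C \<Longrightarrow> Dom C f \<in> Obj C"
    and Cod_in_Obj: "f \<in> Arr C \<Longrightarrow> Cod C f \<in> Obj C"
    and idt_in_Hom: "X \<in> Obj C \<Longrightarrow> idt C X \<in> Hom C X X"
    and comp_in_Hom: "\<lbrakk>f \<in> Hom C X Y; g \<in> Hom C Y Z\<rbrakk> \<Longrightarrow> g \<cdot> f \<in> Hom C X Z"
    and comp_idt: "f \<in> Hom C X Y \<Longrightarrow> f \<cdot> idt C X = f"
    and idt_comp: "f \<in> Hom C X Y \<Longrightarrow> idt C Y \<cdot> f = f"
    and comp_assoc: "\<lbrakk>f \<in> Hom C X Y; g \<in> Hom C Y Z; h \<in> Hom C Z W\<rbrakk> \<Longrightarrow>
      h \<cdot> (g \<cdot> f) = (h \<cdot> g) \<cdot> f"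

definition inverse_arrs :: "('o, 'm, 'x) category_scheme \<Rightarrow> 'm \<Rightarrow> 'm \<Rightarrow> bool" where
  "inverse_arrs C f g \<longleftrightarrow> f \<in> Hom C (Dom C f) (Cod C f) \<and> g \<in> Hom C (Cod C f) (Dom C f) \<and>
     g \<cdot>\<^bsub>C\<^esub> f = idt C (Dom C f) \<and> f \<cdot>\<^bsub>C\<^esub> g = idt C (Cod C f)"

definition is_iso_arr :: "('o, 'm, 'x) category_scheme \<Rightarrow> 'm \<Rightarrow> bool" where
  "is_iso_arr C f \<longleftrightarrow> (\<exists>g. inverse_arrs C f g)"

definition inv_arr :: "('o, 'm, 'x) category_scheme \<Rightarrow> 'm \<Rightarrow> 'm" where
  "inv_arr C f = (THE g. inverse_arrs C f g)"

definition is_retract :: "('o, 'm, 'x) category_scheme \<Rightarrow> 'o \<Rightarrow> 'o \<Rightarrow> bool" where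
  "is_retract C X Y \<longleftrightarrow> X \<in> Obj C \<and> Y \<in> Obj C \<and>
     (\<exists>s\<in>Hom C X Y. \<exists>r\<in>Hom C Y X. r \<cdot>\<^bsub>C\<^esub> s = idt C X)"

text \<open>Coproducts of finite families; \<open>Xs = []\<close> gives initial objects.\<close>

definition is_coproduct ::
    "('o, 'm, 'x) category_scheme \<Rightarrow> 'o list \<Rightarrow> 'o \<Rightarrow> (nat \<Rightarrow> 'm) \<Rightarrow> bool" where
  "is_coproduct C Xs P \<iota> \<longleftrightarrow> set Xs \<subseteq> Obj C \<and> P \<in> Obj C \<and>
     (\<forall>k<length Xs. \<iota> k \<in> Hom C (Xs ! k) P) \<and>
     (\<forall>Z\<in>Obj C. \<forall>g. (\<forall>k<length Xs. g k \<in> Hom C (Xs ! k) Z) \<longrightarrow>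
        (\<exists>!u. u \<in> Hom C P Z \<and> (\<forall>k<length Xs. u \<cdot>\<^bsub>C\<^esub> \<iota> k = g k)))"

definition idempotent_complete :: "('o, 'm, 'x) category_scheme \<Rightarrow> bool" where
  "idempotent_complete C \<longleftrightarrow>
     (\<forall>X\<in>Obj C. \<forall>e\<in>Hom C X X. e \<cdot>\<^bsub>C\<^esub> e = e \<longrightarrow>
        (\<exists>Y\<in>Obj C. \<exists>r\<in>Hom C X Y. \<exists>s\<in>Hom C Y X. s \<cdot>\<^bsub>C\<^esub> r = e \<and> r \<cdot>\<^bsub>C\<^esub> s = idt C Y))"

record ('o, 'm, 'p, 'n) functor_data =
  obj_map :: "'o \<Rightarrow> 'p"
  arr_map :: "'m \<Rightarrow> 'n"

definition is_functor ::
    "('o, 'm, 'x) category_scheme \<Rightarrow> ('p, 'n, 'y) category_scheme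
      \<Rightarrow> ('o, 'm, 'p, 'n) functor_data \<Rightarrow> bool" where
  "is_functor C D F \<longleftrightarrow>
     (\<forall>X\<in>Obj C. obj_map F X \<in> Obj D) \<and>
     (\<forall>X\<in>Obj C. \<forall>Y\<in>Obj C. \<forall>f\<in>Hom C X Y. arr_map F f \<in> Hom D (obj_map F X) (obj_map F Y)) \<and>
     (\<forall>X\<in>Obj C. arr_map F (idt C X) = idt D (obj_map F X)) \<and>
     (\<forall>X\<in>Obj C. \<forall>Y\<in>Obj C. \<forall>Z\<in>Obj C. \<forall>f\<in>Hom C X Y. \<forall>g\<in>Hom C Y Z.
        arr_map F (g \<cdot>\<^bsub>C\<^esub> f) = arr_map F g \<cdot>\<^bsub>D\<^esub> arr_map F f)"

definition is_right_adjoint ::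
    "('o, 'm, 'x) category_scheme \<Rightarrow> ('p, 'n, 'y) category_scheme
      \<Rightarrow> ('o, 'm, 'p, 'n) functor_data \<Rightarrow> ('p, 'n, 'o, 'm) functor_data \<Rightarrow> bool" where
  "is_right_adjoint C D F G \<longleftrightarrow> is_functor D C G \<and>
     (\<exists>\<alpha>. (\<forall>X\<in>Obj C. \<forall>Y\<in>Obj D.
             bij_betw (\<alpha> X Y) (Hom D (obj_map F X) Y) (Hom C X (obj_map G Y))) \<and>
          (\<forall>X\<in>Obj C. \<forall>X'\<in>Obj C. \<forall>Y\<in>Obj D. \<forall>Y'\<in>Obj D.
             \<forall>u\<in>Hom C X' X. \<forall>v\<in>Hom D Y Y'. \<forall>f\<in>Hom D (obj_map F X) Y.
               \<alpha> X' Y' (v \<cdot>\<^bsub>D\<^esub> f \<cdot>\<^bsub>D\<^esub> arr_map F u) = arr_map G v \<cdot>\<^bsub>C\<^esub> \<alpha> X Y f \<cdot>\<^bsub>C\<^esub> u))"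

definition has_right_adjoint ::
    "('o, 'm, 'x) category_scheme \<Rightarrow> ('p, 'n, 'y) category_scheme
      \<Rightarrow> ('o, 'm, 'p, 'n) functor_data \<Rightarrow> bool" where
  "has_right_adjoint C D F \<longleftrightarrow> (\<exists>G. is_right_adjoint C D F G)"


section \<open>Additive categories\<close>

record ('o, 'm) additive_category = "('o, 'm) category" +
  zero_arr :: "'o \<Rightarrow> 'o \<Rightarrow> 'm"
  add_arr :: "'m \<Rightarrow> 'm \<Rightarrow> 'm"  (infixl \<open>\<boxplus>\<index>\<close> 65)

text \<open>The additive group \<open>Hom(X, Y)\<close>, as a \<^typ>\<open>'m ring\<close> record because
  \<^locale>\<open>abelian_group\<close> lives on such records; \<^const>\<open>mult\<close> and \<^const>\<open>one\<close> carry no meaning.\<close>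

definition hom_group :: "('o, 'm, 'x) additive_category_scheme \<Rightarrow> 'o \<Rightarrow> 'o \<Rightarrow> 'm ring" where
  "hom_group C X Y = \<lparr>carrier = Hom C X Y, mult = undefined, one = undefined,
     zero = zero_arr C X Y, add = add_arr C\<rparr>"

definition neg_arr :: "('o, 'm, 'x) additive_category_scheme \<Rightarrow> 'm \<Rightarrow> 'm" where
  "neg_arr C f = \<ominus>\<^bsub>hom_group C (Dom C f) (Cod C f)\<^esub> f"

locale additive_category = category C
  for C :: "('o, 'm, 'x) additive_category_scheme" (structure) +
  assumes hom_abelian_group:
      "\<lbrakk>X \<in> Obj C; Y \<in> Obj C\<rbrakk> \<Longrightarrow> abelian_group (hom_group C X Y)"
    and comp_add: "\<lbrakk>f \<in> Hom C X Y; f' \<in> Hom C X Y; g \<in> Hom C Y Z\<rbrakk> \<Longrightarrow>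
      g \<cdot> (f \<boxplus> f') = g \<cdot> f \<boxplus> g \<cdot> f'"
    and add_comp: "\<lbrakk>f \<in> Hom C X Y; g \<in> Hom C Y Z; g' \<in> Hom C Y Z\<rbrakk> \<Longrightarrow>
      (g \<boxplus> g') \<cdot> f = g \<cdot> f \<boxplus> g' \<cdot> f"
    and finite_coproducts: "set Xs \<subseteq> Obj C \<Longrightarrow> \<exists>P \<iota>. is_coproduct C Xs P \<iota>"

definition is_additive_functor ::
    "('o, 'm, 'x) additive_category_scheme \<Rightarrow> ('p, 'n, 'y) additive_category_scheme
      \<Rightarrow> ('o, 'm, 'p, 'n) functor_data \<Rightarrow> bool" where
  "is_additive_functor C D F \<longleftrightarrow> is_functor C D F \<and>
     (\<forall>X\<in>Obj C. \<forall>Y\<in>Obj C. \<forall>f\<in>Hom C X Y. \<forall>f'\<in>Hom C X Y.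
        arr_map F (f \<boxplus>\<^bsub>C\<^esub> f') = arr_map F f \<boxplus>\<^bsub>D\<^esub> arr_map F f')"


section \<open>Triangulated categories\<close>

text \<open>A triangle \<open>X \<rightarrow> Y \<rightarrow> Z \<rightarrow> \<Sigma>X\<close> is recorded by its three arrows. The suspension is an
  automorphism (not merely an auto-equivalence), so that \<open>\<Sigma>\<^sup>d\<Sigma>\<^sup>e = \<Sigma>\<^sup>d\<^sup>+\<^sup>e\<close> holds strictly for all
  integers \<open>d\<close>, \<open>e\<close>.\<close>

record ('o, 'm) triangulated_category = "('o, 'm) additive_category" +
  susp :: "('o, 'm, 'o, 'm) functor_data"
  Tri :: "('m \<times> 'm \<times> 'm) set"

definition shift_obj ::
    "('o, 'm, 'x) triangulated_category_scheme \<Rightarrow> int \<Rightarrow> 'o \<Rightarrow> 'o" where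
  "shift_obj C d = (if d \<ge> 0 then obj_map (susp C) ^^ nat d
     else inv_into (Obj C) (obj_map (susp C)) ^^ nat (- d))"

definition shift_arr ::
    "('o, 'm, 'x) triangulated_category_scheme \<Rightarrow> int \<Rightarrow> 'm \<Rightarrow> 'm" where
  "shift_arr C d = (if d \<ge> 0 then arr_map (susp C) ^^ nat d
     else inv_into (Arr C) (arr_map (susp C)) ^^ nat (- d))"

definition is_triangle ::
    "('o, 'm, 'x) triangulated_category_scheme \<Rightarrow> 'o \<Rightarrow> 'o \<Rightarrow> 'o \<Rightarrow> 'm \<Rightarrow> 'm \<Rightarrow> 'm \<Rightarrow> bool" where
  "is_triangle C X Y Z f g h \<longleftrightarrow> X \<in> Obj C \<and> Y \<in> Obj C \<and> Z \<in> Obj C \<and>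
     f \<in> Hom C X Y \<and> g \<in> Hom C Y Z \<and> h \<in> Hom C Z (obj_map (susp C) X)"

definition is_exact_triangle ::
    "('o, 'm, 'x) triangulated_category_scheme \<Rightarrow> 'o \<Rightarrow> 'o \<Rightarrow> 'o \<Rightarrow> 'm \<Rightarrow> 'm \<Rightarrow> 'm \<Rightarrow> bool" where
  "is_exact_triangle C X Y Z f g h \<longleftrightarrow> is_triangle C X Y Z f g h \<and> (f, g, h) \<in> Tri C"

locale triangulated_category = additive_category C
  for C :: "('o, 'm, 'x) triangulated_category_scheme" (structure) +
  assumes susp_additive: "is_additive_functor C C (susp C)"
    and susp_bij_obj: "bij_betw (obj_map (susp C)) (Obj C) (Obj C)"
    and susp_bij_arr: "bij_betw (arr_map (susp C)) (Arr C) (Arr C)"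
    and Tri_triangle: "(f, g, h) \<in> Tri C \<Longrightarrow> \<exists>X Y Z. is_triangle C X Y Z f g h"
    and TR1_iso: "\<lbrakk>is_exact_triangle C X Y Z f g h; is_triangle C X' Y' Z' f' g' h';
        a \<in> Hom C X X'; b \<in> Hom C Y Y'; c \<in> Hom C Z Z';
        is_iso_arr C a; is_iso_arr C b; is_iso_arr C c;
        b \<cdot> f = f' \<cdot> a; c \<cdot> g = g' \<cdot> b; arr_map (susp C) a \<cdot> h = h' \<cdot> c\<rbrakk> \<Longrightarrow>
      is_exact_triangle C X' Y' Z' f' g' h'"
    and TR1_idt: "\<lbrakk>X \<in> Obj C; is_coproduct C [] N \<iota>\<rbrakk> \<Longrightarrow>
      is_exact_triangle C X X N (idt C X) (zero_arr C X N) (zero_arr C N (obj_map (susp C) X))"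
    and TR1_cone: "\<lbrakk>X \<in> Obj C; Y \<in> Obj C; f \<in> Hom C X Y\<rbrakk> \<Longrightarrow>
      \<exists>Z g h. is_exact_triangle C X Y Z f g h"
    and TR2: "is_triangle C X Y Z f g h \<Longrightarrow>
      is_exact_triangle C X Y Z f g h \<longleftrightarrow>
      is_exact_triangle C Y Z (obj_map (susp C) X) g h (neg_arr C (arr_map (susp C) f))"
    and TR3: "\<lbrakk>is_exact_triangle C X Y Z f g h; is_exact_triangle C X' Y' Z' f' g' h';
        a \<in> Hom C X X'; b \<in> Hom C Y Y'; b \<cdot> f = f' \<cdot> a\<rbrakk> \<Longrightarrow>
      \<exists>c\<in>Hom C Z Z'. c \<cdot> g = g' \<cdot> b \<and> arr_map (susp C) a \<cdot> h = h' \<cdot> c"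
    and TR4: "\<lbrakk>is_exact_triangle C X Y U f f' f''; is_exact_triangle C Y Z W g g' g'';
        is_exact_triangle C X Z V (g \<cdot> f) k k'\<rbrakk> \<Longrightarrow>
      \<exists>u v. is_exact_triangle C U V W u v (arr_map (susp C) f' \<cdot> g'') \<and>
        u \<cdot> f' = k \<cdot> g \<and> k' \<cdot> u = f'' \<and> v \<cdot> k = g' \<and> g'' \<cdot> v = arr_map (susp C) f \<cdot> k'"


section \<open>Graded linear categories\<close>

text \<open>The degree \<open>d\<close> part of the graded center: natural transformations \<open>\<eta> : id \<rightarrow> \<Sigma>\<^sup>d\<close> with
  \<open>\<eta>\<Sigma> = (-1)\<^sup>d \<Sigma>\<eta>\<close>. They are extensional, so that equality of functions is equality of natural
  transformations.\<close>

definition center_part ::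
    "('o, 'm, 'x) triangulated_category_scheme \<Rightarrow> int \<Rightarrow> ('o \<Rightarrow> 'm) set" where
  "center_part C d = {\<eta> \<in> extensional (Obj C).
     (\<forall>X\<in>Obj C. \<eta> X \<in> Hom C X (shift_obj C d X)) \<and>
     (\<forall>X\<in>Obj C. \<forall>Y\<in>Obj C. \<forall>f\<in>Hom C X Y. \<eta> Y \<cdot>\<^bsub>C\<^esub> f = shift_arr C d f \<cdot>\<^bsub>C\<^esub> \<eta> X) \<and>
     (\<forall>X\<in>Obj C. \<eta> (obj_map (susp C) X) =
        (if even d then arr_map (susp C) (\<eta> X) else neg_arr C (arr_map (susp C) (\<eta> X))))}"

definition center_zero ::
    "('o, 'm, 'x) triangulated_category_scheme \<Rightarrow> int \<Rightarrow> 'o \<Rightarrow> 'm" where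
  "center_zero C d = (\<lambda>X\<in>Obj C. zero_arr C X (shift_obj C d X))"

text \<open>The graded center as a ring: its elements are the finitely supported families
  \<open>(\<eta>\<^sub>d)\<close>, \<open>d \<in> \<int>\<close>. For homogeneous \<open>\<eta>\<close>, \<open>\<zeta>\<close> of degrees \<open>d\<close>, \<open>e\<close> the product has components
  \<open>X \<rightarrow> \<Sigma>\<^sup>eX \<rightarrow> \<Sigma>\<^sup>d\<Sigma>\<^sup>eX\<close>, given by \<open>\<zeta>\<close> at \<open>X\<close> followed by \<open>\<eta>\<close> at \<open>\<Sigma>\<^sup>eX\<close>.\<close>

definition graded_center ::
    "('o, 'm, 'x) triangulated_category_scheme \<Rightarrow> (int \<Rightarrow> 'o \<Rightarrow> 'm) ring" where
  "graded_center C =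
    \<lparr>carrier = {\<eta>. (\<forall>d. \<eta> d \<in> center_part C d) \<and> finite {d. \<eta> d \<noteq> center_zero C d}},
     mult = (\<lambda>\<eta> \<zeta> n. \<lambda>X\<in>Obj C. \<Oplus>\<^bsub>hom_group C X (shift_obj C n X)\<^esub>d\<in>{d. \<eta> d \<noteq> center_zero C d}.
       \<eta> d (shift_obj C (n - d) X) \<cdot>\<^bsub>C\<^esub> \<zeta> (n - d) X),
     one = (\<lambda>d. \<lambda>X\<in>Obj C. if d = 0 then idt C X else zero_arr C X (shift_obj C d X)),
     zero = center_zero C,
     add = (\<lambda>\<eta> \<zeta> d. \<lambda>X\<in>Obj C. \<eta> d X \<boxplus>\<^bsub>C\<^esub> \<zeta> d X)\<rparr>"

locale graded_linear_category =
  graded_commutative_ring R Rd + triangulated_category C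
  for R :: "('r, 'x) ring_scheme" and Rd :: "int \<Rightarrow> 'r set"
    and C :: "('o, 'm, 'y) triangulated_category_scheme" +
  fixes \<phi> :: "'r \<Rightarrow> int \<Rightarrow> 'o \<Rightarrow> 'm"
  assumes action_ring_hom: "\<phi> \<in> ring_hom R (graded_center C)"
    and action_graded: "\<lbrakk>r \<in> Rd d; e \<noteq> d\<rbrakk> \<Longrightarrow> \<phi> r e = center_zero C e"

text \<open>The graded module \<open>Ext\<^sup>*(X, Y)\<close>: finitely supported families of arrows \<open>X \<rightarrow> \<Sigma>\<^sup>dY\<close>,
  with a homogeneous \<open>r\<close> acting on \<open>h : X \<rightarrow> \<Sigma>\<^sup>eY\<close> by \<open>\<phi> r\<close> at \<open>\<Sigma>\<^sup>eY\<close> after \<open>h\<close>.\<close>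

definition Ext_module ::
    "('o, 'm, 'x) triangulated_category_scheme \<Rightarrow> ('r \<Rightarrow> int \<Rightarrow> 'o \<Rightarrow> 'm)
      \<Rightarrow> 'o \<Rightarrow> 'o \<Rightarrow> ('r, int \<Rightarrow> 'm) module" where
  "Ext_module C \<phi> X Y =
    \<lparr>carrier = {h. (\<forall>d. h d \<in> Hom C X (shift_obj C d Y)) \<and>
       finite {d. h d \<noteq> zero_arr C X (shift_obj C d Y)}},
     mult = undefined, one = undefined,
     zero = (\<lambda>d. zero_arr C X (shift_obj C d Y)),
     add = (\<lambda>h k d. h d \<boxplus>\<^bsub>C\<^esub> k d),
     smult = (\<lambda>r h n. \<Oplus>\<^bsub>hom_group C X (shift_obj C n Y)\<^esub>d\<in>{d. \<phi> r d \<noteq> center_zero C d}.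
       \<phi> r d (shift_obj C (n - d) Y) \<cdot>\<^bsub>C\<^esub> h (n - d))\<rparr>"

definition Ext_finite ::
    "('r, 'y) ring_scheme \<Rightarrow> ('o, 'm, 'x) triangulated_category_scheme
      \<Rightarrow> ('r \<Rightarrow> int \<Rightarrow> 'o \<Rightarrow> 'm) \<Rightarrow> bool" where
  "Ext_finite R C \<phi> \<longleftrightarrow>
     (\<forall>X\<in>Obj C. \<forall>Y\<in>Obj C. finitely_generated R (Ext_module C \<phi> X Y))"


section \<open>Exact and graded linear functors\<close>

text \<open>An exact functor is an additive functor \<open>F\<close> together with a natural isomorphism
  \<open>\<theta> : F \<Sigma> \<rightarrow> \<Sigma> F\<close>, compatible with exact triangles.\<close>

definition is_exact_functor ::
    "('o, 'm, 'x) triangulated_category_scheme \<Rightarrow> ('p, 'n, 'y) triangulated_category_scheme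
      \<Rightarrow> ('o, 'm, 'p, 'n) functor_data \<Rightarrow> ('o \<Rightarrow> 'n) \<Rightarrow> bool" where
  "is_exact_functor C D F \<theta> \<longleftrightarrow> is_additive_functor C D F \<and>
     (\<forall>X\<in>Obj C. \<theta> X \<in> Hom D (obj_map F (obj_map (susp C) X)) (obj_map (susp D) (obj_map F X)) \<and>
        is_iso_arr D (\<theta> X)) \<and>
     (\<forall>X\<in>Obj C. \<forall>Y\<in>Obj C. \<forall>f\<in>Hom C X Y.
        \<theta> Y \<cdot>\<^bsub>D\<^esub> arr_map F (arr_map (susp C) f) = arr_map (susp D) (arr_map F f) \<cdot>\<^bsub>D\<^esub> \<theta> X) \<and>
     (\<forall>X Y Z f g h. is_exact_triangle C X Y Z f g h \<longrightarrow>
        is_exact_triangle D (obj_map F X) (obj_map F Y) (obj_map F Z)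
          (arr_map F f) (arr_map F g) (\<theta> X \<cdot>\<^bsub>D\<^esub> arr_map F h))"

text \<open>The isomorphisms \<open>\<theta>\<^sup>d : F \<Sigma>\<^sup>d \<rightarrow> \<Sigma>\<^sup>d F\<close> obtained by iterating \<open>\<theta>\<close>. In negative degrees one
  iterates \<open>\<theta>\<^sup>-\<^sup>1 : F \<Sigma>\<^sup>-\<^sup>1 \<rightarrow> \<Sigma>\<^sup>-\<^sup>1 F\<close>, whose component at \<open>X\<close> is \<open>\<Sigma>\<^sup>-\<^sup>1\<close> applied to the inverse of
  \<open>\<theta> (\<Sigma>\<^sup>-\<^sup>1 X) : F X \<rightarrow> \<Sigma> F \<Sigma>\<^sup>-\<^sup>1 X\<close>.\<close>

primrec theta_pos ::
    "('o, 'm, 'x) triangulated_category_scheme \<Rightarrow> ('p, 'n, 'y) triangulated_category_scheme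
      \<Rightarrow> ('o, 'm, 'p, 'n) functor_data \<Rightarrow> ('o \<Rightarrow> 'n) \<Rightarrow> nat \<Rightarrow> 'o \<Rightarrow> 'n" where
  "theta_pos C D F \<theta> 0 X = idt D (obj_map F X)"
| "theta_pos C D F \<theta> (Suc n) X =
     shift_arr D 1 (theta_pos C D F \<theta> n X) \<cdot>\<^bsub>D\<^esub> \<theta> (shift_obj C (int n) X)"

primrec theta_neg ::
    "('o, 'm, 'x) triangulated_category_scheme \<Rightarrow> ('p, 'n, 'y) triangulated_category_scheme
      \<Rightarrow> ('o, 'm, 'p, 'n) functor_data \<Rightarrow> ('o \<Rightarrow> 'n) \<Rightarrow> nat \<Rightarrow> 'o \<Rightarrow> 'n" where
  "theta_neg C D F \<theta> 0 X = idt D (obj_map F X)"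
| "theta_neg C D F \<theta> (Suc n) X =
     shift_arr D (- 1) (theta_neg C D F \<theta> n X) \<cdot>\<^bsub>D\<^esub>
     shift_arr D (- 1) (inv_arr D (\<theta> (shift_obj C (- 1 - int n) X)))"

definition theta_power ::
    "('o, 'm, 'x) triangulated_category_scheme \<Rightarrow> ('p, 'n, 'y) triangulated_category_scheme
      \<Rightarrow> ('o, 'm, 'p, 'n) functor_data \<Rightarrow> ('o \<Rightarrow> 'n) \<Rightarrow> int \<Rightarrow> 'o \<Rightarrow> 'n" where
  "theta_power C D F \<theta> d =
     (if d \<ge> 0 then theta_pos C D F \<theta> (nat d) else theta_neg C D F \<theta> (nat (- d)))"

definition Ext_map ::
    "('o, 'm, 'x) triangulated_category_scheme \<Rightarrow> ('p, 'n, 'y) triangulated_category_scheme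
      \<Rightarrow> ('o, 'm, 'p, 'n) functor_data \<Rightarrow> ('o \<Rightarrow> 'n) \<Rightarrow> 'o \<Rightarrow> (int \<Rightarrow> 'm) \<Rightarrow> int \<Rightarrow> 'n" where
  "Ext_map C D F \<theta> Y h = (\<lambda>d. theta_power C D F \<theta> d Y \<cdot>\<^bsub>D\<^esub> arr_map F (h d))"

definition is_graded_linear_functor ::
    "('r, 'z) ring_scheme
      \<Rightarrow> ('o, 'm, 'x) triangulated_category_scheme \<Rightarrow> ('r \<Rightarrow> int \<Rightarrow> 'o \<Rightarrow> 'm)
      \<Rightarrow> ('p, 'n, 'y) triangulated_category_scheme \<Rightarrow> ('r \<Rightarrow> int \<Rightarrow> 'p \<Rightarrow> 'n)
      \<Rightarrow> ('o, 'm, 'p, 'n) functor_data \<Rightarrow> ('o \<Rightarrow> 'n) \<Rightarrow> bool" where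
  "is_graded_linear_functor R C \<phi> D \<psi> F \<theta> \<longleftrightarrow> is_exact_functor C D F \<theta> \<and>
     (\<forall>X\<in>Obj C. \<forall>Y\<in>Obj C.
        is_module_map R (Ext_module C \<phi> X Y) (Ext_module D \<psi> (obj_map F X) (obj_map F Y))
          (Ext_map C D F \<theta> Y))"


section \<open>Strong generation\<close>

text \<open>Full subcategories are represented by their sets of objects.\<close>

inductive_set thick_one :: "('o, 'm, 'x) triangulated_category_scheme \<Rightarrow> 'o \<Rightarrow> 'o set"
  for C :: "('o, 'm, 'x) triangulated_category_scheme" and G :: 'o where
  generator: "G \<in> thick_one C G"
| coproduct: "\<lbrakk>\<forall>X\<in>set Xs. X \<in> thick_one C G; is_coproduct C Xs P \<iota>\<rbrakk> \<Longrightarrow> P \<in> thick_one C G"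
| retract: "\<lbrakk>Y \<in> thick_one C G; is_retract C X Y\<rbrakk> \<Longrightarrow> X \<in> thick_one C G"
| suspension: "X \<in> thick_one C G \<Longrightarrow> shift_obj C d X \<in> thick_one C G"

text \<open>\<open>thick C G n\<close> is only meaningful for \<open>n \<ge> 1\<close>.\<close>

fun thick :: "('o, 'm, 'x) triangulated_category_scheme \<Rightarrow> 'o \<Rightarrow> nat \<Rightarrow> 'o set" where
  "thick C G 0 = {}"
| "thick C G (Suc 0) = thick_one C G"
| "thick C G (Suc (Suc n)) = {X \<in> Obj C. \<exists>X' P \<iota> Y Z f g h.
     is_coproduct C [X, X'] P \<iota> \<and> is_exact_triangle C Y P Z f g h \<and>
     Y \<in> thick C G (Suc n) \<and> Z \<in> thick_one C G}"

definition strongly_generated :: "('o, 'm, 'x) triangulated_category_scheme \<Rightarrow> bool" where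
  "strongly_generated C \<longleftrightarrow> (\<exists>G\<in>Obj C. \<exists>n\<ge>1. Obj C = thick C G n)"

end

(* Fix an object Y of T. The functor H = Hom(F -, Y) has to be represented by an object of S. Let G
   be a strong generator. Linearity of F and Ext-finiteness of T give an object A_0 and a morphism
   a_0 : F A_0 -> Y through which every morphism F(Sigma^m G) -> Y factors as a_0 o F x. As R is
   noetherian and S is Ext-finite, the x : Sigma^m G -> A_i with a_i o F x = 0 all factor through
   one morphism B_i -> A_i; its cone A_{i+1} kills them, and a_i extends to a_{i+1} because H is
   cohomological. By induction on the number of extensions needed to build X from G, every
   morphism F X -> Y lifts to A_N, and every x : X -> A_i with a_i o F x = 0 dies in A_{i+k}, with
   N and k independent of X. Hence H is a retract of Hom(-, A_{N+k}), and splitting the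
   corresponding idempotent represents H. *)

theory Submission
  imports Defs
begin

section \<open>Graded modules over graded noetherian rings\<close>

text \<open>Why one object serves all shifts of \<open>G\<close> at once: up to the comparison
  isomorphisms \<open>\<Theta>\<close>, a morphism from \<open>F\<close> of a shift of
  \<open>G\<close> to \<open>Y\<close> is a homogeneous element of Ext from \<open>F G\<close> to
  \<open>Y\<close>. Generators of this module factor through one \<open>F A\<close>, and a ring
  element r acts on it by precomposition with \<open>\<psi> r\<close>, which linearity identifies
  with \<open>F\<close> of \<open>\<phi> r\<close>; so whatever the generators generate factors as
  well. For the same reason the morphisms killed by a_i form a graded submodule of Ext from
  \<open>G\<close> to A_i. The finiteness hypotheses speak of the total ring and of total modules,
  so they must first be turned into statements about homogeneous elements. The obstacle is that a_i
  need not become injective on morphisms at any finite stage; kernels only die later. Hence two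
  properties are tracked: lifting at a given stage, and dying after a lag that is the same at every
  stage. They pass through a triangle by the two halves of the five lemma, each at the cost of one
  stage. An object built with n extensions thus needs N = n and k = n + 1: the generator itself
  already has lag 1.\<close>

inductive graded_span ::
    "(int \<Rightarrow> 'r set) \<Rightarrow> ('m \<Rightarrow> 'm \<Rightarrow> 'm) \<Rightarrow> (int \<Rightarrow> 'm) \<Rightarrow> (int \<Rightarrow> 'r \<Rightarrow> int \<Rightarrow> 'm \<Rightarrow> 'm)
      \<Rightarrow> (int \<times> 'm) set \<Rightarrow> int \<Rightarrow> 'm \<Rightarrow> bool"
  for Rd pl z act \<G> where
  gen: "(e, g) \<in> \<G> \<Longrightarrow> graded_span Rd pl z act \<G> e g"
| zero: "graded_span Rd pl z act \<G> e (z e)"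
| add: "\<lbrakk>graded_span Rd pl z act \<G> e h; graded_span Rd pl z act \<G> e h'\<rbrakk> \<Longrightarrow>
    graded_span Rd pl z act \<G> e (pl h h')"
| act: "\<lbrakk>r \<in> Rd d; graded_span Rd pl z act \<G> e h\<rbrakk> \<Longrightarrow>
    graded_span Rd pl z act \<G> (d + e) (act d r e h)"

text \<open>Closure under negation is implied: -1 is homogeneous of degree 0, and acting by it gives
  negatives. With \<open>M\<close> the ring itself and left multiplication as action, this is the
  notion of a graded left ideal.\<close>

definition graded_submodule ::
    "(int \<Rightarrow> 'r set) \<Rightarrow> (int \<Rightarrow> 'm set) \<Rightarrow> ('m \<Rightarrow> 'm \<Rightarrow> 'm) \<Rightarrow> (int \<Rightarrow> 'm)
      \<Rightarrow> (int \<Rightarrow> 'r \<Rightarrow> int \<Rightarrow> 'm \<Rightarrow> 'm) \<Rightarrow> (int \<Rightarrow> 'm set) \<Rightarrow> bool" where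
  "graded_submodule Rd M pl z act N \<longleftrightarrow>
     (\<forall>e. N e \<subseteq> M e \<and> z e \<in> N e) \<and>
     (\<forall>e. \<forall>h\<in>N e. \<forall>h'\<in>N e. pl h h' \<in> N e) \<and>
     (\<forall>d e. \<forall>r\<in>Rd d. \<forall>h\<in>N e. act d r e h \<in> N (d + e))"

lemma graded_span_in_submodule:
  assumes "graded_span Rd pl z act \<G> e h" "graded_submodule Rd M pl z act N"
    and "\<And>e g. (e, g) \<in> \<G> \<Longrightarrow> g \<in> N e"
  shows "h \<in> N e"
  using assms(1)
  by induction (use assms(2,3) in \<open>auto simp: graded_submodule_def\<close>)

lemma graded_span_mono:
  assumes "graded_span Rd pl z act \<G> e h" "\<G> \<subseteq> \<G>'"
  shows "graded_span Rd pl z act \<G>' e h"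
  using assms(1) by induction (use assms(2) in \<open>auto intro: graded_span.intros\<close>)

text \<open>The subset of the total ring spanned by a graded family. It links graded ideals to the
  ideals of the total ring that \<open>noetherian_ring\<close> speaks about; building sums one
  homogeneous term at a time gives an induction that avoids explicit decompositions.\<close>

inductive_set (in ring) sums_of :: "(int \<Rightarrow> 'a set) \<Rightarrow> 'a set" for I where
  zero: "\<zero> \<in> sums_of I"
| add: "\<lbrakk>x \<in> I d; y \<in> sums_of I\<rbrakk> \<Longrightarrow> x \<oplus> y \<in> sums_of I"

section \<open>Graded ideals and the ideals of the total ring that they span\<close>

context graded_ring
begin

abbreviation left_mult :: "int \<Rightarrow> 'a \<Rightarrow> int \<Rightarrow> 'a \<Rightarrow> 'a" where
  "left_mult \<equiv> \<lambda>d r e s. r \<otimes> s"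

abbreviation graded_ideal :: "(int \<Rightarrow> 'a set) \<Rightarrow> bool" where
  "graded_ideal \<equiv> graded_submodule Rd Rd (\<oplus>) (\<lambda>_. \<zero>) left_mult"

lemma homogeneous_closed [simp, intro]: "r \<in> Rd d \<Longrightarrow> r \<in> carrier R"
  using additive_subgroup.a_subset[OF homogeneous_subgroup] by blast

lemma homogeneous_zero [simp, intro]: "\<zero> \<in> Rd d"
  using additive_subgroup.zero_closed[OF homogeneous_subgroup] .

lemma homogeneous_add [simp, intro]: "\<lbrakk>r \<in> Rd d; s \<in> Rd d\<rbrakk> \<Longrightarrow> r \<oplus> s \<in> Rd d"
  using additive_subgroup.a_closed[OF homogeneous_subgroup] .

lemma homogeneous_neg [simp, intro]: "r \<in> Rd d \<Longrightarrow> \<ominus> r \<in> Rd d"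
  using additive_subgroup.a_inv_closed[OF homogeneous_subgroup] .

lemma sums_of_closed:
  assumes "\<And>d. I d \<subseteq> Rd d" "x \<in> sums_of I"
  shows "x \<in> carrier R"
  using assms(2) by induction (use assms(1) in blast)+

lemma sums_of_add:
  assumes "\<And>d. I d \<subseteq> Rd d" "x \<in> sums_of I" "y \<in> sums_of I"
  shows "x \<oplus> y \<in> sums_of I"
  using assms(2)
proof induction
  case zero
  then show ?case using assms(3) sums_of_closed[OF assms(1,3)] by simp
next
  case (add x d x')
  have "x \<in> carrier R" "x' \<in> carrier R" "y \<in> carrier R"
    using add(1) assms(1) sums_of_closed[OF assms(1) add(2)] sums_of_closed[OF assms(1) assms(3)]
    by auto
  then show ?case using sums_of.add[OF add(1,3)] by (simp add: a_assoc)
qed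

lemma carrier_eq_sums_of: "carrier R = sums_of Rd"
proof
  show "sums_of Rd \<subseteq> carrier R" using sums_of_closed[of Rd] by auto
  show "carrier R \<subseteq> sums_of Rd"
  proof
    fix r assume "r \<in> carrier R"
    from ex1_implies_ex[OF decomposition[OF this]] obtain c
      where c: "\<forall>d. c d \<in> Rd d" "finite {d. c d \<noteq> \<zero>}" "r = (\<Oplus>d\<in>{d. c d \<noteq> \<zero>}. c d)"
      by blast
    have "finite A \<Longrightarrow> (\<Oplus>d\<in>A. c d) \<in> sums_of Rd" for A
    proof (induction rule: finite_induct)
      case (insert d A)
      then have "(\<Oplus>d\<in>insert d A. c d) = c d \<oplus> (\<Oplus>d\<in>A. c d)"
        by (intro finsum_insert) (use c(1) in auto)
      then show ?case using sums_of.add[OF c(1)[rule_format] insert(3)] by simp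
    qed (simp add: sums_of.zero)
    with c show "r \<in> sums_of Rd" by simp
  qed
qed

text \<open>Uniqueness of homogeneous components: a sum of elements of the \<open>I d\<close> has a
  decomposition with components in \<open>I\<close>, while a homogeneous \<open>r\<close> also has
  the decomposition concentrated in its own degree; the two must coincide.\<close>

lemma sums_of_homogeneous:
  assumes I: "graded_ideal I" and "r \<in> sums_of I" "r \<in> Rd d"
  shows "r \<in> I d"
proof -
  have sub: "I e \<subseteq> Rd e" and z: "\<zero> \<in> I e" for e
    using I by (auto simp: graded_submodule_def)
  have "\<exists>c. (\<forall>d. c d \<in> I d) \<and> finite {d. c d \<noteq> \<zero>} \<and> r = (\<Oplus>d\<in>{d. c d \<noteq> \<zero>}. c d)"
    using assms(2)
  proof induction
    case zero
    show ?case by (rule exI[of _ "\<lambda>_. \<zero>"]) (simp add: z)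
  next
    case (add x e y)
    then obtain c where c: "\<forall>d. c d \<in> I d" "finite {d. c d \<noteq> \<zero>}"
      "y = (\<Oplus>d\<in>{d. c d \<noteq> \<zero>}. c d)" by blast
    have cc: "c \<in> A \<rightarrow> carrier R" for A using c(1) sub by (auto simp: subset_iff)
    \<comment> \<open>Adding \<open>x\<close> changes only the component of degree \<open>e\<close>.
      Since \<open>x\<close> may cancel \<open>c e\<close> or make it nonzero, the supports of
      \<open>c\<close> and \<open>c'\<close> can differ, and both sums are compared on the common
      finite set \<open>?D\<close>.\<close>
    define c' where "c' = c(e := x \<oplus> c e)"
    let ?D = "insert e {d. c d \<noteq> \<zero>}"
    have mem: "c' d \<in> I d" for d
      using c(1) add(1) I by (simp add: graded_submodule_def c'_def)
    have xc: "x \<in> carrier R" "c e \<in> carrier R"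
      using add(1) c(1) sub by (auto simp: subset_iff)
    have y: "y = (\<Oplus>d\<in>?D. c d)"
      unfolding c(3) by (rule add.finprod_mono_neutral_cong_left) (use c(2) cc in auto)
    have "(\<Oplus>d\<in>?D. c d) = c e \<oplus> (\<Oplus>d\<in>?D - {e}. c d)"
      using finsum_insert[of "?D - {e}" e c] c(2) cc xc by (simp add: insert_absorb)
    moreover have "(\<Oplus>d\<in>?D. c' d) = c' e \<oplus> (\<Oplus>d\<in>?D - {e}. c' d)"
    proof -
      have "c' \<in> ?D - {e} \<rightarrow> carrier R" "c' e \<in> carrier R"
        using cc xc by (auto simp: c'_def)
      then have "(\<Oplus>d\<in>insert e (?D - {e}). c' d) = c' e \<oplus> (\<Oplus>d\<in>?D - {e}. c' d)"
        using finsum_insert[of "?D - {e}" e c'] c(2) by blast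
      then show ?thesis by (simp only: insert_Diff_single insert_absorb2)
    qed
    moreover have "(\<Oplus>d\<in>?D - {e}. c' d) = (\<Oplus>d\<in>?D - {e}. c d)"
      by (rule finsum_cong') (use cc in \<open>auto simp: Pi_def c'_def\<close>)
    ultimately have "x \<oplus> y = (\<Oplus>d\<in>?D. c' d)"
      using y xc finsum_closed[OF cc] by (simp add: a_assoc c'_def)
    also have "\<dots> = (\<Oplus>d\<in>{d. c' d \<noteq> \<zero>}. c' d)"
      by (rule add.finprod_mono_neutral_cong_right) (use c(2) cc xc in \<open>auto simp: Pi_def c'_def\<close>)
    finally have "x \<oplus> y = (\<Oplus>d\<in>{d. c' d \<noteq> \<zero>}. c' d)" .
    moreover have "finite {d. c' d \<noteq> \<zero>}"
      by (rule finite_subset[of _ ?D]) (use c(2) in \<open>auto simp: c'_def\<close>)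
    ultimately show ?case using mem by blast
  qed
  then obtain c where c: "\<forall>d. c d \<in> I d" "finite {d. c d \<noteq> \<zero>}"
      "r = (\<Oplus>d\<in>{d. c d \<noteq> \<zero>}. c d)" by blast
  have r: "r \<in> carrier R" using assms(3) by blast
  \<comment> \<open>The competing decomposition of \<open>r\<close>, with \<open>r\<close> in degree
    \<open>d\<close> and zero elsewhere.\<close>
  let ?e = "\<lambda>e. if e = d then r else \<zero>"
  have "r = (\<Oplus>e\<in>{d}. ?e e)" using r by simp
  also have "\<dots> = (\<Oplus>e\<in>{e. ?e e \<noteq> \<zero>}. ?e e)"
    by (rule add.finprod_mono_neutral_cong_right) (use r in auto)
  finally have e1: "(\<forall>e. ?e e \<in> Rd e) \<and> finite {e. ?e e \<noteq> \<zero>} \<and> r = (\<Oplus>e\<in>{e. ?e e \<noteq> \<zero>}. ?e e)"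
    using assms(3) by auto
  have e2: "(\<forall>e. c e \<in> Rd e) \<and> finite {e. c e \<noteq> \<zero>} \<and> r = (\<Oplus>e\<in>{e. c e \<noteq> \<zero>}. c e)"
    using c sub by (simp add: subset_iff)
  note unique = the1_equality[OF decomposition[OF r]]
  have "c = ?e" using unique[OF e1] unique[OF e2] by (rule trans[OF sym, rotated])
  then have "c d = r" by simp
  moreover have "c d \<in> I d" using c(1) ..
  ultimately show ?thesis by simp
qed

lemma sums_of_mono:
  assumes "x \<in> sums_of I" "\<And>d. I d \<subseteq> J d"
  shows "x \<in> sums_of J"
  using assms(1)
proof induction
  case (add x d y)
  then show ?case using assms(2)[of d] sums_of.add[of x J d y] by blast
qed (rule sums_of.zero)

end

text \<open>Graded commutativity swaps the factors up to a sign, and the sign is absorbed by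
  multiplying with -1, which has degree 0.\<close>

lemma (in graded_commutative_ring) graded_ideal_right_mult:
  assumes "graded_ideal I" "x \<in> I d" "s \<in> Rd e"
  shows "x \<otimes> s \<in> I (d + e)"
proof -
  have x: "x \<in> Rd d" using assms by (auto simp: graded_submodule_def)
  have 1: "s \<otimes> x \<in> I (e + d)"
    using assms unfolding graded_submodule_def by auto
  have "\<ominus> \<one> \<in> Rd 0" using one_homogeneous by blast
  then have "\<ominus> \<one> \<otimes> (s \<otimes> x) \<in> I (0 + (e + d))"
    using assms(1) 1 unfolding graded_submodule_def by blast
  moreover have "\<ominus> \<one> \<otimes> (s \<otimes> x) = \<ominus> (s \<otimes> x)"
    using x assms(3) by (simp add: l_minus)
  ultimately show ?thesis
    using graded_commutative[OF x assms(3)] 1 by (simp add: add.commute)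
qed

text \<open>Two-sidedness is checked first for homogeneous multipliers, where
  \<open>graded_ideal_right_mult\<close> applies, and then extended to all multipliers by induction
  along \<open>carrier_eq_sums_of\<close>.\<close>

lemma (in graded_commutative_ring) sums_of_ideal:
  assumes I: "graded_ideal I"
  shows "ideal (sums_of I) R"
proof -
  have sub: "\<And>e. I e \<subseteq> Rd e"
    using I by (auto simp: graded_submodule_def)
  note closed = sums_of_closed[OF sub]
  have l: "s \<otimes> x \<in> sums_of I" if "x \<in> sums_of I" "s \<in> Rd e" for x s e
    using that(1)
  proof induction
    case zero
    show ?case using that(2) by (simp add: sums_of.zero)
  next
    case (add x d y)
    have "s \<otimes> x \<in> I (e + d)" using I add(1) that(2) by (auto simp: graded_submodule_def)
    from sums_of.add[of _ I, OF this add(3)] show ?case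
      using add closed that(2) sub by (metis homogeneous_closed r_distr subsetD)
  qed
  have r: "x \<otimes> s \<in> sums_of I" if "x \<in> sums_of I" "s \<in> Rd e" for x s e
    using that(1)
  proof induction
    case zero
    show ?case using that(2) by (simp add: sums_of.zero)
  next
    case (add x d y)
    have "x \<otimes> s \<in> I (d + e)" using graded_ideal_right_mult[OF I add(1) that(2)] .
    from sums_of.add[of _ I, OF this add(3)] show ?case
      using add closed that(2) sub by (metis homogeneous_closed l_distr subsetD)
  qed
  have L: "s \<otimes> x \<in> sums_of I" if s: "s \<in> carrier R" and x: "x \<in> sums_of I" for x s
    using s unfolding carrier_eq_sums_of
  proof induction
    case zero
    show ?case using closed[OF x] by (simp add: sums_of.zero)
  next
    case (add s d t)
    have "t \<in> carrier R" using add(2) carrier_eq_sums_of by simp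
    then have "(s \<oplus> t) \<otimes> x = s \<otimes> x \<oplus> t \<otimes> x"
      using add(1) closed[OF x] by (simp add: l_distr homogeneous_closed)
    then show ?case using sums_of_add[OF sub l[OF x add(1)] add(3)] by simp
  qed
  have Rr: "x \<otimes> s \<in> sums_of I" if s: "s \<in> carrier R" and x: "x \<in> sums_of I" for x s
    using s unfolding carrier_eq_sums_of
  proof induction
    case zero
    show ?case using closed[OF x] by (simp add: sums_of.zero)
  next
    case (add s d t)
    have "t \<in> carrier R" using add(2) carrier_eq_sums_of by simp
    then have "x \<otimes> (s \<oplus> t) = x \<otimes> s \<oplus> x \<otimes> t"
      using add(1) closed[OF x] by (simp add: r_distr homogeneous_closed)
    then show ?case using sums_of_add[OF sub r[OF x add(1)] add(3)] by simp
  qed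
  show ?thesis
  proof (rule idealI[OF ring_axioms])
    show "subgroup (sums_of I) (add_monoid R)"
    proof (rule add.subgroupI)
      show "sums_of I \<subseteq> carrier R" using closed by blast
      show "sums_of I \<noteq> {}" using sums_of.zero by blast
      fix a assume a: "a \<in> sums_of I"
      then have "\<ominus> \<one> \<otimes> a \<in> sums_of I" using L by simp
      then show "\<ominus> a \<in> sums_of I" using closed[OF a] by (simp add: l_minus)
      fix b assume "b \<in> sums_of I"
      with a show "a \<oplus> b \<in> sums_of I" by (rule sums_of_add[OF sub])
    qed
  qed (use L Rr in auto)
qed

lemma (in graded_ring) graded_ideal_span:
  assumes "\<And>d b. (d, b) \<in> B \<Longrightarrow> b \<in> Rd d"
  shows "graded_ideal (\<lambda>d. {r. graded_span Rd (\<oplus>) (\<lambda>_. \<zero>) left_mult B d r})"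
proof -
  have 0: "graded_ideal Rd"
    by (auto simp: graded_submodule_def intro: mult_homogeneous)
  have "graded_span Rd (\<oplus>) (\<lambda>_. \<zero>) left_mult B d r \<Longrightarrow> r \<in> Rd d" for d r
    by (rule graded_span_in_submodule[OF _ 0]) (use assms in auto)
  then show ?thesis
    using graded_span.zero[of Rd "(\<oplus>)" "\<lambda>_. \<zero>" left_mult B]
      graded_span.add[of Rd "(\<oplus>)" "\<lambda>_. \<zero>" left_mult B]
      graded_span.act[of _ Rd _ "(\<oplus>)" "\<lambda>_. \<zero>" left_mult B]
    unfolding graded_submodule_def by (simp add: Collect_mono_iff subset_iff)
qed

text \<open>Noetherianity yields finitely many generators that need not be homogeneous. Replacing
  each by the finitely many homogeneous terms of a sum representing it gives homogeneous generators
  of the same ideal, and \<open>sums_of_homogeneous\<close> brings the result back to each single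
  degree.\<close>

lemma (in graded_commutative_ring) graded_ideal_finitely_generated:
  assumes noeth: "noetherian_ring R" and I: "graded_ideal I"
  shows "\<exists>B. finite B \<and> (\<forall>(d, b)\<in>B. b \<in> I d) \<and>
    (\<forall>d. \<forall>r\<in>I d. graded_span Rd (\<oplus>) (\<lambda>_. \<zero>) left_mult B d r)"
proof -
  have sub: "\<And>e. I e \<subseteq> Rd e"
    using I by (auto simp: graded_submodule_def)
  obtain A where A: "A \<subseteq> carrier R" "finite A" "sums_of I = Idl A"
    using noetherian_ring.finetely_gen[OF noeth sums_of_ideal[OF I]] by blast
  \<comment> \<open>\<open>B\<close> collects the homogeneous terms, with their degrees, from which
    \<open>a\<close> is summed up.\<close>
  have "\<exists>B. finite B \<and> (\<forall>(d, b)\<in>B. b \<in> I d) \<and> a \<in> sums_of (\<lambda>d. {b. (d, b) \<in> B})"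
    if "a \<in> sums_of I" for a
    using that
  proof induction
    case zero
    show ?case by (rule exI[of _ "{}"]) (simp add: sums_of.zero)
  next
    case (add x d y)
    then obtain B where B: "finite B" "\<forall>(d, b)\<in>B. b \<in> I d"
      "y \<in> sums_of (\<lambda>d. {b. (d, b) \<in> B})" by blast
    have "y \<in> sums_of (\<lambda>e. {b. (e, b) \<in> insert (d, x) B})"
      by (rule sums_of_mono[OF B(3)]) blast
    then have "x \<oplus> y \<in> sums_of (\<lambda>e. {b. (e, b) \<in> insert (d, x) B})"
      by (intro sums_of.add[of x _ d]) auto
    then show ?case using B add(1) by (intro exI[of _ "insert (d, x) B"]) auto
  qed
  moreover have "a \<in> sums_of I" if "a \<in> A" for a
    using genideal_self[OF A(1)] A(3) that by blast
  ultimately have "\<forall>a\<in>A. \<exists>B. finite B \<and> (\<forall>(d, b)\<in>B. b \<in> I d) \<and> a \<in> sums_of (\<lambda>d. {b. (d, b) \<in> B})"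
    by blast
  then obtain B where B: "\<And>a. a \<in> A \<Longrightarrow> finite (B a)" "\<And>a d b. a \<in> A \<Longrightarrow> (d, b) \<in> B a \<Longrightarrow> b \<in> I d"
    "\<And>a. a \<in> A \<Longrightarrow> a \<in> sums_of (\<lambda>d. {b. (d, b) \<in> B a})"
    unfolding bchoice_iff by fastforce
  let ?B = "\<Union>a\<in>A. B a"
  let ?J = "\<lambda>d. {r. graded_span Rd (\<oplus>) (\<lambda>_. \<zero>) left_mult ?B d r}"
  have J: "graded_ideal ?J"
    by (rule graded_ideal_span) (use B(2) sub in blast)
  have "A \<subseteq> sums_of ?J"
  proof
    fix a assume a: "a \<in> A"
    show "a \<in> sums_of ?J"
      by (rule sums_of_mono[OF B(3)[OF a]]) (use a in \<open>auto intro: graded_span.gen\<close>)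
  qed
  then have "sums_of I \<subseteq> sums_of ?J"
    unfolding A(3) by (rule genideal_minimal[OF sums_of_ideal[OF J]])
  moreover have "r \<in> sums_of I" if "r \<in> I d" for r d
    using sums_of.add[of r I d \<zero>, OF that sums_of.zero] that sub by fastforce
  ultimately have "r \<in> ?J d" if "r \<in> I d" for r d
    using sums_of_homogeneous[OF J] that sub by blast
  then show ?thesis using A(2) B(1,2) by (intro exI[of _ ?B]) blast
qed

text \<open>The degrees are arguments of \<open>act\<close> because in the application the action
  composes with a component of a natural transformation at an object that depends on the degree.
  Additively only a commutative monoid is required; negatives come from the action of -1, see
  \<open>pl_neg\<close>.\<close>

locale graded_module = graded_commutative_ring R Rd
  for R :: "('r, 'x) ring_scheme" (structure) and Rd +
  fixes M :: "int \<Rightarrow> 'm set" and pl :: "'m \<Rightarrow> 'm \<Rightarrow> 'm" and z :: "int \<Rightarrow> 'm"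
    and act :: "int \<Rightarrow> 'r \<Rightarrow> int \<Rightarrow> 'm \<Rightarrow> 'm"
  assumes pl_closed: "\<lbrakk>h \<in> M e; h' \<in> M e\<rbrakk> \<Longrightarrow> pl h h' \<in> M e"
    and pl_assoc: "\<lbrakk>h \<in> M e; h' \<in> M e; h'' \<in> M e\<rbrakk> \<Longrightarrow> pl (pl h h') h'' = pl h (pl h' h'')"
    and pl_comm: "\<lbrakk>h \<in> M e; h' \<in> M e\<rbrakk> \<Longrightarrow> pl h h' = pl h' h"
    and z_closed: "z e \<in> M e"
    and z_pl: "h \<in> M e \<Longrightarrow> pl (z e) h = h"
    and act_closed: "\<lbrakk>r \<in> Rd d; h \<in> M e\<rbrakk> \<Longrightarrow> act d r e h \<in> M (d + e)"
    and act_pl: "\<lbrakk>r \<in> Rd d; h \<in> M e; h' \<in> M e\<rbrakk> \<Longrightarrow>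
      act d r e (pl h h') = pl (act d r e h) (act d r e h')"
    and act_z: "r \<in> Rd d \<Longrightarrow> act d r e (z e) = z (d + e)"
    and add_act: "\<lbrakk>r \<in> Rd d; r' \<in> Rd d; h \<in> M e\<rbrakk> \<Longrightarrow>
      act d (r \<oplus> r') e h = pl (act d r e h) (act d r' e h)"
    and zero_act: "h \<in> M e \<Longrightarrow> act d \<zero> e h = z (d + e)"
    and mult_act: "\<lbrakk>r \<in> Rd d; r' \<in> Rd d'; h \<in> M e\<rbrakk> \<Longrightarrow>
      act (d + d') (r \<otimes> r') e h = act d r (d' + e) (act d' r' e h)"
    and one_act: "h \<in> M e \<Longrightarrow> act 0 \<one> e h = h"
begin

abbreviation span :: "(int \<times> 'm) set \<Rightarrow> int \<Rightarrow> 'm \<Rightarrow> bool" where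
  "span \<equiv> graded_span Rd pl z act"

abbreviation submodule :: "(int \<Rightarrow> 'm set) \<Rightarrow> bool" where
  "submodule \<equiv> graded_submodule Rd M pl z act"

lemma submodule_whole: "submodule M"
  by (auto simp: graded_submodule_def pl_closed z_closed act_closed)

lemma span_closed: "\<lbrakk>span \<G> e h; \<And>e g. (e, g) \<in> \<G> \<Longrightarrow> g \<in> M e\<rbrakk> \<Longrightarrow> h \<in> M e"
  using graded_span_in_submodule[OF _ submodule_whole] .

lemma pl_neg:
  assumes "h \<in> M e"
  shows "pl h (act 0 (\<ominus> \<one>) e h) = z e"
proof -
  have "act 0 (\<one> \<oplus> \<ominus> \<one>) e h = pl (act 0 \<one> e h) (act 0 (\<ominus> \<one>) e h)"
    using add_act assms one_homogeneous homogeneous_neg by blast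
  then show ?thesis using assms zero_act[of h e 0] by (simp add: one_act r_neg)
qed

lemma pl_swap:
  assumes "a \<in> M e" "b \<in> M e" "c \<in> M e" "d \<in> M e"
  shows "pl (pl a b) (pl c d) = pl (pl a c) (pl b d)"
proof -
  have "pl (pl a b) (pl c d) = pl a (pl (pl b c) d)"
    using assms by (simp add: pl_assoc[of _ e] pl_closed)
  also have "pl b c = pl c b" using assms pl_comm by blast
  also have "pl a (pl (pl c b) d) = pl (pl a c) (pl b d)"
    using assms by (simp add: pl_assoc[of _ e] pl_closed)
  finally show ?thesis .
qed

text \<open>All occurrences of the new generator are collected into one homogeneous coefficient:
  sums add coefficients and nested actions multiply them, so the degree of the coefficient is forced
  to be \<open>d - e0\<close>.\<close>

lemma span_insert:
  assumes "span (insert (e0, g) \<G>) d h" "g \<in> M e0" "\<And>e g. (e, g) \<in> \<G> \<Longrightarrow> g \<in> M e"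
  shows "\<exists>r\<in>Rd (d - e0). \<exists>s. span \<G> d s \<and> h = pl (act (d - e0) r e0 g) s"
  using assms(1)
proof induction
  case (gen e h)
  note closed = span_closed[OF _ assms(3)]
  show ?case
  proof (cases "(e, h) = (e0, g)")
    case True
    moreover have "pl g (z e0) = g"
      using assms(2) pl_comm z_closed z_pl by metis
    ultimately show ?thesis
      using one_homogeneous one_act[OF assms(2)] graded_span.zero[of Rd pl z act \<G> e0]
      by (intro bexI[of _ \<one>] exI[of _ "z e0"]) auto
  next
    case False
    then have h: "span \<G> e h" using gen by (auto intro: graded_span.gen)
    then show ?thesis
      using zero_act[OF assms(2), of "e - e0"] z_pl[OF closed[OF h]]
      by (intro bexI[of _ \<zero>] exI[of _ h]) auto
  qed
next
  case (zero e)
  show ?case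
    using zero_act[OF assms(2), of "e - e0"] z_pl[OF z_closed, of e] graded_span.zero[of Rd pl z act \<G> e]
    by (intro bexI[of _ \<zero>] exI[of _ "z e"]) auto
next
  case (add e h h')
  note closed = span_closed[OF _ assms(3)]
  obtain r s r' s' where rs: "r \<in> Rd (e - e0)" "span \<G> e s" "h = pl (act (e - e0) r e0 g) s"
    and rs': "r' \<in> Rd (e - e0)" "span \<G> e s'" "h' = pl (act (e - e0) r' e0 g) s'"
    using add by blast
  have a: "act (e - e0) r e0 g \<in> M e" "act (e - e0) r' e0 g \<in> M e"
    using act_closed[OF rs(1) assms(2)] act_closed[OF rs'(1) assms(2)] by simp_all
  have "pl h h' = pl (act (e - e0) (r \<oplus> r') e0 g) (pl s s')"
    using rs rs' pl_swap[OF a(1) closed a(2) closed] add_act[OF rs(1) rs'(1) assms(2)] by simp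
  then show ?case using rs rs' by (blast intro: graded_span.add)
next
  case (act r d e h)
  note closed = span_closed[OF _ assms(3)]
  obtain r' s where rs: "r' \<in> Rd (e - e0)" "span \<G> e s" "h = pl (act (e - e0) r' e0 g) s"
    using act by blast
  have "act (e - e0) r' e0 g \<in> M e" using act_closed[OF rs(1) assms(2)] by simp
  then have "act d r e h = pl (act d r e (act (e - e0) r' e0 g)) (act d r e s)"
    using act_pl[OF act(1)] rs closed by blast
  moreover have "act (d + (e - e0)) (r \<otimes> r') e0 g = act d r e (act (e - e0) r' e0 g)"
    using mult_act[OF act(1) rs(1) assms(2)] by simp
  moreover have "r \<otimes> r' \<in> Rd (d + (e - e0))" using mult_homogeneous act(1) rs(1) .
  moreover have "d + e - e0 = d + (e - e0)" by simp
  ultimately show ?case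
    using rs(2) graded_span.act[of r Rd d pl z act \<G> e s] act(1) by metis
qed

text \<open>Induction on the generating set of the ambient span. \<open>N\<close> is generated by
  \<open>\<H>\<^sub>1\<close>, elements of \<open>N\<close> that realise finitely many generators of
  the ideal of coefficients of \<open>g\<close>, together with \<open>\<H>\<^sub>2\<close>,
  generators of the part of \<open>N\<close> lying in the span of the remaining generators.\<close>

lemma submodule_finitely_generated:
  assumes noeth: "noetherian_ring R" and "finite \<G>" "\<And>e g. (e, g) \<in> \<G> \<Longrightarrow> g \<in> M e"
    and "submodule N" "\<And>e h. h \<in> N e \<Longrightarrow> span \<G> e h"
  shows "\<exists>\<H>. finite \<H> \<and> (\<forall>(e, h)\<in>\<H>. h \<in> N e) \<and> (\<forall>e. \<forall>h\<in>N e. span \<H> e h)"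
  using assms(2-)
proof (induction \<G> arbitrary: N rule: finite_induct)
  case empty
  then show ?case by (intro exI[of _ "{}"]) auto
next
  case (insert eg \<G>)
  obtain e0 g where [simp]: "eg = (e0, g)" by (cases eg)
  note N = insert.prems(2)
  have g: "g \<in> M e0" and \<G>: "\<And>e g. (e, g) \<in> \<G> \<Longrightarrow> g \<in> M e" using insert.prems(1) by auto
  note closed = span_closed[OF _ \<G>]
  have NM: "n \<in> N e \<Longrightarrow> n \<in> M e" for n e using N by (auto simp: graded_submodule_def)
  have Nz: "z e \<in> N e" for e using N by (auto simp: graded_submodule_def)
  have Npl: "h \<in> N e \<Longrightarrow> h' \<in> N e \<Longrightarrow> pl h h' \<in> N e" for h h' e
    using N by (auto simp: graded_submodule_def)
  have Nact: "r \<in> Rd d \<Longrightarrow> h \<in> N e \<Longrightarrow> act d r e h \<in> N (d + e)" for r d h e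
    using N by (auto simp: graded_submodule_def)
  \<comment> \<open>As in Hilbert's basis theorem: \<open>lead P d r\<close> says that \<open>r\<close> is the coefficient of \<open>g\<close> of an element
    of \<open>P\<close>, modulo the span of \<open>\<G>\<close>; for \<open>P = N\<close> these coefficients form a graded ideal.\<close>
  define lead where "lead P d r \<longleftrightarrow> (\<exists>n s. P (d + e0) n \<and> span \<G> (d + e0) s \<and> n = pl (act d r e0 g) s)"
    for P d r
  define I where "I d = {r \<in> Rd d. lead (\<lambda>e n. n \<in> N e) d r}" for d
  have lead_zero: "lead P d \<zero>" if "P (d + e0) (z (d + e0))" for P d
    unfolding lead_def using that zero_act[OF g, of d] z_pl[OF z_closed] graded_span.zero by metis
  have lead_add: "lead P d (r \<oplus> r')"
    if P: "\<And>e n n'. P e n \<Longrightarrow> P e n' \<Longrightarrow> P e (pl n n')"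
      and "r \<in> Rd d" "r' \<in> Rd d" "lead P d r" "lead P d r'" for P d r r'
  proof -
    obtain n s n' s' where ns: "P (d + e0) n" "span \<G> (d + e0) s" "n = pl (act d r e0 g) s"
      and ns': "P (d + e0) n'" "span \<G> (d + e0) s'" "n' = pl (act d r' e0 g) s'"
      using \<open>lead P d r\<close> \<open>lead P d r'\<close> unfolding lead_def by metis
    have "pl n n' = pl (act d (r \<oplus> r') e0 g) (pl s s')"
      using ns ns' that pl_swap[OF act_closed closed act_closed closed] g add_act by metis
    then show ?thesis unfolding lead_def using P ns ns' by (blast intro: graded_span.add)
  qed
  have lead_act: "lead P (d + e) (r \<otimes> x)"
    if P: "\<And>r d e n. r \<in> Rd d \<Longrightarrow> P e n \<Longrightarrow> P (d + e) (act d r e n)"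
      and "r \<in> Rd d" "x \<in> Rd e" "lead P e x" for P d e r x
  proof -
    obtain n s where ns: "P (e + e0) n" "span \<G> (e + e0) s" "n = pl (act e x e0 g) s"
      using \<open>lead P e x\<close> unfolding lead_def by metis
    have "act d r (e + e0) n = pl (act d r (e + e0) (act e x e0 g)) (act d r (e + e0) s)"
      unfolding ns(3) using act_pl[OF that(2)] act_closed[OF that(3) g] closed[OF ns(2)] by blast
    also have "act d r (e + e0) (act e x e0 g) = act (d + e) (r \<otimes> x) e0 g"
      using mult_act[OF that(2,3) g] by simp
    finally show ?thesis
      unfolding lead_def add.assoc
      using P[OF that(2) ns(1)] graded_span.act[of r Rd d pl z act \<G>, OF that(2) ns(2)] by blast
  qed
  have "graded_ideal I"
    unfolding graded_submodule_def I_def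
    using lead_zero[of "\<lambda>e n. n \<in> N e"] lead_add[of "\<lambda>e n. n \<in> N e"] lead_act[of "\<lambda>e n. n \<in> N e"]
      Nz Npl Nact mult_homogeneous by auto
  from graded_ideal_finitely_generated[OF noeth this] obtain B where
    B: "finite B" "\<And>d b. (d, b) \<in> B \<Longrightarrow> b \<in> I d"
    "\<And>d r. r \<in> I d \<Longrightarrow> graded_span Rd (\<oplus>) (\<lambda>_. \<zero>) left_mult B d r" by blast
  have "\<forall>x\<in>B. \<exists>n. n \<in> N (fst x + e0) \<and>
      (\<exists>s. span \<G> (fst x + e0) s \<and> n = pl (act (fst x) (snd x) e0 g) s)"
    using B(2) unfolding I_def lead_def by fastforce
  then obtain n where n: "\<And>x. x \<in> B \<Longrightarrow> n x \<in> N (fst x + e0)"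
    "\<And>x. x \<in> B \<Longrightarrow> \<exists>s. span \<G> (fst x + e0) s \<and> n x = pl (act (fst x) (snd x) e0 g) s"
    unfolding bchoice_iff by blast
  define \<H>\<^sub>1 where "\<H>\<^sub>1 = (\<lambda>x. (fst x + e0, n x)) ` B"
  have H1sub: "h \<in> N e" if "(e, h) \<in> \<H>\<^sub>1" for e h
  proof -
    from that obtain x where "x \<in> B" "e = fst x + e0" "h = n x" unfolding \<H>\<^sub>1_def by blast
    then show ?thesis using n(1) by simp
  qed
  have H1N: "h \<in> N e" if "span \<H>\<^sub>1 e h" for e h
    by (rule graded_span_in_submodule[OF that N]) (rule H1sub)
  \<comment> \<open>With \<open>P\<close> now the span of \<open>\<H>\<^sub>1\<close> instead of
    \<open>N\<close>, the same closure facts about \<open>lead\<close> show that every coefficient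
    in the ideal is attained by an element of this span.\<close>
  have H1: "r \<in> Rd d \<and> lead (span \<H>\<^sub>1) d r"
    if "graded_span Rd (\<oplus>) (\<lambda>_. \<zero>) left_mult B d r" for d r
    using that
  proof induction
    case (gen d r)
    have "span \<H>\<^sub>1 (d + e0) (n (d, r))"
      by (rule graded_span.gen) (use gen in \<open>force simp: \<H>\<^sub>1_def\<close>)
    then show ?case
      using n(2)[OF gen] B(2)[OF gen] unfolding lead_def I_def by auto
  next
    case (zero e)
    show ?case using lead_zero[of "span \<H>\<^sub>1" e] graded_span.zero[of Rd pl z act] by simp
  next
    case (add e h h')
    then show ?case
      using lead_add[of "span \<H>\<^sub>1" h e h'] graded_span.add[of Rd pl z act \<H>\<^sub>1]
      by (metis homogeneous_add)
  next
    case (act r d e h)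
    have "lead (span \<H>\<^sub>1) (d + e) (r \<otimes> h)"
    proof (rule lead_act)
      show "span \<H>\<^sub>1 (d' + e') (act d' r' e' n)"
        if "r' \<in> Rd d'" "span \<H>\<^sub>1 e' n" for r' d' e' n
        using graded_span.act[of r' Rd d' pl z act, OF that] .
    qed (use act in auto)
    then show ?case using mult_homogeneous act by blast
  qed
  \<comment> \<open>The elements of \<open>N\<close> that can be written without \<open>g\<close>;
    the induction hypothesis applies to them.\<close>
  define N' where "N' e = {n \<in> N e. span \<G> e n}" for e
  have "submodule N'"
    using NM Nz Npl Nact unfolding graded_submodule_def N'_def
    using graded_span.act[of _ Rd _ pl z act \<G>] by (simp add: graded_span.zero graded_span.add subset_iff)
  from insert.IH[OF \<G> this] obtain \<H>\<^sub>2 where H2: "finite \<H>\<^sub>2" "\<And>e h. (e, h) \<in> \<H>\<^sub>2 \<Longrightarrow> h \<in> N e"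
    "\<And>e h. h \<in> N' e \<Longrightarrow> span \<H>\<^sub>2 e h"
    unfolding N'_def by blast
  have "span (\<H>\<^sub>1 \<union> \<H>\<^sub>2) e h" if h: "h \<in> N e" for e h
  proof -
    have "span (insert (e0, g) \<G>) e h" using insert.prems(3)[OF h] by simp
    from span_insert[OF this g \<G>] obtain r s where rs: "r \<in> Rd (e - e0)" "span \<G> e s"
      "h = pl (act (e - e0) r e0 g) s" by blast
    have "r \<in> I (e - e0)" unfolding I_def lead_def using rs h by auto
    from H1[OF B(3)[OF this]] obtain n s' where n: "span \<H>\<^sub>1 e n" "span \<G> e s'"
      "n = pl (act (e - e0) r e0 g) s'" unfolding lead_def by auto
    \<comment> \<open>\<open>n\<close> has the same coefficient of \<open>g\<close> as
      \<open>h\<close>, so in \<open>h - n\<close> the \<open>g\<close>-terms cancel and what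
      remains lies in \<open>N'\<close>. The four abbreviations are the negatives and the
      \<open>g\<close>-term needed to carry out this subtraction.\<close>
    define m where "m = act 0 (\<ominus> \<one>) e n"
    define t where "t = act 0 (\<ominus> \<one>) e s'"
    define a where "a = act (e - e0) r e0 g"
    define a' where "a' = act 0 (\<ominus> \<one>) e a"
    have one: "\<ominus> \<one> \<in> Rd 0" using one_homogeneous by blast
    have nN: "n \<in> N e" using H1N[OF n(1)] .
    have mN: "m \<in> N e" unfolding m_def using Nact[OF one nN] by simp
    have tG: "span \<G> e t" unfolding t_def
      using graded_span.act[of "\<ominus> \<one>" Rd 0 pl z act, OF one n(2)] by simp
    have aM: "a \<in> M e" unfolding a_def using act_closed[OF rs(1) g] by simp
    have a'M: "a' \<in> M e" unfolding a'_def using act_closed[OF one aM] by simp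
    have m: "m = pl a' t" unfolding m_def n(3) a'_def t_def
      using act_pl[OF one aM closed[OF n(2)]] a_def by simp
    have "pl h m = pl (pl a s) (pl a' t)" using m rs(3) a_def by simp
    also have "\<dots> = pl (pl a a') (pl s t)"
      using pl_swap aM a'M closed[OF rs(2)] closed[OF tG] by blast
    also have "pl a a' = z e" unfolding a'_def using pl_neg[OF aM] .
    also have "pl (z e) (pl s t) = pl s t"
      using z_pl pl_closed closed[OF rs(2)] closed[OF tG] by blast
    finally have "span \<G> e (pl h m)" using rs(2) tG by (simp add: graded_span.add)
    then have "pl h m \<in> N' e" unfolding N'_def using Npl[OF h mN] by blast
    then have 1: "span (\<H>\<^sub>1 \<union> \<H>\<^sub>2) e (pl h m)" by (intro graded_span_mono[OF H2(3)]) auto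
    have "pl (pl h m) n = pl h (pl n m)"
      using pl_assoc[of h e m n] pl_comm[of m e n] NM h mN nN by auto
    also have "pl n m = z e" unfolding m_def using pl_neg[OF NM[OF nN]] .
    also have "pl h (z e) = h" using pl_comm[of h e "z e"] z_pl z_closed NM h by auto
    finally have "h = pl (pl h m) n" by simp
    moreover have "span (\<H>\<^sub>1 \<union> \<H>\<^sub>2) e n" by (intro graded_span_mono[OF n(1)]) auto
    ultimately show ?thesis using 1 graded_span.add[of Rd pl z act _ e "pl h m" n] by simp
  qed
  moreover have "finite (\<H>\<^sub>1 \<union> \<H>\<^sub>2)" using B(1) H2(1) by (simp add: \<H>\<^sub>1_def)
  moreover have "\<forall>(e, h)\<in>\<H>\<^sub>1 \<union> \<H>\<^sub>2. h \<in> N e" using H1sub H2(2) by blast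
  ultimately show ?case by blast
qed

end

section \<open>Additive and triangulated categories\<close>

context category
begin

lemma Hom_Obj: "f \<in> Hom C X Y \<Longrightarrow> X \<in> Obj C \<and> Y \<in> Obj C"
  using Dom_in_Obj Cod_in_Obj unfolding Hom_def by blast

lemma Hom_unique: "\<lbrakk>f \<in> Hom C X Y; f \<in> Hom C X' Y'\<rbrakk> \<Longrightarrow> X = X' \<and> Y = Y'"
  unfolding Hom_def by blast

lemma Hom_Arr: "f \<in> Hom C X Y \<Longrightarrow> f \<in> Arr C"
  unfolding Hom_def by blast

lemma Arr_Hom: "f \<in> Arr C \<Longrightarrow> f \<in> Hom C (Dom C f) (Cod C f)"
  unfolding Hom_def by blast

lemma inverse_arrs_inv_arr:
  assumes "is_iso_arr C f"
  shows "inverse_arrs C f (inv_arr C f)"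
proof -
  obtain g where g: "inverse_arrs C f g" using assms unfolding is_iso_arr_def by blast
  show ?thesis
    unfolding inv_arr_def
  proof (rule theI[of _ g], rule g)
    fix h assume "inverse_arrs C f h"
    then have h: "h \<in> Hom C (Cod C f) (Dom C f)" "f \<in> Hom C (Dom C f) (Cod C f)"
      "h \<cdot> f = idt C (Dom C f)" unfolding inverse_arrs_def by auto
    have g': "g \<in> Hom C (Cod C f) (Dom C f)" "f \<cdot> g = idt C (Cod C f)"
      using g unfolding inverse_arrs_def by auto
    have "h = h \<cdot> (f \<cdot> g)" using comp_idt[OF h(1)] g' by simp
    also have "\<dots> = (h \<cdot> f) \<cdot> g" using comp_assoc[OF g'(1) h(2,1)] .
    also have "\<dots> = g" using h(3) idt_comp[OF g'(1)] by simp
    finally show "h = g" .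
  qed
qed

lemma iso_inverse:
  assumes "is_iso_arr C f" "f \<in> Hom C X Y"
  shows "inv_arr C f \<in> Hom C Y X" "inv_arr C f \<cdot> f = idt C X" "f \<cdot> inv_arr C f = idt C Y"
  using inverse_arrs_inv_arr[OF assms(1)] assms(2) unfolding inverse_arrs_def Hom_def by auto

lemma iso_cancel:
  assumes "is_iso_arr C f" "f \<in> Hom C X Y" "g \<in> Hom C Y Z" "h \<in> Hom C Y Z" "g \<cdot> f = h \<cdot> f"
  shows "g = h"
proof -
  have "k = (k \<cdot> f) \<cdot> inv_arr C f" if "k \<in> Hom C Y Z" for k
    using comp_assoc[OF iso_inverse(1)[OF assms(1,2)] assms(2) that] iso_inverse(3)[OF assms(1,2)]
      comp_idt[OF that] by simp
  then show ?thesis using assms(3-5) by metis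
qed

end

text \<open>Finite sums of composites through objects of \<open>\<X>\<close>. That the identity of X
  is such a sum says that X is a retract of a finite coproduct of objects of \<open>\<X>\<close>.
  This equational form treats coproducts and retracts alike and is visibly preserved by
  shifts.\<close>

inductive_set factor_sums ::
    "('o, 'm, 'x) additive_category_scheme \<Rightarrow> 'o set \<Rightarrow> 'o \<Rightarrow> 'o \<Rightarrow> 'm set"
  for C \<X> X Y where
  zero: "zero_arr C X Y \<in> factor_sums C \<X> X Y"
| add: "\<lbrakk>y \<in> Hom C X W; W \<in> \<X>; x \<in> Hom C W Y; f \<in> factor_sums C \<X> X Y\<rbrakk> \<Longrightarrow>
    f \<boxplus>\<^bsub>C\<^esub> x \<cdot>\<^bsub>C\<^esub> y \<in> factor_sums C \<X> X Y"

section \<open>Arithmetic of morphisms, biproducts, and identities as sums of factorizations\<close>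

context additive_category
begin

lemma add_in_Hom: "\<lbrakk>f \<in> Hom C X Y; g \<in> Hom C X Y\<rbrakk> \<Longrightarrow> f \<boxplus> g \<in> Hom C X Y"
  and add_arr_comm: "\<lbrakk>f \<in> Hom C X Y; g \<in> Hom C X Y\<rbrakk> \<Longrightarrow> f \<boxplus> g = g \<boxplus> f"
  and add_arr_assoc: "\<lbrakk>f \<in> Hom C X Y; g \<in> Hom C X Y; h \<in> Hom C X Y\<rbrakk> \<Longrightarrow>
    (f \<boxplus> g) \<boxplus> h = f \<boxplus> (g \<boxplus> h)"
  and zero_add: "f \<in> Hom C X Y \<Longrightarrow> zero_arr C X Y \<boxplus> f = f"
  and add_zero: "f \<in> Hom C X Y \<Longrightarrow> f \<boxplus> zero_arr C X Y = f"
  and neg_in_Hom: "f \<in> Hom C X Y \<Longrightarrow> neg_arr C f \<in> Hom C X Y"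
  and add_neg: "f \<in> Hom C X Y \<Longrightarrow> f \<boxplus> neg_arr C f = zero_arr C X Y"
  and neg_add: "f \<in> Hom C X Y \<Longrightarrow> neg_arr C f \<boxplus> f = zero_arr C X Y"
proof -
  have ag: "abelian_group (hom_group C X Y)" if "f \<in> Hom C X Y" for f
    using hom_abelian_group Hom_Obj[OF that] by blast
  have neg: "neg_arr C f = \<ominus>\<^bsub>hom_group C X Y\<^esub> f" if "f \<in> Hom C X Y" for f
    using that unfolding neg_arr_def Hom_def by simp
  show "\<lbrakk>f \<in> Hom C X Y; g \<in> Hom C X Y\<rbrakk> \<Longrightarrow> f \<boxplus> g \<in> Hom C X Y"
    using abelian_monoid.a_closed[OF abelian_group.axioms(1)[OF ag], of f f g]
    by (simp add: hom_group_def)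
  show "\<lbrakk>f \<in> Hom C X Y; g \<in> Hom C X Y\<rbrakk> \<Longrightarrow> f \<boxplus> g = g \<boxplus> f"
    using abelian_monoid.a_comm[OF abelian_group.axioms(1)[OF ag], of f f g]
    by (simp add: hom_group_def)
  show "\<lbrakk>f \<in> Hom C X Y; g \<in> Hom C X Y; h \<in> Hom C X Y\<rbrakk> \<Longrightarrow> (f \<boxplus> g) \<boxplus> h = f \<boxplus> (g \<boxplus> h)"
    using abelian_monoid.a_assoc[OF abelian_group.axioms(1)[OF ag], of f f g h]
    by (simp add: hom_group_def)
  show "f \<in> Hom C X Y \<Longrightarrow> zero_arr C X Y \<boxplus> f = f"
    using abelian_monoid.l_zero[OF abelian_group.axioms(1)[OF ag], of f f]
    by (simp add: hom_group_def)
  show "f \<in> Hom C X Y \<Longrightarrow> f \<boxplus> zero_arr C X Y = f"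
    using abelian_monoid.r_zero[OF abelian_group.axioms(1)[OF ag], of f f]
    by (simp add: hom_group_def)
  show "f \<in> Hom C X Y \<Longrightarrow> neg_arr C f \<in> Hom C X Y"
    using abelian_group.a_inv_closed[OF ag, of f f] neg
    by (simp add: hom_group_def)
  show "f \<in> Hom C X Y \<Longrightarrow> f \<boxplus> neg_arr C f = zero_arr C X Y"
    using abelian_group.r_neg[OF ag, of f f] neg by (simp add: hom_group_def)
  show "f \<in> Hom C X Y \<Longrightarrow> neg_arr C f \<boxplus> f = zero_arr C X Y"
    using abelian_group.l_neg[OF ag, of f f] neg by (simp add: hom_group_def)
qed

lemma zero_in_Hom: "\<lbrakk>X \<in> Obj C; Y \<in> Obj C\<rbrakk> \<Longrightarrow> zero_arr C X Y \<in> Hom C X Y"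
  using abelian_monoid.zero_closed[OF abelian_group.axioms(1)[OF hom_abelian_group]]
  by (simp add: hom_group_def)

text \<open>Source of the zero laws below: an additive map sends zero to an element equal to its own
  double.\<close>

lemma add_idem_zero:
  assumes "f \<in> Hom C X Y" "f \<boxplus> f = f"
  shows "f = zero_arr C X Y"
proof -
  have "f = f \<boxplus> (f \<boxplus> neg_arr C f)" using add_neg add_zero assms(1) by simp
  also have "\<dots> = f \<boxplus> neg_arr C f" using add_arr_assoc[of f X Y f "neg_arr C f"] neg_in_Hom assms by simp
  finally show ?thesis using add_neg assms(1) by simp
qed

lemma comp_zero: "\<lbrakk>X \<in> Obj C; g \<in> Hom C Y Z\<rbrakk> \<Longrightarrow> g \<cdot> zero_arr C X Y = zero_arr C X Z"
  using Hom_Obj[of g] zero_in_Hom[of X Y] zero_add comp_add[of "zero_arr C X Y" X Y "zero_arr C X Y" g Z]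
  by (intro add_idem_zero) (auto intro: comp_in_Hom)

lemma zero_comp: "\<lbrakk>Z \<in> Obj C; f \<in> Hom C X Y\<rbrakk> \<Longrightarrow> zero_arr C Y Z \<cdot> f = zero_arr C X Z"
  using Hom_Obj[of f] zero_in_Hom[of Y Z] zero_add add_comp[of f X Y "zero_arr C Y Z" Z "zero_arr C Y Z"]
  by (intro add_idem_zero) (auto intro: comp_in_Hom)

lemma add_eq_zero_unique:
  assumes "f \<in> Hom C X Y" "g \<in> Hom C X Y" "h \<in> Hom C X Y"
    "f \<boxplus> g = zero_arr C X Y" "h \<boxplus> g = zero_arr C X Y"
  shows "f = h"
proof -
  have "f = f \<boxplus> (g \<boxplus> h)" using assms add_arr_comm[of g X Y h] add_zero by simp
  also have "\<dots> = h" using assms add_arr_assoc[of f X Y g h] zero_add by simp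
  finally show ?thesis .
qed

lemma eq_of_diff_zero:
  assumes "f \<in> Hom C X Y" "g \<in> Hom C X Y" "f \<boxplus> neg_arr C g = zero_arr C X Y"
  shows "f = g"
  using add_eq_zero_unique[OF assms(1) neg_in_Hom[OF assms(2)] assms(2,3) add_neg[OF assms(2)]] .

lemma comp_neg:
  assumes "f \<in> Hom C X Y" "g \<in> Hom C Y Z"
  shows "g \<cdot> neg_arr C f = neg_arr C (g \<cdot> f)"
proof -
  have gf: "g \<cdot> f \<in> Hom C X Z" and gn: "g \<cdot> neg_arr C f \<in> Hom C X Z"
    using assms neg_in_Hom comp_in_Hom by blast+
  have "g \<cdot> neg_arr C f \<boxplus> g \<cdot> f = zero_arr C X Z"
    using comp_add[OF neg_in_Hom[OF assms(1)] assms] neg_add[OF assms(1)]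
      comp_zero[OF _ assms(2), of X] Hom_Obj[OF assms(1)] by simp
  then show ?thesis
    using add_eq_zero_unique[OF gn gf neg_in_Hom[OF gf] _ neg_add[OF gf]] by blast
qed

lemma neg_comp:
  assumes "f \<in> Hom C X Y" "g \<in> Hom C Y Z"
  shows "neg_arr C g \<cdot> f = neg_arr C (g \<cdot> f)"
proof -
  have gf: "g \<cdot> f \<in> Hom C X Z" and gn: "neg_arr C g \<cdot> f \<in> Hom C X Z"
    using assms neg_in_Hom comp_in_Hom by blast+
  have "neg_arr C g \<cdot> f \<boxplus> g \<cdot> f = zero_arr C X Z"
    using add_comp[OF assms(1) neg_in_Hom[OF assms(2)] assms(2)] neg_add[OF assms(2)]
      zero_comp[OF _ assms(1), of Z] Hom_Obj[OF assms(2)] by simp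
  then show ?thesis
    using add_eq_zero_unique[OF gn gf neg_in_Hom[OF gf] _ neg_add[OF gf]] by blast
qed

lemma diff_add_cancel:
  assumes "f \<in> Hom C X Y" "g \<in> Hom C X Y"
  shows "(f \<boxplus> neg_arr C g) \<boxplus> g = f"
  using assms add_arr_assoc[of f X Y "neg_arr C g" g] neg_in_Hom neg_add add_zero by simp

lemma biproduct:
  assumes "X \<in> Obj C" "Y \<in> Obj C"
  obtains P i j p q where "P \<in> Obj C" "i \<in> Hom C X P" "j \<in> Hom C Y P"
    "p \<in> Hom C P X" "q \<in> Hom C P Y" "p \<cdot> i = idt C X" "q \<cdot> j = idt C Y"
    "p \<cdot> j = zero_arr C Y X" "q \<cdot> i = zero_arr C X Y"
proof -
  obtain P \<iota> where P: "is_coproduct C [X, Y] P \<iota>"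
    using finite_coproducts[of "[X, Y]"] assms by auto
  have \<iota>: "\<iota> 0 \<in> Hom C X P" "\<iota> 1 \<in> Hom C Y P" "P \<in> Obj C"
    using P unfolding is_coproduct_def by auto
  have univ: "\<exists>u. u \<in> Hom C P Z \<and> u \<cdot> \<iota> 0 = g 0 \<and> u \<cdot> \<iota> 1 = g 1"
    if "Z \<in> Obj C" "g 0 \<in> Hom C X Z" "g 1 \<in> Hom C Y Z" for Z and g :: "nat \<Rightarrow> 'm"
  proof -
    have "\<forall>k<length [X, Y]. g k \<in> Hom C ([X, Y] ! k) Z"
      using that(2,3) by (auto simp: less_Suc_eq)
    then have "\<exists>!u. u \<in> Hom C P Z \<and> (\<forall>k<length [X, Y]. u \<cdot> \<iota> k = g k)"
      using P that(1) unfolding is_coproduct_def by blast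
    then show ?thesis by (auto simp: less_Suc_eq)
  qed
  from univ[of X "\<lambda>k. if k = 0 then idt C X else zero_arr C Y X"]
  obtain p where "p \<in> Hom C P X" "p \<cdot> \<iota> 0 = idt C X" "p \<cdot> \<iota> 1 = zero_arr C Y X"
    using assms idt_in_Hom zero_in_Hom by auto
  moreover from univ[of Y "\<lambda>k. if k = 0 then zero_arr C X Y else idt C Y"]
  obtain q where "q \<in> Hom C P Y" "q \<cdot> \<iota> 0 = zero_arr C X Y" "q \<cdot> \<iota> 1 = idt C Y"
    using assms idt_in_Hom zero_in_Hom by auto
  ultimately show thesis using that \<iota> by blast
qed

lemma coproduct_summand_retract:
  assumes P: "is_coproduct C [X, X'] P \<iota>"
  shows "is_retract C X P"
proof -
  have \<iota>: "\<iota> 0 \<in> Hom C X P" "P \<in> Obj C" and X: "X \<in> Obj C" "X' \<in> Obj C"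
    using P unfolding is_coproduct_def by auto
  let ?g = "\<lambda>k::nat. if k = 0 then idt C X else zero_arr C X' X"
  have "\<forall>k<length [X, X']. ?g k \<in> Hom C ([X, X'] ! k) X"
    using X idt_in_Hom zero_in_Hom by (auto simp: less_Suc_eq)
  then have "\<exists>!u. u \<in> Hom C P X \<and> (\<forall>k<length [X, X']. u \<cdot> \<iota> k = ?g k)"
    using P X(1) unfolding is_coproduct_def by (elim conjE) (drule (1) bspec, drule spec[of _ ?g], erule mp)
  from ex1_implies_ex[OF this] obtain u where "u \<in> Hom C P X"
    "\<forall>k<length [X, X']. u \<cdot> \<iota> k = ?g k" by (elim exE conjE)
  then have "u \<in> Hom C P X" "u \<cdot> \<iota> 0 = idt C X" by simp_all
  then show ?thesis
    unfolding is_retract_def using \<iota> X(1) by (intro conjI bexI[of _ "\<iota> 0"] bexI[of _ u])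
qed

lemma factor_sums_Hom:
  assumes "f \<in> factor_sums C \<X> X Y" "X \<in> Obj C" "Y \<in> Obj C"
  shows "f \<in> Hom C X Y"
  using assms(1)
proof induction
  case zero
  show ?case using zero_in_Hom assms(2,3) .
next
  case (add y W x f)
  show ?case using add_in_Hom[OF add(5) comp_in_Hom[OF add(1,3)]] .
qed

text \<open>The identity of a finite coproduct is the sum of the composites of projections and
  injections. Partial sums are built so that they restrict correctly to the first n summands and
  vanish on the others; for the full sum, uniqueness in the universal property gives the
  identity.\<close>

lemma coproduct_factor_sums:
  assumes P: "is_coproduct C Xs P \<iota>"
  shows "idt C P \<in> factor_sums C (set Xs) P P"
proof -
  have \<iota>: "\<And>k. k < length Xs \<Longrightarrow> \<iota> k \<in> Hom C (Xs ! k) P" and Po: "P \<in> Obj C"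
    and Xs: "\<And>k. k < length Xs \<Longrightarrow> Xs ! k \<in> Obj C"
    using P unfolding is_coproduct_def by (auto simp: subset_iff)
  have univ: "\<exists>!u. u \<in> Hom C P Z \<and> (\<forall>k<length Xs. u \<cdot> \<iota> k = g k)"
    if "Z \<in> Obj C" "\<forall>k<length Xs. g k \<in> Hom C (Xs ! k) Z" for Z and g :: "nat \<Rightarrow> 'm"
    using P that unfolding is_coproduct_def by blast
  have "n \<le> length Xs \<Longrightarrow> \<exists>e\<in>factor_sums C (set Xs) P P. \<forall>k<length Xs.
      e \<cdot> \<iota> k = (if k < n then \<iota> k else zero_arr C (Xs ! k) P)" for n
  proof (induction n)
    case 0
    show ?case
      using zero_comp[OF Po \<iota>] by (intro bexI[OF _ factor_sums.zero]) auto
  next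
    case (Suc n)
    then obtain e where e: "e \<in> factor_sums C (set Xs) P P"
      "\<And>k. k < length Xs \<Longrightarrow> e \<cdot> \<iota> k = (if k < n then \<iota> k else zero_arr C (Xs ! k) P)" by auto
    have n: "n < length Xs" using Suc by simp
    \<comment> \<open>The components of the projection onto the n-th summand. Adding the composite
      of this projection with \<open>\<iota> n\<close> changes the partial sum on that summand
      only.\<close>
    let ?g = "\<lambda>k. if k = n then idt C (Xs ! n) else zero_arr C (Xs ! k) (Xs ! n)"
    have "\<forall>k<length Xs. ?g k \<in> Hom C (Xs ! k) (Xs ! n)"
      using Xs n idt_in_Hom zero_in_Hom by simp
    from univ[OF Xs[OF n] this] obtain p where p: "p \<in> Hom C P (Xs ! n)"
      "\<And>k. k < length Xs \<Longrightarrow> p \<cdot> \<iota> k = ?g k" by blast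
    have eH: "e \<in> Hom C P P" using factor_sums_Hom e(1) Po by blast
    have ip: "\<iota> n \<cdot> p \<in> Hom C P P" using comp_in_Hom p(1) \<iota>[OF n] .
    let ?e = "e \<boxplus> \<iota> n \<cdot> p"
    have "?e \<in> factor_sums C (set Xs) P P"
      using factor_sums.add[OF p(1) _ \<iota>[OF n] e(1)] n by simp
    moreover have "?e \<cdot> \<iota> k = (if k < Suc n then \<iota> k else zero_arr C (Xs ! k) P)"
      if k: "k < length Xs" for k
    proof -
      have "?e \<cdot> \<iota> k = e \<cdot> \<iota> k \<boxplus> (\<iota> n \<cdot> p) \<cdot> \<iota> k"
        using add_comp[OF \<iota>[OF k] eH ip] .
      also have "(\<iota> n \<cdot> p) \<cdot> \<iota> k = \<iota> n \<cdot> ?g k"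
        using comp_assoc[OF \<iota>[OF k] p(1) \<iota>[OF n]] p(2)[OF k] by simp
      also have "\<dots> = (if k = n then \<iota> n else zero_arr C (Xs ! k) P)"
        using comp_idt[OF \<iota>[OF n]] comp_zero[OF Xs[OF k] \<iota>[OF n]] by simp
      finally show ?thesis
        using e(2)[OF k] zero_add[OF \<iota>[OF k]] add_zero[OF \<iota>[OF k]]
          zero_add[OF zero_in_Hom[OF Xs[OF k] Po]] by (auto simp: less_Suc_eq)
    qed
    ultimately show ?case by blast
  qed
  from this[of "length Xs"] obtain e where e: "e \<in> factor_sums C (set Xs) P P"
    "\<And>k. k < length Xs \<Longrightarrow> e \<cdot> \<iota> k = \<iota> k" by auto
  have "e \<in> Hom C P P" using factor_sums_Hom e(1) Po by blast
  then have "e = idt C P"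
    using univ[OF Po, of \<iota>] \<iota> e(2) idt_in_Hom[OF Po] idt_comp[OF \<iota>] by blast
  then show ?thesis using e(1) by simp
qed

lemma retract_factor_sums:
  assumes "is_retract C X Y"
  shows "idt C X \<in> factor_sums C {Y} X X"
proof -
  obtain s r where sr: "s \<in> Hom C X Y" "r \<in> Hom C Y X" "r \<cdot> s = idt C X" and X: "X \<in> Obj C"
    using assms unfolding is_retract_def by blast
  show ?thesis
    using factor_sums.add[OF sr(1) _ sr(2) factor_sums.zero, of "{Y}"] sr(3)
      zero_add[OF idt_in_Hom[OF X]] by simp
qed

end

locale additive_functor = C: additive_category C + D: additive_category D
  for C :: "('o, 'm, 'x) additive_category_scheme" and D :: "('p, 'n, 'y) additive_category_scheme" +
  fixes F :: "('o, 'm, 'p, 'n) functor_data"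
  assumes additive: "is_additive_functor C D F"
begin

lemma F_obj: "X \<in> Obj C \<Longrightarrow> obj_map F X \<in> Obj D"
  using additive unfolding is_additive_functor_def is_functor_def by blast

lemma F_Hom: "f \<in> Hom C X Y \<Longrightarrow> arr_map F f \<in> Hom D (obj_map F X) (obj_map F Y)"
  using additive C.Hom_Obj[of f X Y] unfolding is_additive_functor_def is_functor_def by blast

lemma F_idt: "X \<in> Obj C \<Longrightarrow> arr_map F (idt C X) = idt D (obj_map F X)"
  using additive unfolding is_additive_functor_def is_functor_def by blast

lemma F_comp: "\<lbrakk>f \<in> Hom C X Y; g \<in> Hom C Y Z\<rbrakk> \<Longrightarrow>
    arr_map F (g \<cdot>\<^bsub>C\<^esub> f) = arr_map F g \<cdot>\<^bsub>D\<^esub> arr_map F f"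
  using additive C.Hom_Obj[of f X Y] C.Hom_Obj[of g Y Z]
  unfolding is_additive_functor_def is_functor_def by blast

lemma F_add: "\<lbrakk>f \<in> Hom C X Y; f' \<in> Hom C X Y\<rbrakk> \<Longrightarrow>
    arr_map F (f \<boxplus>\<^bsub>C\<^esub> f') = arr_map F f \<boxplus>\<^bsub>D\<^esub> arr_map F f'"
  using additive C.Hom_Obj[of f X Y] unfolding is_additive_functor_def by blast

lemma F_zero:
  assumes "X \<in> Obj C" "Y \<in> Obj C"
  shows "arr_map F (zero_arr C X Y) = zero_arr D (obj_map F X) (obj_map F Y)"
proof (rule D.add_idem_zero)
  note z = C.zero_in_Hom[OF assms]
  show "arr_map F (zero_arr C X Y) \<in> Hom D (obj_map F X) (obj_map F Y)" using F_Hom[OF z] .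
  show "arr_map F (zero_arr C X Y) \<boxplus>\<^bsub>D\<^esub> arr_map F (zero_arr C X Y) = arr_map F (zero_arr C X Y)"
    using F_add[OF z z] C.zero_add[OF z] by simp
qed

lemma F_neg:
  assumes f: "f \<in> Hom C X Y"
  shows "arr_map F (neg_arr C f) = neg_arr D (arr_map F f)"
proof (rule D.add_eq_zero_unique)
  note Ff = F_Hom[OF f]
  show "arr_map F (neg_arr C f) \<in> Hom D (obj_map F X) (obj_map F Y)"
    using F_Hom[OF C.neg_in_Hom[OF f]] .
  show "arr_map F f \<in> Hom D (obj_map F X) (obj_map F Y)" using Ff .
  show "neg_arr D (arr_map F f) \<in> Hom D (obj_map F X) (obj_map F Y)" using D.neg_in_Hom[OF Ff] .
  show "arr_map F (neg_arr C f) \<boxplus>\<^bsub>D\<^esub> arr_map F f = zero_arr D (obj_map F X) (obj_map F Y)"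
    using F_add[OF C.neg_in_Hom[OF f] f] C.neg_add[OF f] F_zero C.Hom_Obj[OF f] by simp
  show "neg_arr D (arr_map F f) \<boxplus>\<^bsub>D\<^esub> arr_map F f = zero_arr D (obj_map F X) (obj_map F Y)"
    using D.neg_add[OF Ff] .
qed

end

text \<open>Induction over the integers in which the downward step may be proved by cancelling:
  since the suspension is injective, an equation in degree d follows from its suspended form in
  degree d + 1.\<close>

lemma int_shift_induct:
  fixes P :: "int \<Rightarrow> bool"
  assumes "P 0" "\<And>d. P d \<Longrightarrow> P (d + 1)" "\<And>d. P (d + 1) \<Longrightarrow> P d"
  shows "P d"
  by (induction d rule: int_induct[where k = 0]) (use assms(1,2) assms(3)[of "_ - 1"] in auto)

text \<open>One recursion valid in all integer degrees, so that the case split at 0 in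
  \<open>shift_obj\<close> and \<open>shift_arr\<close> never has to be opened again.\<close>

lemma int_iterate_succ:
  fixes s :: "'a \<Rightarrow> 'a"
  assumes "bij_betw s A A" "x \<in> A"
  defines "pw \<equiv> \<lambda>d::int. if d \<ge> 0 then s ^^ nat d else inv_into A s ^^ nat (- d)"
  shows "pw d x \<in> A" "pw (d + 1) x = s (pw d x)"
proof -
  have s: "s y \<in> A" if "y \<in> A" for y using assms(1) that by (auto simp: bij_betw_def)
  have i: "inv_into A s y \<in> A" "s (inv_into A s y) = y" if "y \<in> A" for y
    using assms(1) that by (auto simp: bij_betw_def inv_into_into f_inv_into_f)
  have pos: "(s ^^ n) x \<in> A" for n by (induction n) (use s assms(2) in auto)
  have neg: "(inv_into A s ^^ n) x \<in> A" for n by (induction n) (use i assms(2) in auto)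
  show "pw d x \<in> A" unfolding pw_def using pos neg by simp
  show "pw (d + 1) x = s (pw d x)"
  proof (cases "d \<ge> 0")
    case True
    then show ?thesis unfolding pw_def by (simp add: nat_add_distrib)
  next
    case False
    then have "nat (- d) = Suc (nat (- (d + 1)))" by simp
    then have "pw d x = inv_into A s ((inv_into A s ^^ nat (- (d + 1))) x)"
      using False unfolding pw_def by simp
    then have "s (pw d x) = (inv_into A s ^^ nat (- (d + 1))) x"
      using i(2)[OF neg] by simp
    then show ?thesis using False unfolding pw_def by auto
  qed
qed

section \<open>Integer shifts, rotation of triangles, and exactness of Hom\<close>

context triangulated_category
begin

sublocale susp: additive_functor C C "susp C"
  by unfold_locales (rule susp_additive)

lemma susp_obj_inj: "\<lbrakk>X \<in> Obj C; Y \<in> Obj C; obj_map (susp C) X = obj_map (susp C) Y\<rbrakk> \<Longrightarrow> X = Y"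
  using susp_bij_obj unfolding bij_betw_def inj_on_def by blast

lemma susp_arr_inj: "\<lbrakk>f \<in> Arr C; g \<in> Arr C; arr_map (susp C) f = arr_map (susp C) g\<rbrakk> \<Longrightarrow> f = g"
  using susp_bij_arr unfolding bij_betw_def inj_on_def by blast

lemma shift_obj_0 [simp]: "shift_obj C 0 X = X"
  by (simp add: shift_obj_def)

lemma shift_arr_0 [simp]: "shift_arr C 0 f = f"
  by (simp add: shift_arr_def)

lemma shift_obj_closed: "X \<in> Obj C \<Longrightarrow> shift_obj C d X \<in> Obj C"
  and shift_obj_succ: "X \<in> Obj C \<Longrightarrow> shift_obj C (d + 1) X = obj_map (susp C) (shift_obj C d X)"
  using int_iterate_succ[OF susp_bij_obj] unfolding shift_obj_def by auto

lemma shift_arr_Arr: "f \<in> Arr C \<Longrightarrow> shift_arr C d f \<in> Arr C"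
  and shift_arr_succ: "f \<in> Arr C \<Longrightarrow> shift_arr C (d + 1) f = arr_map (susp C) (shift_arr C d f)"
  using int_iterate_succ[OF susp_bij_arr] unfolding shift_arr_def by auto

lemma shift_obj_1: "shift_obj C 1 X = obj_map (susp C) X"
  by (simp add: shift_obj_def)

lemma shift_arr_1: "shift_arr C 1 f = arr_map (susp C) f"
  by (simp add: shift_arr_def)

lemma shift_obj_add:
  assumes X: "X \<in> Obj C"
  shows "shift_obj C (d + e) X = shift_obj C d (shift_obj C e X)"
proof (induction d rule: int_shift_induct)
  case 1
  show ?case by simp
next
  case (2 d)
  then show ?case
    using shift_obj_succ[OF X, of "d + e"] shift_obj_succ[OF shift_obj_closed[OF X], of d]
    by (simp add: add.commute add.left_commute)
next
  case (3 d)
  show ?case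
  proof (rule susp_obj_inj)
    show "obj_map (susp C) (shift_obj C (d + e) X) = obj_map (susp C) (shift_obj C d (shift_obj C e X))"
      using 3 shift_obj_succ[OF X, of "d + e"] shift_obj_succ[OF shift_obj_closed[OF X], of d]
      by (simp add: add.commute add.left_commute)
  qed (simp_all add: shift_obj_closed X)
qed

lemma shift_arr_shift:
  assumes f: "f \<in> Arr C"
  shows "shift_arr C (d + e) f = shift_arr C d (shift_arr C e f)"
proof (induction d rule: int_shift_induct)
  case 1
  show ?case by simp
next
  case (2 d)
  then show ?case
    using shift_arr_succ[OF f, of "d + e"] shift_arr_succ[OF shift_arr_Arr[OF f], of d]
    by (simp add: add.commute add.left_commute)
next
  case (3 d)
  show ?case
  proof (rule susp_arr_inj)
    show "arr_map (susp C) (shift_arr C (d + e) f) = arr_map (susp C) (shift_arr C d (shift_arr C e f))"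
      using 3 shift_arr_succ[OF f, of "d + e"] shift_arr_succ[OF shift_arr_Arr[OF f], of d]
      by (simp add: add.commute add.left_commute)
  qed (simp_all add: shift_arr_Arr f)
qed

lemma shift_arr_Hom:
  assumes f: "f \<in> Hom C X Y"
  shows "shift_arr C d f \<in> Hom C (shift_obj C d X) (shift_obj C d Y)"
proof (induction d rule: int_shift_induct)
  case 1
  show ?case using f by simp
next
  case (2 d)
  show ?case
    using susp.F_Hom[OF 2] shift_arr_succ[OF Hom_Arr[OF f]] shift_obj_succ Hom_Obj[OF f] by simp
next
  case (3 d)
  let ?g = "shift_arr C d f"
  \<comment> \<open>Source and target of the desuspended arrow are not yet known; they are read off
    from its suspension, because the suspension is injective on objects.\<close>
  have g: "?g \<in> Hom C (Dom C ?g) (Cod C ?g)" using Arr_Hom shift_arr_Arr Hom_Arr[OF f] by blast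
  have "arr_map (susp C) ?g \<in> Hom C (obj_map (susp C) (shift_obj C d X)) (obj_map (susp C) (shift_obj C d Y))"
    using 3 shift_arr_succ[OF Hom_Arr[OF f]] shift_obj_succ Hom_Obj[OF f] by simp
  with susp.F_Hom[OF g] have "Dom C ?g = shift_obj C d X" "Cod C ?g = shift_obj C d Y"
    using Hom_unique susp_obj_inj Hom_Obj[OF g] shift_obj_closed Hom_Obj[OF f] by blast+
  then show ?case using g by simp
qed

lemma shift_comp:
  assumes f: "f \<in> Hom C X Y" and g: "g \<in> Hom C Y Z"
  shows "shift_arr C d (g \<cdot> f) = shift_arr C d g \<cdot> shift_arr C d f"
proof (induction d rule: int_shift_induct)
  note succ = shift_arr_succ[OF Hom_Arr[OF f]] shift_arr_succ[OF Hom_Arr[OF g]]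
    shift_arr_succ[OF Hom_Arr[OF comp_in_Hom[OF f g]]]
  note F = susp.F_comp[OF shift_arr_Hom[OF f] shift_arr_Hom[OF g]]
  case 1
  show ?case by simp
  case (2 d)
  then show ?case using succ F by simp
  case (3 d)
  show ?case
    by (rule susp_arr_inj[OF Hom_Arr Hom_Arr])
      (use 3 succ F shift_arr_Hom comp_in_Hom[OF f g] comp_in_Hom[OF shift_arr_Hom[OF f] shift_arr_Hom[OF g]] in auto)
qed

lemma shift_add:
  assumes f: "f \<in> Hom C X Y" and g: "g \<in> Hom C X Y"
  shows "shift_arr C d (f \<boxplus> g) = shift_arr C d f \<boxplus> shift_arr C d g"
proof (induction d rule: int_shift_induct)
  note succ = shift_arr_succ[OF Hom_Arr[OF f]] shift_arr_succ[OF Hom_Arr[OF g]]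
    shift_arr_succ[OF Hom_Arr[OF add_in_Hom[OF f g]]]
  note F = susp.F_add[OF shift_arr_Hom[OF f] shift_arr_Hom[OF g]]
  case 1
  show ?case by simp
  case (2 d)
  then show ?case using succ F by simp
  case (3 d)
  show ?case
    by (rule susp_arr_inj[OF Hom_Arr Hom_Arr])
      (use 3 succ F shift_arr_Hom add_in_Hom[OF f g] add_in_Hom[OF shift_arr_Hom[OF f] shift_arr_Hom[OF g]] in auto)
qed

lemma shift_idt:
  assumes X: "X \<in> Obj C"
  shows "shift_arr C d (idt C X) = idt C (shift_obj C d X)"
proof -
  let ?e = "shift_arr C d (idt C X)"
  have e: "?e \<in> Hom C (shift_obj C d X) (shift_obj C d X)"
    using shift_arr_Hom[OF idt_in_Hom[OF X]] .
  let ?i = "idt C (shift_obj C d X)"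
  have i: "?i \<in> Hom C (shift_obj C d X) (shift_obj C d X)"
    using idt_in_Hom shift_obj_closed X by blast
  have cancel: "shift_obj C (- d) (shift_obj C d X) = X"
    using shift_obj_add[OF X, of "- d" d] by simp
  \<comment> \<open>The identity of the shifted object is itself the shift of \<open>?j\<close>.
    Hence functoriality on composites alone shows that \<open>?e\<close> composed with this identity
    is this identity.\<close>
  let ?j = "shift_arr C (- d) ?i"
  have j: "?j \<in> Hom C X X" using shift_arr_Hom[OF i, of "- d"] cancel by simp
  have di: "shift_arr C d ?j = ?i" using shift_arr_shift[OF Hom_Arr[OF i], of d "- d"] by simp
  have "?e = ?e \<cdot> ?i" using comp_idt[OF e] by simp
  also have "\<dots> = shift_arr C d (idt C X \<cdot> ?j)" using shift_comp[OF j idt_in_Hom[OF X]] di by simp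
  also have "\<dots> = ?i" using idt_comp[OF j] di by simp
  finally show ?thesis .
qed

lemma shift_zero:
  assumes "X \<in> Obj C" "Y \<in> Obj C"
  shows "shift_arr C d (zero_arr C X Y) = zero_arr C (shift_obj C d X) (shift_obj C d Y)"
  using shift_add[OF zero_in_Hom zero_in_Hom, OF assms assms] zero_add[OF zero_in_Hom[OF assms]]
    shift_arr_Hom[OF zero_in_Hom[OF assms]] by (intro add_idem_zero) auto

lemma shift_obj_cancel: "X \<in> Obj C \<Longrightarrow> shift_obj C (- d) (shift_obj C d X) = X"
  and shift_obj_cancel': "X \<in> Obj C \<Longrightarrow> shift_obj C d (shift_obj C (- d) X) = X"
  using shift_obj_add[of X "- d" d] shift_obj_add[of X d "- d"] by auto

lemma shift_arr_cancel: "f \<in> Arr C \<Longrightarrow> shift_arr C d (shift_arr C (- d) f) = f"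
  using shift_arr_shift[of f d "- d"] by simp

lemma shift_retract: "is_retract C X Y \<Longrightarrow> is_retract C (shift_obj C d X) (shift_obj C d Y)"
  unfolding is_retract_def by (metis shift_obj_closed shift_arr_Hom shift_comp shift_idt)

lemma triangle_rotate:
  assumes "is_exact_triangle C X Y Z f g h"
  shows "is_exact_triangle C Y Z (obj_map (susp C) X) g h (neg_arr C (arr_map (susp C) f))"
  using assms TR2[of X Y Z f g h] unfolding is_exact_triangle_def by blast

text \<open>Three rotations suspend all three objects. The maps acquire signs, which is harmless
  because only the existence of some triangle on these objects is needed.\<close>

lemma triangle_susp:
  assumes "is_exact_triangle C X Y Z f g h"
  shows "\<exists>f' g' h'. is_exact_triangle C (obj_map (susp C) X) (obj_map (susp C) Y) (obj_map (susp C) Z) f' g' h'"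
  using triangle_rotate[OF triangle_rotate[OF triangle_rotate[OF assms]]] by blast

text \<open>TR2 is an equivalence, so a backward rotation needs only a first map whose negated
  suspension is \<open>h\<close>: minus the desuspension of \<open>h\<close>.\<close>

lemma triangle_rotate_back:
  assumes "is_exact_triangle C X Y Z f g h"
  shows "\<exists>k. is_exact_triangle C (shift_obj C (- 1) Z) X Y k f g"
proof -
  have X: "X \<in> Obj C" "Y \<in> Obj C" "Z \<in> Obj C" and f: "f \<in> Hom C X Y" "g \<in> Hom C Y Z"
    and h: "h \<in> Hom C Z (shift_obj C 1 X)"
    using assms unfolding is_exact_triangle_def is_triangle_def shift_obj_1 by auto
  let ?h = "shift_arr C (- 1) h"
  have h': "?h \<in> Hom C (shift_obj C (- 1) Z) X"
    using shift_arr_Hom[OF h, of "- 1"] shift_obj_cancel[OF X(1), of 1] by simp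
  let ?k = "neg_arr C ?h"
  have Z: "obj_map (susp C) (shift_obj C (- 1) Z) = Z"
    using shift_obj_cancel'[OF X(3), of 1] shift_obj_1 by simp
  have k: "?k \<in> Hom C (shift_obj C (- 1) Z) X" using neg_in_Hom[OF h'] .
  have sh: "arr_map (susp C) ?h = h"
    using shift_arr_cancel[OF Hom_Arr[OF h], of 1] shift_arr_1 by simp
  have "arr_map (susp C) ?k = neg_arr C h"
    using susp.F_neg[OF h'] sh by simp
  moreover have "neg_arr C (neg_arr C h) = h"
    using add_eq_zero_unique[OF neg_in_Hom[OF neg_in_Hom[OF h]] neg_in_Hom[OF h] h
        neg_add[OF neg_in_Hom[OF h]] add_neg[OF h]] .
  ultimately have "neg_arr C (arr_map (susp C) ?k) = h" by simp
  moreover have "is_triangle C (shift_obj C (- 1) Z) X Y ?k f g"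
    unfolding is_triangle_def using X f k Z shift_obj_closed by simp
  ultimately have "is_exact_triangle C (shift_obj C (- 1) Z) X Y ?k f g"
    using TR2[of "shift_obj C (- 1) Z" X Y ?k f g] assms Z by simp
  then show ?thesis by blast
qed

lemma zero_object:
  obtains N where "N \<in> Obj C" "\<And>X. X \<in> Obj C \<Longrightarrow> is_exact_triangle C X X N (idt C X) (zero_arr C X N) (zero_arr C N (obj_map (susp C) X))"
proof -
  obtain N \<iota> where N: "is_coproduct C [] N \<iota>" using finite_coproducts[of "[]"] by auto
  then have "N \<in> Obj C" unfolding is_coproduct_def by simp
  then show thesis using that TR1_idt[OF _ N] by blast
qed

text \<open>TR3 maps the trivial triangle on \<open>X\<close> to the given one by the identity and
  \<open>f\<close>; the square it completes writes the composite of \<open>f\<close> and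
  \<open>g\<close> as a map that factors through a zero morphism.\<close>

lemma triangle_comp_zero:
  assumes t: "is_exact_triangle C X Y Z f g h"
  shows "g \<cdot> f = zero_arr C X Z"
proof -
  have X: "X \<in> Obj C" "Z \<in> Obj C" and f: "f \<in> Hom C X Y"
    using t unfolding is_exact_triangle_def is_triangle_def by auto
  obtain N where N: "N \<in> Obj C"
    "is_exact_triangle C X X N (idt C X) (zero_arr C X N) (zero_arr C N (obj_map (susp C) X))"
    using zero_object X by metis
  from TR3[OF N(2) t idt_in_Hom[OF X(1)] f] obtain c where c: "c \<in> Hom C N Z"
    "c \<cdot> zero_arr C X N = g \<cdot> f" by blast
  then show ?thesis using comp_zero[OF X(1) c(1)] by simp
qed

text \<open>The contravariant functor \<open>Hom(-, W)\<close> is cohomological: a morphism killed by the first map of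
  a triangle extends to a morphism of triangles into \<open>0 \<rightarrow> W \<rightarrow> W \<rightarrow> 0\<close>.\<close>

lemma triangle_factor:
  assumes t: "is_exact_triangle C X Y Z f g h" and w: "w \<in> Hom C Y W" and z: "w \<cdot> f = zero_arr C X W"
  shows "\<exists>v\<in>Hom C Z W. w = v \<cdot> g"
proof -
  have X: "X \<in> Obj C" and W: "W \<in> Obj C"
    using t Hom_Obj[OF w] unfolding is_exact_triangle_def is_triangle_def by auto
  obtain N where N: "N \<in> Obj C"
    "is_exact_triangle C (shift_obj C (- 1) W) (shift_obj C (- 1) W) N (idt C (shift_obj C (- 1) W))
      (zero_arr C (shift_obj C (- 1) W) N) (zero_arr C N (obj_map (susp C) (shift_obj C (- 1) W)))"
    using zero_object shift_obj_closed[OF W] by metis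
  have sW: "obj_map (susp C) (shift_obj C (- 1) W) = W"
    using shift_obj_cancel'[OF W, of 1] shift_obj_1 by simp
  \<comment> \<open>Rotating the trivial triangle on the desuspension of \<open>W\<close> twice
    turns its identity into minus the identity of \<open>W\<close>. The map supplied by TR3
    therefore has the wrong sign, and its negative is the desired factor.\<close>
  have t': "is_exact_triangle C N W W (zero_arr C N W) (neg_arr C (idt C W))
      (neg_arr C (arr_map (susp C) (zero_arr C (shift_obj C (- 1) W) N)))"
    using triangle_rotate[OF triangle_rotate[OF N(2)]] sW susp.F_idt[OF shift_obj_closed[OF W]] by simp
  have "w \<cdot> f = zero_arr C N W \<cdot> zero_arr C X N"
    using z zero_comp[OF W zero_in_Hom[OF X N(1)]] by simp
  from TR3[OF t t' zero_in_Hom[OF X N(1)] w this] obtain c where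
    c: "c \<in> Hom C Z W" "c \<cdot> g = neg_arr C (idt C W) \<cdot> w" by blast
  have g: "g \<in> Hom C Y Z" using t unfolding is_exact_triangle_def is_triangle_def by auto
  have "neg_arr C (idt C W) \<cdot> w = neg_arr C w"
    using neg_comp[OF w idt_in_Hom[OF W]] idt_comp[OF w] by simp
  then have "neg_arr C c \<cdot> g = neg_arr C (neg_arr C w)" using neg_comp[OF g c(1)] c(2) by simp
  also have "\<dots> = w"
    using add_eq_zero_unique[OF neg_in_Hom[OF neg_in_Hom[OF w]] neg_in_Hom[OF w] w
        neg_add[OF neg_in_Hom[OF w]] add_neg[OF w]] .
  finally show ?thesis using neg_in_Hom[OF c(1)] by metis
qed

end

section \<open>Exact functors and iterated suspensions\<close>

locale exact_functor = C: triangulated_category C + D: triangulated_category D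
  for C :: "('o, 'm, 'x) triangulated_category_scheme"
    and D :: "('p, 'n, 'y) triangulated_category_scheme" +
  fixes F :: "('o, 'm, 'p, 'n) functor_data" and \<theta> :: "'o \<Rightarrow> 'n"
  assumes exact: "is_exact_functor C D F \<theta>"
begin

sublocale additive_functor C D F
  by unfold_locales (use exact in \<open>simp add: is_exact_functor_def\<close>)

abbreviation \<Theta> :: "int \<Rightarrow> 'o \<Rightarrow> 'n" where
  "\<Theta> \<equiv> theta_power C D F \<theta>"

lemma \<theta>_Hom: "X \<in> Obj C \<Longrightarrow>
    \<theta> X \<in> Hom D (obj_map F (obj_map (susp C) X)) (obj_map (susp D) (obj_map F X))"
  and \<theta>_iso: "X \<in> Obj C \<Longrightarrow> is_iso_arr D (\<theta> X)"
  using exact unfolding is_exact_functor_def by blast+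

lemma \<theta>_natural: "f \<in> Hom C X Y \<Longrightarrow>
    \<theta> Y \<cdot>\<^bsub>D\<^esub> arr_map F (arr_map (susp C) f) = arr_map (susp D) (arr_map F f) \<cdot>\<^bsub>D\<^esub> \<theta> X"
  using exact C.Hom_Obj[of f X Y] unfolding is_exact_functor_def by blast

lemma F_triangle: "is_exact_triangle C X Y Z f g h \<Longrightarrow>
    is_exact_triangle D (obj_map F X) (obj_map F Y) (obj_map F Z)
      (arr_map F f) (arr_map F g) (\<theta> X \<cdot>\<^bsub>D\<^esub> arr_map F h)"
  using exact unfolding is_exact_functor_def by blast

lemma \<theta>_shift_Hom:
  assumes "X \<in> Obj C"
  shows "\<theta> (shift_obj C d X) \<in>
    Hom D (obj_map F (shift_obj C (d + 1) X)) (obj_map (susp D) (obj_map F (shift_obj C d X)))"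
  using \<theta>_Hom[OF C.shift_obj_closed[OF assms]] C.shift_obj_succ[OF assms] by simp

lemma theta_pos_Hom:
  assumes X: "X \<in> Obj C"
  shows "theta_pos C D F \<theta> n X \<in> Hom D (obj_map F (shift_obj C (int n) X)) (shift_obj D (int n) (obj_map F X))"
proof (induction n)
  case 0
  show ?case using D.idt_in_Hom[OF F_obj[OF X]] by simp
next
  case (Suc n)
  have "shift_arr D 1 (theta_pos C D F \<theta> n X) \<in>
      Hom D (obj_map (susp D) (obj_map F (shift_obj C (int n) X))) (shift_obj D (int n + 1) (obj_map F X))"
    using D.shift_arr_Hom[OF Suc, of 1] D.shift_obj_succ[OF F_obj[OF X]] by (simp add: D.shift_obj_1)
  from D.comp_in_Hom[OF \<theta>_shift_Hom[OF X] this] show ?case by (simp add: add.commute)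
qed

lemma shift_inv_\<theta>:
  assumes X: "X \<in> Obj C"
  shows "shift_arr D (- 1) (inv_arr D (\<theta> (shift_obj C d X))) \<in>
      Hom D (obj_map F (shift_obj C d X)) (shift_obj D (- 1) (obj_map F (shift_obj C (d + 1) X)))"
proof -
  let ?Z = "shift_obj C d X"
  have Z: "?Z \<in> Obj C" using C.shift_obj_closed[OF X] .
  have "inv_arr D (\<theta> ?Z) \<in> Hom D (shift_obj D 1 (obj_map F ?Z)) (obj_map F (shift_obj C (d + 1) X))"
    using D.iso_inverse(1)[OF \<theta>_iso[OF Z] \<theta>_shift_Hom[OF X]] by (simp add: D.shift_obj_1)
  from D.shift_arr_Hom[OF this, of "- 1"] show ?thesis
    using D.shift_obj_cancel[OF F_obj[OF Z], of 1] by simp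
qed

lemma theta_neg_Hom:
  assumes X: "X \<in> Obj C"
  shows "theta_neg C D F \<theta> n X \<in>
    Hom D (obj_map F (shift_obj C (- int n) X)) (shift_obj D (- int n) (obj_map F X))"
proof (induction n)
  case 0
  show ?case using D.idt_in_Hom[OF F_obj[OF X]] by simp
next
  case (Suc n)
  have "shift_arr D (- 1) (theta_neg C D F \<theta> n X) \<in>
      Hom D (shift_obj D (- 1) (obj_map F (shift_obj C (- int n) X))) (shift_obj D (- 1 - int n) (obj_map F X))"
    using D.shift_arr_Hom[OF Suc, of "- 1"] D.shift_obj_add[OF F_obj[OF X], of "- 1" "- int n"] by simp
  moreover have "shift_arr D (- 1) (inv_arr D (\<theta> (shift_obj C (- 1 - int n) X))) \<in>
      Hom D (obj_map F (shift_obj C (- 1 - int n) X)) (shift_obj D (- 1) (obj_map F (shift_obj C (- int n) X)))"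
    using shift_inv_\<theta>[OF X, of "- 1 - int n"] by simp
  ultimately show ?case using D.comp_in_Hom by (simp add: algebra_simps)
qed

lemma \<Theta>_Hom: "X \<in> Obj C \<Longrightarrow>
    \<Theta> d X \<in> Hom D (obj_map F (shift_obj C d X)) (shift_obj D d (obj_map F X))"
  using theta_pos_Hom[of X "nat d"] theta_neg_Hom[of X "nat (- d)"] unfolding theta_power_def by auto

lemma \<Theta>_0: "\<Theta> 0 X = idt D (obj_map F X)"
  by (simp add: theta_power_def)

text \<open>A single recursion for both branches of \<open>theta_power\<close>. In negative degrees
  the defining recursion composes with the desuspended inverse of \<open>\<theta>\<close>; after one
  suspension, composing with \<open>\<theta>\<close> undoes this.\<close>

lemma \<Theta>_succ:
  assumes X: "X \<in> Obj C"
  shows "\<Theta> (d + 1) X = arr_map (susp D) (\<Theta> d X) \<cdot>\<^bsub>D\<^esub> \<theta> (shift_obj C d X)"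
proof (cases "d \<ge> 0")
  case True
  then show ?thesis unfolding theta_power_def by (simp add: nat_add_distrib D.shift_arr_1)
next
  case False
  define n where "n = nat (- (d + 1))"
  have d: "nat (- d) = Suc n" "d = - 1 - int n" "d + 1 = - int n"
    using False unfolding n_def by auto
  let ?Z = "shift_obj C d X" and ?t = "theta_neg C D F \<theta> n X"
  have Z: "?Z \<in> Obj C" using C.shift_obj_closed[OF X] .
  let ?i = "inv_arr D (\<theta> ?Z)"
  note th = \<theta>_shift_Hom[OF X, of d]
  have i: "?i \<in> Hom D (obj_map (susp D) (obj_map F ?Z)) (obj_map F (shift_obj C (d + 1) X))"
    "?i \<cdot>\<^bsub>D\<^esub> \<theta> ?Z = idt D (obj_map F (shift_obj C (d + 1) X))"
    using D.iso_inverse(1,2)[OF \<theta>_iso[OF Z] th] by simp_all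
  have t: "?t \<in> Hom D (obj_map F (shift_obj C (d + 1) X)) (shift_obj D (d + 1) (obj_map F X))"
    using theta_neg_Hom[OF X, of n] d(3) by simp
  have ti: "?t \<cdot>\<^bsub>D\<^esub> ?i \<in> Hom D (obj_map (susp D) (obj_map F ?Z)) (shift_obj D (d + 1) (obj_map F X))"
    using D.comp_in_Hom[OF i(1) t] .
  have "\<Theta> d X = shift_arr D (- 1) ?t \<cdot>\<^bsub>D\<^esub> shift_arr D (- 1) ?i"
    using False d(1) unfolding theta_power_def by (simp add: d(2)[symmetric])
  also have "\<dots> = shift_arr D (- 1) (?t \<cdot>\<^bsub>D\<^esub> ?i)"
    using D.shift_comp[OF i(1) t] by simp
  finally have "arr_map (susp D) (\<Theta> d X) = ?t \<cdot>\<^bsub>D\<^esub> ?i"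
    using D.shift_arr_cancel[OF D.Hom_Arr[OF ti], of 1] by (simp add: D.shift_arr_1)
  then have "arr_map (susp D) (\<Theta> d X) \<cdot>\<^bsub>D\<^esub> \<theta> ?Z = ?t \<cdot>\<^bsub>D\<^esub> (?i \<cdot>\<^bsub>D\<^esub> \<theta> ?Z)"
    using D.comp_assoc[OF th i(1) t] by simp
  also have "\<dots> = ?t" using i(2) D.comp_idt[OF t] by simp
  also have "\<dots> = \<Theta> (d + 1) X" using d False unfolding theta_power_def by auto
  finally show ?thesis by simp
qed

text \<open>The downward steps of \<open>int_shift_induct\<close> for \<open>\<Theta>\<close> rest
  on this: \<open>\<theta>\<close> is invertible and the suspension is faithful.\<close>

lemma susp_\<theta>_cancel:
  assumes X: "X \<in> Obj C" and a: "a \<in> Hom D (obj_map F (shift_obj C d X)) W"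
    and b: "b \<in> Hom D (obj_map F (shift_obj C d X)) W"
    and eq: "arr_map (susp D) a \<cdot>\<^bsub>D\<^esub> \<theta> (shift_obj C d X) = arr_map (susp D) b \<cdot>\<^bsub>D\<^esub> \<theta> (shift_obj C d X)"
  shows "a = b"
  using D.iso_cancel[OF \<theta>_iso[OF C.shift_obj_closed[OF X]] \<theta>_shift_Hom[OF X]
      D.susp.F_Hom[OF a] D.susp.F_Hom[OF b] eq]
    D.susp_arr_inj D.Hom_Arr[OF a] D.Hom_Arr[OF b] by blast

text \<open>Cocycle rule for the comparison isomorphisms. As functions of \<open>m\<close> both
  sides obey the recursion of \<open>\<Theta>_succ\<close> and agree at
  \<open>m = 0\<close>.\<close>

lemma \<Theta>_add:
  assumes X: "X \<in> Obj C"
  shows "\<Theta> (m + d) X = shift_arr D m (\<Theta> d X) \<cdot>\<^bsub>D\<^esub> \<Theta> m (shift_obj C d X)"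
proof -
  define rhs where "rhs m = shift_arr D m (\<Theta> d X) \<cdot>\<^bsub>D\<^esub> \<Theta> m (shift_obj C d X)" for m
  note Xd = C.shift_obj_closed[OF X, of d]
  have r1: "\<Theta> m (shift_obj C d X) \<in>
      Hom D (obj_map F (shift_obj C (m + d) X)) (shift_obj D m (obj_map F (shift_obj C d X)))" for m
    using \<Theta>_Hom[OF Xd, of m] C.shift_obj_add[OF X] by simp
  have r2: "shift_arr D m (\<Theta> d X) \<in>
      Hom D (shift_obj D m (obj_map F (shift_obj C d X))) (shift_obj D (m + d) (obj_map F X))" for m
    using D.shift_arr_Hom[OF \<Theta>_Hom[OF X], of m d] D.shift_obj_add[OF F_obj[OF X], of m d] by simp
  have rhs: "rhs m \<in> Hom D (obj_map F (shift_obj C (m + d) X)) (shift_obj D (m + d) (obj_map F X))" for m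
    unfolding rhs_def using D.comp_in_Hom[OF r1 r2] .
  have succ: "rhs (m + 1) = arr_map (susp D) (rhs m) \<cdot>\<^bsub>D\<^esub> \<theta> (shift_obj C (m + d) X)" for m
  proof -
    have "rhs (m + 1) = arr_map (susp D) (shift_arr D m (\<Theta> d X)) \<cdot>\<^bsub>D\<^esub>
        (arr_map (susp D) (\<Theta> m (shift_obj C d X)) \<cdot>\<^bsub>D\<^esub> \<theta> (shift_obj C (m + d) X))"
      unfolding rhs_def
      using \<Theta>_succ[OF Xd, of m] D.shift_arr_succ[OF D.Hom_Arr[OF \<Theta>_Hom[OF X]]] C.shift_obj_add[OF X]
      by simp
    also have "\<dots> = arr_map (susp D) (rhs m) \<cdot>\<^bsub>D\<^esub> \<theta> (shift_obj C (m + d) X)"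
      unfolding rhs_def
      using D.comp_assoc[OF \<theta>_shift_Hom[OF X] D.susp.F_Hom[OF r1] D.susp.F_Hom[OF r2], of "m"]
        D.susp.F_comp[OF r1 r2] by simp
    finally show ?thesis .
  qed
  have shift: "\<Theta> (m + 1 + d) X = \<Theta> (m + d + 1) X" for m
    by (rule arg_cong[where f = "\<lambda>d. \<Theta> d X"]) simp
  have "\<Theta> (m + d) X = rhs m"
  proof (induction m rule: int_shift_induct)
    case 1
    show ?case unfolding rhs_def using D.comp_idt[OF \<Theta>_Hom[OF X]] by (simp add: \<Theta>_0)
  next
    case (2 m)
    then show ?case using succ[of m] \<Theta>_succ[OF X, of "m + d"] shift[of m] by simp
  next
    case (3 m)
    then show ?case
      using succ[of m] \<Theta>_succ[OF X, of "m + d"] shift[of m] susp_\<theta>_cancel[OF X \<Theta>_Hom[OF X] rhs] by simp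
  qed
  then show ?thesis unfolding rhs_def .
qed

text \<open>Passing from \<open>m\<close> to \<open>m + 1\<close> transforms both sides in the same
  way, namely suspend and precompose with \<open>\<theta>\<close>, by naturality of
  \<open>\<theta>\<close>; the induction runs upward and, after cancelling, downward.\<close>

lemma \<Theta>_natural:
  assumes f: "f \<in> Hom C X Y"
  shows "\<Theta> m Y \<cdot>\<^bsub>D\<^esub> arr_map F (shift_arr C m f) = shift_arr D m (arr_map F f) \<cdot>\<^bsub>D\<^esub> \<Theta> m X"
proof (induction m rule: int_shift_induct)
  have X: "X \<in> Obj C" and Y: "Y \<in> Obj C" using C.Hom_Obj[OF f] by auto
  note sf = C.shift_arr_Hom[OF f]
  note Fsf = F_Hom[OF sf] and sFf = D.shift_arr_Hom[OF F_Hom[OF f]]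
  note l = D.comp_in_Hom[OF Fsf \<Theta>_Hom[OF Y]] and r = D.comp_in_Hom[OF \<Theta>_Hom[OF X] sFf]
  have lhs: "\<Theta> (m + 1) Y \<cdot>\<^bsub>D\<^esub> arr_map F (shift_arr C (m + 1) f) =
      arr_map (susp D) (\<Theta> m Y \<cdot>\<^bsub>D\<^esub> arr_map F (shift_arr C m f)) \<cdot>\<^bsub>D\<^esub> \<theta> (shift_obj C m X)" for m
  proof -
    have s: "shift_arr C (m + 1) f = arr_map (susp C) (shift_arr C m f)"
      using C.shift_arr_succ[OF C.Hom_Arr[OF f]] .
    have Fs: "arr_map F (shift_arr C (m + 1) f) \<in>
        Hom D (obj_map F (shift_obj C (m + 1) X)) (obj_map F (shift_obj C (m + 1) Y))"
      using F_Hom[OF sf] .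
    have "\<Theta> (m + 1) Y \<cdot>\<^bsub>D\<^esub> arr_map F (shift_arr C (m + 1) f) =
        arr_map (susp D) (\<Theta> m Y) \<cdot>\<^bsub>D\<^esub> (\<theta> (shift_obj C m Y) \<cdot>\<^bsub>D\<^esub> arr_map F (shift_arr C (m + 1) f))"
      using \<Theta>_succ[OF Y] D.comp_assoc[OF Fs \<theta>_shift_Hom[OF Y] D.susp.F_Hom[OF \<Theta>_Hom[OF Y]]] by simp
    also have "\<dots> = arr_map (susp D) (\<Theta> m Y) \<cdot>\<^bsub>D\<^esub>
        (arr_map (susp D) (arr_map F (shift_arr C m f)) \<cdot>\<^bsub>D\<^esub> \<theta> (shift_obj C m X))"
      using \<theta>_natural[OF sf] s by simp
    also have "\<dots> = arr_map (susp D) (\<Theta> m Y \<cdot>\<^bsub>D\<^esub> arr_map F (shift_arr C m f)) \<cdot>\<^bsub>D\<^esub> \<theta> (shift_obj C m X)"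
      using D.comp_assoc[OF \<theta>_shift_Hom[OF X] D.susp.F_Hom[OF Fsf] D.susp.F_Hom[OF \<Theta>_Hom[OF Y]]]
        D.susp.F_comp[OF Fsf \<Theta>_Hom[OF Y]] by simp
    finally show ?thesis .
  qed
  have rhs: "shift_arr D (m + 1) (arr_map F f) \<cdot>\<^bsub>D\<^esub> \<Theta> (m + 1) X =
      arr_map (susp D) (shift_arr D m (arr_map F f) \<cdot>\<^bsub>D\<^esub> \<Theta> m X) \<cdot>\<^bsub>D\<^esub> \<theta> (shift_obj C m X)" for m
    using \<Theta>_succ[OF X, of m] D.shift_arr_succ[OF D.Hom_Arr[OF F_Hom[OF f]], of m]
      D.comp_assoc[OF \<theta>_shift_Hom[OF X] D.susp.F_Hom[OF \<Theta>_Hom[OF X]] D.susp.F_Hom[OF sFf]]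
      D.susp.F_comp[OF \<Theta>_Hom[OF X] sFf] by simp
  {
    case 1
    show ?case
      using D.idt_comp[OF F_Hom[OF f]] D.comp_idt[OF F_Hom[OF f]] by (simp add: \<Theta>_0)
  next
    case (2 m)
    then show ?case using lhs[of m] rhs[of m] by simp
  next
    case (3 m)
    then show ?case using lhs[of m] rhs[of m] susp_\<theta>_cancel[OF X l r] by simp
  }
qed

text \<open>The cocycle rule for the degrees \<open>d\<close> and \<open>- d\<close> at the shifted
  object writes \<open>\<Theta> 0\<close>, an identity, as a composite ending in
  \<open>\<Theta> d X\<close> on the right; the other factor is the left inverse.\<close>

lemma \<Theta>_left_inverse:
  assumes X: "X \<in> Obj C"
  shows "\<exists>j\<in>Hom D (shift_obj D d (obj_map F X)) (obj_map F (shift_obj C d X)).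
    j \<cdot>\<^bsub>D\<^esub> \<Theta> d X = idt D (obj_map F (shift_obj C d X))"
proof -
  have Xd: "shift_obj C d X \<in> Obj C" using C.shift_obj_closed[OF X] .
  have eq: "\<Theta> (d + - d) (shift_obj C d X) = idt D (obj_map F (shift_obj C d X))" by (simp add: \<Theta>_0)
  have "\<Theta> (- d) (shift_obj C d X) \<in> Hom D (obj_map F X) (shift_obj D (- d) (obj_map F (shift_obj C d X)))"
    using \<Theta>_Hom[OF Xd, of "- d"] C.shift_obj_cancel[OF X] by simp
  from D.shift_arr_Hom[OF this, of d]
  have "shift_arr D d (\<Theta> (- d) (shift_obj C d X)) \<in>
      Hom D (shift_obj D d (obj_map F X)) (obj_map F (shift_obj C d X))"
    using D.shift_obj_cancel'[OF F_obj[OF Xd], of d] by simp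
  moreover have "shift_arr D d (\<Theta> (- d) (shift_obj C d X)) \<cdot>\<^bsub>D\<^esub> \<Theta> d X =
      idt D (obj_map F (shift_obj C d X))"
    using \<Theta>_add[OF Xd, of d "- d"] eq C.shift_obj_cancel[OF X] by simp
  ultimately show ?thesis by blast
qed

end

section \<open>The graded modules of morphisms\<close>

context additive_category
begin

lemma finsum_hom_group_in:
  assumes "X \<in> Obj C" "Y \<in> Obj C" "N \<subseteq> Hom C X Y" "zero_arr C X Y \<in> N"
    and add: "\<And>f g. \<lbrakk>f \<in> N; g \<in> N\<rbrakk> \<Longrightarrow> f \<boxplus> g \<in> N"
    and f: "\<And>i. i \<in> I \<Longrightarrow> f i \<in> N"
  shows "finsum (hom_group C X Y) f I \<in> N"
proof -
  interpret H: abelian_group "hom_group C X Y" using hom_abelian_group assms(1,2) .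
  have N: "\<And>g. g \<in> N \<Longrightarrow> g \<in> carrier (hom_group C X Y)"
    using assms(3) by (auto simp: hom_group_def)
  have z: "\<zero>\<^bsub>hom_group C X Y\<^esub> \<in> N" and a: "\<And>f g. f \<oplus>\<^bsub>hom_group C X Y\<^esub> g = f \<boxplus> g"
    using assms(4) by (simp_all add: hom_group_def)
  show ?thesis
  proof (cases "finite I")
    case True
    then show ?thesis using f
    proof (induction rule: finite_induct)
      case (insert i I)
      have "finsum (hom_group C X Y) f (insert i I) = f i \<boxplus> finsum (hom_group C X Y) f I"
        using H.finsum_insert[of I i f] insert(1,2,4) N a by auto
      then show ?case using insert add by simp
    qed (simp add: z)
  qed (simp add: H.finsum_infinite z)
qed

text \<open>The sums that define products and actions run over the degrees in which
  \<open>\<phi> r\<close> is nonzero. For homogeneous r this set is a singleton, or empty if r acts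
  by zero; both cases give the single expected term.\<close>

lemma finsum_hom_group_subset_singleton:
  assumes "X \<in> Obj C" "Y \<in> Obj C" "f d \<in> Hom C X Y" "I \<subseteq> {d}"
    "d \<notin> I \<Longrightarrow> f d = zero_arr C X Y"
  shows "finsum (hom_group C X Y) f I = f d"
proof -
  interpret H: abelian_group "hom_group C X Y" using hom_abelian_group assms(1,2) .
  have d: "f d \<in> carrier (hom_group C X Y)" using assms(3) by (simp add: hom_group_def)
  show ?thesis
  proof (cases "d \<in> I")
    case True
    then have "I = {d}" using assms(4) by auto
    then show ?thesis using H.finsum_insert[of "{}" d f] d by simp
  next
    case False
    then have "I = {}" using assms(4) by auto
    then show ?thesis using H.finsum_empty[of f] assms(5) by (simp add: hom_group_def)
  qed
qed

end

section \<open>Ext as a graded module, and its generation by homogeneous morphisms\<close>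

context graded_linear_category
begin

lemma action_closed: "r \<in> carrier R \<Longrightarrow> \<phi> r d \<in> center_part C d"
  using ring_hom_closed[OF action_ring_hom, of r] by (simp add: graded_center_def)

lemma action_Hom: "\<lbrakk>r \<in> carrier R; X \<in> Obj C\<rbrakk> \<Longrightarrow> \<phi> r d X \<in> Hom C X (shift_obj C d X)"
  using action_closed[of r d] unfolding center_part_def by simp

lemma action_natural: "\<lbrakk>r \<in> carrier R; f \<in> Hom C X Y\<rbrakk> \<Longrightarrow>
    \<phi> r d Y \<cdot>\<^bsub>C\<^esub> f = shift_arr C d f \<cdot>\<^bsub>C\<^esub> \<phi> r d X"
  using action_closed[of r d] Hom_Obj[of f X Y] unfolding center_part_def by simp

lemma action_add: "\<lbrakk>r \<in> carrier R; s \<in> carrier R; X \<in> Obj C\<rbrakk> \<Longrightarrow>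
    \<phi> (r \<oplus>\<^bsub>R\<^esub> s) d X = \<phi> r d X \<boxplus>\<^bsub>C\<^esub> \<phi> s d X"
  using ring_hom_add[OF action_ring_hom, of r s] by (simp add: graded_center_def)

lemma action_zero:
  assumes X: "X \<in> Obj C"
  shows "\<phi> \<zero>\<^bsub>R\<^esub> d X = zero_arr C X (shift_obj C d X)"
  using action_add[of "\<zero>\<^bsub>R\<^esub>" "\<zero>\<^bsub>R\<^esub>" X d] action_Hom[of "\<zero>\<^bsub>R\<^esub>" X d] X
  by (intro add_idem_zero) auto

lemma action_one: "X \<in> Obj C \<Longrightarrow> \<phi> \<one>\<^bsub>R\<^esub> 0 X = idt C X"
  using ring_hom_one[OF action_ring_hom] by (simp add: graded_center_def)

lemma action_support: "r \<in> Rd d \<Longrightarrow> {e. \<phi> r e \<noteq> center_zero C e} \<subseteq> {d}"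
  using action_graded by auto

lemma action_sum_homogeneous:
  assumes r: "r \<in> Rd d" and X: "X \<in> Obj C" and Y: "Y \<in> Obj C"
    and k: "k (n - d) \<in> Hom C X (shift_obj C (n - d) Y)"
  shows "finsum (hom_group C X (shift_obj C n Y)) (\<lambda>e. \<phi> r e (shift_obj C (n - e) Y) \<cdot>\<^bsub>C\<^esub> k (n - e))
      {e. \<phi> r e \<noteq> center_zero C e} = \<phi> r d (shift_obj C (n - d) Y) \<cdot>\<^bsub>C\<^esub> k (n - d)"
proof (rule finsum_hom_group_subset_singleton[OF X shift_obj_closed[OF Y] _ action_support[OF r]])
  have Yd: "shift_obj C (n - d) Y \<in> Obj C" using shift_obj_closed[OF Y] .
  have shift: "shift_obj C d (shift_obj C (n - d) Y) = shift_obj C n Y"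
    using shift_obj_add[OF Y, of d "n - d"] by simp
  have "\<phi> r d (shift_obj C (n - d) Y) \<in> Hom C (shift_obj C (n - d) Y) (shift_obj C n Y)"
    using action_Hom[OF homogeneous_closed[OF r] Yd, of d] shift by simp
  from comp_in_Hom[OF k this]
  show "\<phi> r d (shift_obj C (n - d) Y) \<cdot>\<^bsub>C\<^esub> k (n - d) \<in> Hom C X (shift_obj C n Y)" .
  assume "d \<notin> {e. \<phi> r e \<noteq> center_zero C e}"
  then have "\<phi> r d (shift_obj C (n - d) Y) = zero_arr C (shift_obj C (n - d) Y) (shift_obj C n Y)"
    using Yd shift by (simp add: center_zero_def)
  then show "\<phi> r d (shift_obj C (n - d) Y) \<cdot>\<^bsub>C\<^esub> k (n - d) = zero_arr C X (shift_obj C n Y)"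
    using zero_comp[OF shift_obj_closed[OF Y] k] by simp
qed

lemma action_mult:
  assumes r: "r \<in> Rd d" and s: "s \<in> Rd e" and X: "X \<in> Obj C"
  shows "\<phi> (r \<otimes>\<^bsub>R\<^esub> s) (d + e) X = \<phi> r d (shift_obj C e X) \<cdot>\<^bsub>C\<^esub> \<phi> s e X"
proof -
  have "\<phi> (r \<otimes>\<^bsub>R\<^esub> s) = \<phi> r \<otimes>\<^bsub>graded_center C\<^esub> \<phi> s"
    using ring_hom_mult[OF action_ring_hom] r s by auto
  then have "\<phi> (r \<otimes>\<^bsub>R\<^esub> s) (d + e) X = finsum (hom_group C X (shift_obj C (d + e) X))
      (\<lambda>i. \<phi> r i (shift_obj C (d + e - i) X) \<cdot>\<^bsub>C\<^esub> \<phi> s (d + e - i) X) {i. \<phi> r i \<noteq> center_zero C i}"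
    using X by (simp add: graded_center_def)
  also have "\<dots> = \<phi> r d (shift_obj C (d + e - d) X) \<cdot>\<^bsub>C\<^esub> \<phi> s (d + e - d) X"
    by (rule action_sum_homogeneous[OF r X X]) (use s X action_Hom in auto)
  finally show ?thesis by simp
qed

definition act :: "'o \<Rightarrow> int \<Rightarrow> 'r \<Rightarrow> int \<Rightarrow> 'm \<Rightarrow> 'm" where
  "act Y d r e h = \<phi> r d (shift_obj C e Y) \<cdot>\<^bsub>C\<^esub> h"

text \<open>By naturality the action can be moved to the source. This is the form in which a ring
  element becomes precomposition with a morphism not depending on \<open>h\<close>.\<close>

lemma act_shift:
  assumes "r \<in> Rd d" "h \<in> Hom C X (shift_obj C e Y)"
  shows "act Y d r e h = shift_arr C d h \<cdot>\<^bsub>C\<^esub> \<phi> r d X"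
  unfolding act_def using action_natural[OF homogeneous_closed[OF assms(1)] assms(2)] .

lemma graded_module_Hom:
  assumes X: "X \<in> Obj C" and Y: "Y \<in> Obj C"
  shows "graded_module R Rd (\<lambda>e. Hom C X (shift_obj C e Y)) (add_arr C)
    (\<lambda>e. zero_arr C X (shift_obj C e Y)) (act Y)"
proof unfold_locales
  note Ye = shift_obj_closed[OF Y]
  have \<phi>: "\<phi> r d (shift_obj C e Y) \<in> Hom C (shift_obj C e Y) (shift_obj C (d + e) Y)"
    if "r \<in> Rd d" for r d e
    using action_Hom[OF homogeneous_closed[OF that] Ye, of d e] shift_obj_add[OF Y] by simp
  show "act Y d r e h \<in> Hom C X (shift_obj C (d + e) Y)"
    if "r \<in> Rd d" "h \<in> Hom C X (shift_obj C e Y)" for r d h e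
    unfolding act_def using comp_in_Hom[OF that(2) \<phi>[OF that(1)]] .
  show "act Y d r e (h \<boxplus>\<^bsub>C\<^esub> h') = act Y d r e h \<boxplus>\<^bsub>C\<^esub> act Y d r e h'"
    if "r \<in> Rd d" "h \<in> Hom C X (shift_obj C e Y)" "h' \<in> Hom C X (shift_obj C e Y)" for r d h e h'
    unfolding act_def using comp_add[OF that(2,3) \<phi>[OF that(1)]] .
  show "act Y d r e (zero_arr C X (shift_obj C e Y)) = zero_arr C X (shift_obj C (d + e) Y)"
    if "r \<in> Rd d" for r d e
    unfolding act_def using comp_zero[OF X \<phi>[OF that]] .
  show "act Y d (r \<oplus>\<^bsub>R\<^esub> r') e h = act Y d r e h \<boxplus>\<^bsub>C\<^esub> act Y d r' e h"
    if "r \<in> Rd d" "r' \<in> Rd d" "h \<in> Hom C X (shift_obj C e Y)" for r r' d h e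
    unfolding act_def
    using add_comp[OF that(3) \<phi>[OF that(1)] \<phi>[OF that(2)]] action_add[of r r'] Ye that(1,2) by auto
  show "act Y d \<zero>\<^bsub>R\<^esub> e h = zero_arr C X (shift_obj C (d + e) Y)"
    if "h \<in> Hom C X (shift_obj C e Y)" for d h e
    unfolding act_def
    using action_zero[OF Ye, of d e] zero_comp[OF Ye that, of "d + e"] shift_obj_add[OF Y, of d e] by simp
  show "act Y (d + d') (r \<otimes>\<^bsub>R\<^esub> r') e h = act Y d r (d' + e) (act Y d' r' e h)"
    if "r \<in> Rd d" "r' \<in> Rd d'" "h \<in> Hom C X (shift_obj C e Y)" for r d r' d' h e
    unfolding act_def
    using action_mult[OF that(1,2) Ye] comp_assoc[OF that(3) \<phi>[OF that(2)], of "\<phi> r d (shift_obj C (d' + e) Y)"]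
      \<phi>[OF that(1), of "d' + e"] shift_obj_add[OF Y] by simp
  show "act Y 0 \<one>\<^bsub>R\<^esub> e h = h" if "h \<in> Hom C X (shift_obj C e Y)" for h e
    unfolding act_def using action_one[OF Ye] idt_comp[OF that] by simp
qed (use add_in_Hom add_arr_assoc add_arr_comm zero_add zero_in_Hom[OF X shift_obj_closed[OF Y]] in blast)+

text \<open>\<open>s\<close> is the degree \<open>d\<close> component of \<open>r\<close>. Since
  \<open>\<phi>\<close> is additive and respects degrees, the components of other degrees contribute
  zero.\<close>

lemma action_component:
  assumes "r \<in> carrier R"
  shows "\<exists>s\<in>Rd d. \<forall>X\<in>Obj C. \<phi> r d X = \<phi> s d X"
  using assms unfolding carrier_eq_sums_of
proof induction
  case zero
  show ?case by blast
next
  case (add x e y)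
  then obtain s where s: "s \<in> Rd d" "\<And>X. X \<in> Obj C \<Longrightarrow> \<phi> y d X = \<phi> s d X" by blast
  have y: "y \<in> carrier R" using add(2) carrier_eq_sums_of by simp
  have x: "x \<in> carrier R" using add(1) by blast
  show ?case
  proof (cases "e = d")
    case True
    have "\<phi> (x \<oplus>\<^bsub>R\<^esub> y) d X = \<phi> (x \<oplus>\<^bsub>R\<^esub> s) d X" if "X \<in> Obj C" for X
      using action_add[OF x y that] action_add[OF x homogeneous_closed[OF s(1)] that] s(2)[OF that] by simp
    then show ?thesis using add(1) s(1) True by blast
  next
    case False
    have "\<phi> (x \<oplus>\<^bsub>R\<^esub> y) d X = \<phi> s d X" if "X \<in> Obj C" for X
      using action_add[OF x y that, of d] s(2)[OF that] action_graded[OF add(1), of d] False that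
        zero_add[OF action_Hom[OF homogeneous_closed[OF s(1)] that]] by (simp add: center_zero_def)
    then show ?thesis using s(1) by blast
  qed
qed

lemma Ext_module_abelian_monoid:
  assumes X: "X \<in> Obj C" and Y: "Y \<in> Obj C"
  shows "abelian_monoid (Ext_module C \<phi> X Y)"
proof (rule abelian_monoidI)
  note z = zero_in_Hom[OF X shift_obj_closed[OF Y]]
  fix h k assume h: "h \<in> carrier (Ext_module C \<phi> X Y)" and k: "k \<in> carrier (Ext_module C \<phi> X Y)"
  have "{d. h d \<boxplus>\<^bsub>C\<^esub> k d \<noteq> zero_arr C X (shift_obj C d Y)} \<subseteq>
      {d. h d \<noteq> zero_arr C X (shift_obj C d Y)} \<union> {d. k d \<noteq> zero_arr C X (shift_obj C d Y)}"
    using zero_add[OF z] by auto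
  then have "finite {d. h d \<boxplus>\<^bsub>C\<^esub> k d \<noteq> zero_arr C X (shift_obj C d Y)}"
    using h k by (auto simp: Ext_module_def intro: finite_subset)
  then show "h \<oplus>\<^bsub>Ext_module C \<phi> X Y\<^esub> k \<in> carrier (Ext_module C \<phi> X Y)"
    using h k add_in_Hom by (simp add: Ext_module_def)
  show "h \<oplus>\<^bsub>Ext_module C \<phi> X Y\<^esub> k = k \<oplus>\<^bsub>Ext_module C \<phi> X Y\<^esub> h"
    using h k by (auto simp: Ext_module_def intro: add_arr_comm)
  show "\<zero>\<^bsub>Ext_module C \<phi> X Y\<^esub> \<oplus>\<^bsub>Ext_module C \<phi> X Y\<^esub> h = h"
    using h zero_add by (auto simp: Ext_module_def)
  fix l assume l: "l \<in> carrier (Ext_module C \<phi> X Y)"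
  have "h d \<boxplus>\<^bsub>C\<^esub> k d \<boxplus>\<^bsub>C\<^esub> l d = h d \<boxplus>\<^bsub>C\<^esub> (k d \<boxplus>\<^bsub>C\<^esub> l d)" for d
    using add_arr_assoc[of "h d" X "shift_obj C d Y" "k d" "l d"] h k l by (simp add: Ext_module_def)
  then show "(h \<oplus>\<^bsub>Ext_module C \<phi> X Y\<^esub> k) \<oplus>\<^bsub>Ext_module C \<phi> X Y\<^esub> l =
      h \<oplus>\<^bsub>Ext_module C \<phi> X Y\<^esub> (k \<oplus>\<^bsub>Ext_module C \<phi> X Y\<^esub> l)"
    by (simp add: Ext_module_def)
qed (use zero_in_Hom[OF X shift_obj_closed[OF Y]] in \<open>simp add: Ext_module_def\<close>)

text \<open>Reduces an inhomogeneous scalar to homogeneous ones, degree by degree. \<open>N\<close>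
  is an arbitrary additively closed set containing zero, so that it can be a whole Hom set, the zero
  set (to bound supports), or a graded span.\<close>

lemma Ext_module_smult_in:
  assumes X: "X \<in> Obj C" and Y: "Y \<in> Obj C" and r: "r \<in> carrier R"
    and h: "h \<in> carrier (Ext_module C \<phi> X Y)"
    and N: "N \<subseteq> Hom C X (shift_obj C n Y)" "zero_arr C X (shift_obj C n Y) \<in> N"
      "\<And>f g. \<lbrakk>f \<in> N; g \<in> N\<rbrakk> \<Longrightarrow> f \<boxplus>\<^bsub>C\<^esub> g \<in> N"
    and act: "\<And>d s. \<lbrakk>\<phi> r d \<noteq> center_zero C d; s \<in> Rd d\<rbrakk> \<Longrightarrow> act Y d s (n - d) (h (n - d)) \<in> N"
  shows "(r \<odot>\<^bsub>Ext_module C \<phi> X Y\<^esub> h) n \<in> N"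
proof -
  have "finsum (hom_group C X (shift_obj C n Y)) (\<lambda>d. \<phi> r d (shift_obj C (n - d) Y) \<cdot>\<^bsub>C\<^esub> h (n - d))
      {d. \<phi> r d \<noteq> center_zero C d} \<in> N"
  proof (rule finsum_hom_group_in[OF X shift_obj_closed[OF Y] N])
    fix d assume d: "d \<in> {d. \<phi> r d \<noteq> center_zero C d}"
    obtain s where s: "s \<in> Rd d" "\<forall>X\<in>Obj C. \<phi> r d X = \<phi> s d X" using action_component[OF r] by blast
    show "\<phi> r d (shift_obj C (n - d) Y) \<cdot>\<^bsub>C\<^esub> h (n - d) \<in> N"
      using act[OF _ s(1)] d s(2) shift_obj_closed[OF Y] unfolding act_def by simp
  qed
  then show ?thesis by (simp add: Ext_module_def)
qed

lemma Ext_module_smult_closed: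
  assumes X: "X \<in> Obj C" and Y: "Y \<in> Obj C" and r: "r \<in> carrier R"
    and h: "h \<in> carrier (Ext_module C \<phi> X Y)"
  shows "r \<odot>\<^bsub>Ext_module C \<phi> X Y\<^esub> h \<in> carrier (Ext_module C \<phi> X Y)"
proof -
  interpret M: graded_module R Rd "\<lambda>e. Hom C X (shift_obj C e Y)" "add_arr C"
    "\<lambda>e. zero_arr C X (shift_obj C e Y)" "act Y"
    using graded_module_Hom[OF X Y] .
  have hH: "h d \<in> Hom C X (shift_obj C d Y)" for d using h by (simp add: Ext_module_def)
  let ?S = "{d. \<phi> r d \<noteq> center_zero C d}" and ?T = "{d. h d \<noteq> zero_arr C X (shift_obj C d Y)}"
  have fin: "finite ?S" "finite ?T"
    using ring_hom_closed[OF action_ring_hom r] h by (auto simp: graded_center_def Ext_module_def)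
  have a: "act Y d s (n - d) (h (n - d)) \<in> Hom C X (shift_obj C n Y)" if "s \<in> Rd d" for d s n
    using M.act_closed[OF that hH, of "n - d"] by simp
  have "(r \<odot>\<^bsub>Ext_module C \<phi> X Y\<^esub> h) n \<in> Hom C X (shift_obj C n Y)" for n
    by (rule Ext_module_smult_in[OF X Y r h order_refl M.z_closed add_in_Hom a])
  \<comment> \<open>The support of the product lies in the set of sums of a degree from the support
    of \<open>\<phi> r\<close> and one from the support of \<open>h\<close>, which is
    finite.\<close>
  moreover have "(r \<odot>\<^bsub>Ext_module C \<phi> X Y\<^esub> h) n = zero_arr C X (shift_obj C n Y)"
    if n: "n \<notin> (\<lambda>(d, e). d + e) ` (?S \<times> ?T)" for n
  proof -
    have "(r \<odot>\<^bsub>Ext_module C \<phi> X Y\<^esub> h) n \<in> {zero_arr C X (shift_obj C n Y)}"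
    proof (rule Ext_module_smult_in[OF X Y r h])
      fix d s assume d: "\<phi> r d \<noteq> center_zero C d" and s: "s \<in> Rd d"
      have "h (n - d) = zero_arr C X (shift_obj C (n - d) Y)"
      proof (rule ccontr)
        assume "h (n - d) \<noteq> zero_arr C X (shift_obj C (n - d) Y)"
        then have "(d, n - d) \<in> ?S \<times> ?T" using d by simp
        then show False using n by force
      qed
      then show "act Y d s (n - d) (h (n - d)) \<in> {zero_arr C X (shift_obj C n Y)}"
        using M.act_z[OF s, of "n - d"] by simp
    qed (use M.z_closed M.z_pl in auto)
    then show ?thesis by simp
  qed
  then have "{n. (r \<odot>\<^bsub>Ext_module C \<phi> X Y\<^esub> h) n \<noteq> zero_arr C X (shift_obj C n Y)} \<subseteq>
      (\<lambda>(d, e). d + e) ` (?S \<times> ?T)" by blast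
  then have "finite {n. (r \<odot>\<^bsub>Ext_module C \<phi> X Y\<^esub> h) n \<noteq> zero_arr C X (shift_obj C n Y)}"
    using fin by (simp add: finite_subset)
  ultimately show ?thesis by (simp add: Ext_module_def)
qed

text \<open>Each generator of the total module is replaced by its finitely many nonzero components.
  Reading an equation between families in one degree then expresses a homogeneous morphism through
  these components with homogeneous scalars.\<close>

lemma Ext_finite_span:
  assumes "Ext_finite R C \<phi>" and X: "X \<in> Obj C" and Y: "Y \<in> Obj C"
  shows "\<exists>\<G>. finite \<G> \<and> (\<forall>(e, g)\<in>\<G>. g \<in> Hom C X (shift_obj C e Y)) \<and>
    (\<forall>e. \<forall>h\<in>Hom C X (shift_obj C e Y). graded_span Rd (add_arr C) (\<lambda>e. zero_arr C X (shift_obj C e Y)) (act Y) \<G> e h)"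
proof -
  interpret M: graded_module R Rd "\<lambda>e. Hom C X (shift_obj C e Y)" "add_arr C"
    "\<lambda>e. zero_arr C X (shift_obj C e Y)" "act Y"
    using graded_module_Hom[OF X Y] .
  interpret E: abelian_monoid "Ext_module C \<phi> X Y" using Ext_module_abelian_monoid[OF X Y] .
  obtain A where A: "finite A" "A \<subseteq> carrier (Ext_module C \<phi> X Y)"
    and gen: "\<And>m. m \<in> carrier (Ext_module C \<phi> X Y) \<Longrightarrow>
      \<exists>c\<in>A \<rightarrow> carrier R. m = (\<Oplus>\<^bsub>Ext_module C \<phi> X Y\<^esub>a\<in>A. c a \<odot>\<^bsub>Ext_module C \<phi> X Y\<^esub> a)"
    using assms unfolding Ext_finite_def finitely_generated_def by meson
  let ?T = "\<lambda>a. {d. a d \<noteq> zero_arr C X (shift_obj C d Y)}"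
  define \<G> where "\<G> = (\<Union>a\<in>A. (\<lambda>d. (d, a d)) ` ?T a)"
  have AH: "a d \<in> Hom C X (shift_obj C d Y)" "finite (?T a)" if "a \<in> A" for a d
    using A(2) that by (auto simp: Ext_module_def)
  have \<G>: "g \<in> Hom C X (shift_obj C e Y)" if "(e, g) \<in> \<G>" for e g
    using that AH(1) unfolding \<G>_def by blast
  have a: "M.span \<G> d (a d)" if "a \<in> A" for a d
  proof (cases "d \<in> ?T a")
    case True
    then show ?thesis using that unfolding \<G>_def by (intro graded_span.gen) blast
  next
    case False
    then have "a d = zero_arr C X (shift_obj C d Y)" by simp
    moreover have "M.span \<G> d (zero_arr C X (shift_obj C d Y))"
      by (rule graded_span.zero[where z = "\<lambda>e. zero_arr C X (shift_obj C e Y)"])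
    ultimately show ?thesis by simp
  qed
  have ra: "M.span \<G> n ((r \<odot>\<^bsub>Ext_module C \<phi> X Y\<^esub> a) n)" if "a \<in> A" "r \<in> carrier R" for a r n
  proof -
    have "(r \<odot>\<^bsub>Ext_module C \<phi> X Y\<^esub> a) n \<in> {h. M.span \<G> n h}"
    proof (rule Ext_module_smult_in[OF X Y that(2)])
      show "a \<in> carrier (Ext_module C \<phi> X Y)" using A(2) that(1) by blast
      show "{h. M.span \<G> n h} \<subseteq> Hom C X (shift_obj C n Y)" using M.span_closed \<G> by blast
      show "zero_arr C X (shift_obj C n Y) \<in> {h. M.span \<G> n h}"
        using graded_span.zero[where z = "\<lambda>e. zero_arr C X (shift_obj C e Y)"] by simp
      show "f \<boxplus>\<^bsub>C\<^esub> g \<in> {h. M.span \<G> n h}" if "f \<in> {h. M.span \<G> n h}" "g \<in> {h. M.span \<G> n h}" for f g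
        using that graded_span.add[where pl = "add_arr C"] by simp
      show "act Y d s (n - d) (a (n - d)) \<in> {h. M.span \<G> n h}" if "s \<in> Rd d" for d s
        using graded_span.act[where act = "act Y", OF that a[OF \<open>a \<in> A\<close>], of "n - d"] by simp
    qed
    then show ?thesis by simp
  qed
  have sums: "finite B \<Longrightarrow> B \<subseteq> A \<Longrightarrow>
      M.span \<G> n ((\<Oplus>\<^bsub>Ext_module C \<phi> X Y\<^esub>a\<in>B. c a \<odot>\<^bsub>Ext_module C \<phi> X Y\<^esub> a) n)"
    if c: "c \<in> A \<rightarrow> carrier R" for c B n
  proof (induction B rule: finite_induct)
    case empty
    show ?case
      unfolding E.finsum_empty
      using graded_span.zero[where z = "\<lambda>e. zero_arr C X (shift_obj C e Y)"] by (simp add: Ext_module_def)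
  next
    case (insert b B)
    have closed: "c a \<odot>\<^bsub>Ext_module C \<phi> X Y\<^esub> a \<in> carrier (Ext_module C \<phi> X Y)" if "a \<in> A" for a
      using Ext_module_smult_closed[OF X Y] c A(2) that by blast
    have "(\<Oplus>\<^bsub>Ext_module C \<phi> X Y\<^esub>a\<in>insert b B. c a \<odot>\<^bsub>Ext_module C \<phi> X Y\<^esub> a) n =
        (c b \<odot>\<^bsub>Ext_module C \<phi> X Y\<^esub> b) n \<boxplus>\<^bsub>C\<^esub> (\<Oplus>\<^bsub>Ext_module C \<phi> X Y\<^esub>a\<in>B. c a \<odot>\<^bsub>Ext_module C \<phi> X Y\<^esub> a) n"
    proof -
      have add: "(x \<oplus>\<^bsub>Ext_module C \<phi> X Y\<^esub> y) n = x n \<boxplus>\<^bsub>C\<^esub> y n" for x y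
        by (simp add: Ext_module_def)
      have "(\<lambda>a. c a \<odot>\<^bsub>Ext_module C \<phi> X Y\<^esub> a) \<in> B \<rightarrow> carrier (Ext_module C \<phi> X Y)"
        using closed insert(4) by blast
      from E.finsum_insert[OF insert(1,2) this] show ?thesis
        using closed insert(4) add by simp
    qed
    moreover have "M.span \<G> n ((c b \<odot>\<^bsub>Ext_module C \<phi> X Y\<^esub> b) n)" using ra[of b "c b"] c insert(4) by blast
    ultimately show ?case using graded_span.add[where pl = "add_arr C"] insert(3,4) by simp
  qed
  have "M.span \<G> n h" if h: "h \<in> Hom C X (shift_obj C n Y)" for n h
  proof -
    \<comment> \<open>The morphism \<open>h\<close> viewed as an element of the total module,
      concentrated in degree \<open>n\<close>.\<close>
    let ?m = "\<lambda>d. if d = n then h else zero_arr C X (shift_obj C d Y)"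
    have "{d. ?m d \<noteq> zero_arr C X (shift_obj C d Y)} \<subseteq> {n}" by auto
    then have "finite {d. ?m d \<noteq> zero_arr C X (shift_obj C d Y)}" by (rule finite_subset) simp
    then have "?m \<in> carrier (Ext_module C \<phi> X Y)"
      using h M.z_closed by (simp add: Ext_module_def)
    then obtain c where c: "c \<in> A \<rightarrow> carrier R"
      "?m = (\<Oplus>\<^bsub>Ext_module C \<phi> X Y\<^esub>a\<in>A. c a \<odot>\<^bsub>Ext_module C \<phi> X Y\<^esub> a)" using gen by blast
    have "?m n = h" by simp
    then show ?thesis using sums[OF c(1) A(1) order_refl, of n] unfolding c(2)[symmetric] by simp
  qed
  moreover have "finite \<G>" unfolding \<G>_def using A(1) AH(2) by simp
  ultimately show ?thesis using \<G> by blast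
qed

end

section \<open>Right adjoints from universal arrows\<close>

text \<open>The objects \<open>Q\<close> and arrows \<open>b\<close> are chosen pointwise.
  Functoriality and naturality then follow from uniqueness: morphisms into \<open>Q Y\<close> are
  equal once they agree after applying \<open>F\<close> and composing with
  \<open>b Y\<close>.\<close>

lemma right_adjoint_of_universal_arrows:
  assumes C: "category C" and D: "category D" and F: "is_functor C D F"
    and univ: "\<And>Y. Y \<in> Obj D \<Longrightarrow> \<exists>Q\<in>Obj C. \<exists>b\<in>Hom D (obj_map F Q) Y.
      \<forall>X\<in>Obj C. bij_betw (\<lambda>x. b \<cdot>\<^bsub>D\<^esub> arr_map F x) (Hom C X Q) (Hom D (obj_map F X) Y)"
  shows "has_right_adjoint C D F"
proof -
  interpret C: category C by fact
  interpret D: category D by fact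
  have F_Hom: "arr_map F f \<in> Hom D (obj_map F X) (obj_map F Y)" if "f \<in> Hom C X Y" for f X Y
    using F C.Hom_Obj[OF that] that unfolding is_functor_def by blast
  have F_idt: "arr_map F (idt C X) = idt D (obj_map F X)" if "X \<in> Obj C" for X
    using F that unfolding is_functor_def by blast
  have F_comp: "arr_map F (g \<cdot>\<^bsub>C\<^esub> f) = arr_map F g \<cdot>\<^bsub>D\<^esub> arr_map F f"
    if "f \<in> Hom C X Y" "g \<in> Hom C Y Z" for f g X Y Z
    using F C.Hom_Obj[OF that(1)] C.Hom_Obj[OF that(2)] that unfolding is_functor_def by blast
  have "\<forall>Y\<in>Obj D. \<exists>Qb. fst Qb \<in> Obj C \<and> snd Qb \<in> Hom D (obj_map F (fst Qb)) Y \<and>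
      (\<forall>X\<in>Obj C. bij_betw (\<lambda>x. snd Qb \<cdot>\<^bsub>D\<^esub> arr_map F x) (Hom C X (fst Qb)) (Hom D (obj_map F X) Y))"
    using univ by (metis fst_conv snd_conv)
  from bchoice[OF this] obtain Qb where Qb: "\<forall>Y\<in>Obj D. fst (Qb Y) \<in> Obj C \<and>
      snd (Qb Y) \<in> Hom D (obj_map F (fst (Qb Y))) Y \<and>
      (\<forall>X\<in>Obj C. bij_betw (\<lambda>x. snd (Qb Y) \<cdot>\<^bsub>D\<^esub> arr_map F x) (Hom C X (fst (Qb Y))) (Hom D (obj_map F X) Y))"
    by blast
  define Q where "Q Y = fst (Qb Y)" for Y
  define b where "b Y = snd (Qb Y)" for Y
  have Q: "Q Y \<in> Obj C" and b: "b Y \<in> Hom D (obj_map F (Q Y)) Y"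
    and bij: "\<And>X. X \<in> Obj C \<Longrightarrow>
      bij_betw (\<lambda>x. b Y \<cdot>\<^bsub>D\<^esub> arr_map F x) (Hom C X (Q Y)) (Hom D (obj_map F X) Y)"
    if "Y \<in> Obj D" for Y
    using Qb that unfolding Q_def b_def by blast+
  define \<alpha> where "\<alpha> X Y = inv_into (Hom C X (Q Y)) (\<lambda>x. b Y \<cdot>\<^bsub>D\<^esub> arr_map F x)" for X Y
  have \<alpha>: "\<alpha> X Y f \<in> Hom C X (Q Y)" "b Y \<cdot>\<^bsub>D\<^esub> arr_map F (\<alpha> X Y f) = f"
    if "X \<in> Obj C" "f \<in> Hom D (obj_map F X) Y" for X Y f
  proof -
    have Y: "Y \<in> Obj D" using D.Hom_Obj[OF that(2)] by blast
    show "\<alpha> X Y f \<in> Hom C X (Q Y)"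
      unfolding \<alpha>_def using bij_betw_imp_surj_on[OF bij[OF Y that(1)]] that(2)
      by (intro inv_into_into) simp
    show "b Y \<cdot>\<^bsub>D\<^esub> arr_map F (\<alpha> X Y f) = f"
      unfolding \<alpha>_def using bij_betw_inv_into_right[OF bij[OF Y that(1)] that(2)] .
  qed
  have eqI: "x = x'" if "Y \<in> Obj D" "x \<in> Hom C X (Q Y)" "x' \<in> Hom C X (Q Y)"
    "b Y \<cdot>\<^bsub>D\<^esub> arr_map F x = b Y \<cdot>\<^bsub>D\<^esub> arr_map F x'" for x x' X Y
    using bij_betw_imp_inj_on[OF bij[OF that(1)]] C.Hom_Obj[OF that(2)] that(2-4)
    unfolding inj_on_def by blast
  \<comment> \<open>\<open>arr_map\<close> receives only the arrow, so source and target are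
    recovered by \<open>Dom\<close> and \<open>Cod\<close>.\<close>
  define g where "g v = \<alpha> (Q (Dom D v)) (Cod D v) (v \<cdot>\<^bsub>D\<^esub> b (Dom D v))" for v
  have g: "g v \<in> Hom C (Q Y) (Q Y')" "b Y' \<cdot>\<^bsub>D\<^esub> arr_map F (g v) = v \<cdot>\<^bsub>D\<^esub> b Y"
    if "v \<in> Hom D Y Y'" for v Y Y'
  proof -
    have "Y \<in> Obj D" "Y' \<in> Obj D" using D.Hom_Obj[OF that] by auto
    moreover have "v \<cdot>\<^bsub>D\<^esub> b Y \<in> Hom D (obj_map F (Q Y)) Y'"
      using D.comp_in_Hom[OF b that] calculation by blast
    moreover have "Dom D v = Y" "Cod D v = Y'" using that unfolding Hom_def by auto
    ultimately show "g v \<in> Hom C (Q Y) (Q Y')" "b Y' \<cdot>\<^bsub>D\<^esub> arr_map F (g v) = v \<cdot>\<^bsub>D\<^esub> b Y"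
      unfolding g_def using \<alpha> Q by simp_all
  qed
  let ?G = "\<lparr>obj_map = Q, arr_map = g\<rparr>"
  have "is_functor D C ?G"
    unfolding is_functor_def
  proof (intro conjI ballI)
    fix X assume X: "X \<in> Obj D"
    show "obj_map ?G X \<in> Obj C" using Q[OF X] by simp
    note i = D.idt_in_Hom[OF X]
    have "g (idt D X) = idt C (Q X)"
      by (rule eqI[OF X g(1)[OF i] C.idt_in_Hom[OF Q[OF X]]])
        (simp add: g(2)[OF i] F_idt[OF Q[OF X]] D.comp_idt[OF b[OF X]] D.idt_comp[OF b[OF X]])
    then show "arr_map ?G (idt D X) = idt C (obj_map ?G X)" by simp
    fix Y assume Y: "Y \<in> Obj D"
    fix f assume f: "f \<in> Hom D X Y"
    show "arr_map ?G f \<in> Hom C (obj_map ?G X) (obj_map ?G Y)" using g(1)[OF f] by simp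
  next
    fix X Y Z f h assume X: "X \<in> Obj D" and Y: "Y \<in> Obj D" and Z: "Z \<in> Obj D"
      and f: "f \<in> Hom D X Y" and h: "h \<in> Hom D Y Z"
    have "b Z \<cdot>\<^bsub>D\<^esub> arr_map F (g h \<cdot>\<^bsub>C\<^esub> g f) = (b Z \<cdot>\<^bsub>D\<^esub> arr_map F (g h)) \<cdot>\<^bsub>D\<^esub> arr_map F (g f)"
      using F_comp[OF g(1)[OF f] g(1)[OF h]]
        D.comp_assoc[OF F_Hom[OF g(1)[OF f]] F_Hom[OF g(1)[OF h]] b[OF Z]] by simp
    also have "\<dots> = h \<cdot>\<^bsub>D\<^esub> (b Y \<cdot>\<^bsub>D\<^esub> arr_map F (g f))"
      using g(2)[OF h] D.comp_assoc[OF F_Hom[OF g(1)[OF f]] b[OF Y] h] by simp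
    also have "\<dots> = (h \<cdot>\<^bsub>D\<^esub> f) \<cdot>\<^bsub>D\<^esub> b X"
      using g(2)[OF f] D.comp_assoc[OF b[OF X] f h] by simp
    also have "\<dots> = b Z \<cdot>\<^bsub>D\<^esub> arr_map F (g (h \<cdot>\<^bsub>D\<^esub> f))"
      using g(2)[OF D.comp_in_Hom[OF f h]] by simp
    finally have "g (h \<cdot>\<^bsub>D\<^esub> f) = g h \<cdot>\<^bsub>C\<^esub> g f"
      using eqI[OF Z g(1)[OF D.comp_in_Hom[OF f h]] C.comp_in_Hom[OF g(1)[OF f] g(1)[OF h]]] by simp
    then show "arr_map ?G (h \<cdot>\<^bsub>D\<^esub> f) = arr_map ?G h \<cdot>\<^bsub>C\<^esub> arr_map ?G f" by simp
  qed
  moreover have "bij_betw (\<alpha> X Y) (Hom D (obj_map F X) Y) (Hom C X (Q Y))"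
    if "X \<in> Obj C" "Y \<in> Obj D" for X Y
    unfolding \<alpha>_def using bij_betw_inv_into[OF bij[OF that(2,1)]] .
  moreover have "\<alpha> X' Y' (v \<cdot>\<^bsub>D\<^esub> f \<cdot>\<^bsub>D\<^esub> arr_map F w) = g v \<cdot>\<^bsub>C\<^esub> \<alpha> X Y f \<cdot>\<^bsub>C\<^esub> w"
    if X: "X \<in> Obj C" and X': "X' \<in> Obj C" and Y: "Y \<in> Obj D" and Y': "Y' \<in> Obj D"
      and w: "w \<in> Hom C X' X" and v: "v \<in> Hom D Y Y'" and f: "f \<in> Hom D (obj_map F X) Y"
    for X X' Y Y' w v f
  proof -
    note \<alpha>f = \<alpha>[OF X f]
    have fw: "f \<cdot>\<^bsub>D\<^esub> arr_map F w \<in> Hom D (obj_map F X') Y"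
      using D.comp_in_Hom[OF F_Hom[OF w] f] .
    have aw: "\<alpha> X Y f \<cdot>\<^bsub>C\<^esub> w \<in> Hom C X' (Q Y)" using C.comp_in_Hom[OF w \<alpha>f(1)] .
    have "b Y' \<cdot>\<^bsub>D\<^esub> arr_map F (g v \<cdot>\<^bsub>C\<^esub> \<alpha> X Y f \<cdot>\<^bsub>C\<^esub> w) =
        (b Y' \<cdot>\<^bsub>D\<^esub> arr_map F (g v)) \<cdot>\<^bsub>D\<^esub> arr_map F (\<alpha> X Y f \<cdot>\<^bsub>C\<^esub> w)"
      using F_comp[OF aw g(1)[OF v]] D.comp_assoc[OF F_Hom[OF aw] F_Hom[OF g(1)[OF v]] b[OF Y']] by simp
    also have "\<dots> = v \<cdot>\<^bsub>D\<^esub> (b Y \<cdot>\<^bsub>D\<^esub> arr_map F (\<alpha> X Y f \<cdot>\<^bsub>C\<^esub> w))"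
      using g(2)[OF v] D.comp_assoc[OF F_Hom[OF aw] b[OF Y] v] by simp
    also have "b Y \<cdot>\<^bsub>D\<^esub> arr_map F (\<alpha> X Y f \<cdot>\<^bsub>C\<^esub> w) = f \<cdot>\<^bsub>D\<^esub> arr_map F w"
      using F_comp[OF w \<alpha>f(1)] D.comp_assoc[OF F_Hom[OF w] F_Hom[OF \<alpha>f(1)] b[OF Y]] \<alpha>f(2) by simp
    also have "v \<cdot>\<^bsub>D\<^esub> f \<cdot>\<^bsub>D\<^esub> arr_map F w = b Y' \<cdot>\<^bsub>D\<^esub> arr_map F (\<alpha> X' Y' (v \<cdot>\<^bsub>D\<^esub> f \<cdot>\<^bsub>D\<^esub> arr_map F w))"
      using \<alpha>(2)[OF X' D.comp_in_Hom[OF fw v]] by simp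
    finally show ?thesis
      using eqI[OF Y' \<alpha>(1)[OF X' D.comp_in_Hom[OF fw v]] C.comp_in_Hom[OF aw g(1)[OF v]]] by simp
  qed
  ultimately have "is_right_adjoint C D F ?G"
    unfolding is_right_adjoint_def by (intro conjI exI[of _ \<alpha>]) auto
  then show ?thesis unfolding has_right_adjoint_def by blast
qed

section \<open>Approximations of the functor represented along \<open>F\<close>\<close>

locale graded_linear_functor = exact_functor C D F \<theta> +
    C: graded_linear_category R Rd C \<phi> + D: graded_linear_category R Rd D \<psi>
  for R :: "('r, 'z) ring_scheme" and Rd and C :: "('o, 'm, 'x) triangulated_category_scheme"
    and \<phi> :: "'r \<Rightarrow> int \<Rightarrow> 'o \<Rightarrow> 'm" and D :: "('p, 'n, 'y) triangulated_category_scheme"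
    and \<psi> :: "'r \<Rightarrow> int \<Rightarrow> 'p \<Rightarrow> 'n" and F :: "('o, 'm, 'p, 'n) functor_data" and \<theta> :: "'o \<Rightarrow> 'n" +
  assumes linear: "is_graded_linear_functor R C \<phi> D \<psi> F \<theta>"
    and noetherian: "noetherian_ring R"
    and Ext_finite_C: "Ext_finite R C \<phi>" and Ext_finite_D: "Ext_finite R D \<psi>"
begin

text \<open>Linearity of \<open>Ext\<^sup>*(G, G) \<rightarrow> Ext\<^sup>*(F G, F G)\<close>, applied to the identity of \<open>G\<close>.\<close>

lemma \<Theta>_action:
  assumes r: "r \<in> Rd d" and G: "G \<in> Obj C"
  shows "\<Theta> d G \<cdot>\<^bsub>D\<^esub> arr_map F (\<phi> r d G) = \<psi> r d (obj_map F G)"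
proof -
  let ?\<delta> = "\<lambda>e. if e = 0 then idt C G else zero_arr C G (shift_obj C e G)"
  have rc: "r \<in> carrier R" using C.homogeneous_closed[OF r] .
  have "{e. ?\<delta> e \<noteq> zero_arr C G (shift_obj C e G)} \<subseteq> {0}" by auto
  then have "finite {e. ?\<delta> e \<noteq> zero_arr C G (shift_obj C e G)}" by (rule finite_subset) simp
  then have \<delta>: "?\<delta> \<in> carrier (Ext_module C \<phi> G G)"
    using C.idt_in_Hom[OF G] C.zero_in_Hom[OF G C.shift_obj_closed[OF G]] by (simp add: Ext_module_def)
  have FG: "obj_map F G \<in> Obj D" using F_obj[OF G] .
  have u0: "Ext_map C D F \<theta> G ?\<delta> 0 = idt D (obj_map F G)"
    using F_idt[OF G] D.idt_comp[OF D.idt_in_Hom[OF FG]] by (simp add: Ext_map_def \<Theta>_0)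
  have "(r \<odot>\<^bsub>Ext_module C \<phi> G G\<^esub> ?\<delta>) d = \<phi> r d (shift_obj C (d - d) G) \<cdot>\<^bsub>C\<^esub> ?\<delta> (d - d)"
    unfolding Ext_module_def
    using C.action_sum_homogeneous[OF r G G, of ?\<delta> d] C.idt_in_Hom[OF G] by simp
  also have "\<dots> = \<phi> r d G" using C.comp_idt[OF C.action_Hom[OF rc G]] by simp
  finally have "\<Theta> d G \<cdot>\<^bsub>D\<^esub> arr_map F (\<phi> r d G) =
      Ext_map C D F \<theta> G (r \<odot>\<^bsub>Ext_module C \<phi> G G\<^esub> ?\<delta>) d" by (simp add: Ext_map_def)
  also have "Ext_map C D F \<theta> G (r \<odot>\<^bsub>Ext_module C \<phi> G G\<^esub> ?\<delta>) =
      r \<odot>\<^bsub>Ext_module D \<psi> (obj_map F G) (obj_map F G)\<^esub> Ext_map C D F \<theta> G ?\<delta>"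
    using linear rc \<delta> G unfolding is_graded_linear_functor_def is_module_map_def by blast
  also have "\<dots> d = \<psi> r d (shift_obj D (d - d) (obj_map F G)) \<cdot>\<^bsub>D\<^esub> Ext_map C D F \<theta> G ?\<delta> (d - d)"
    unfolding Ext_module_def
    using D.action_sum_homogeneous[OF r FG FG, of "Ext_map C D F \<theta> G ?\<delta>" d] D.idt_in_Hom[OF FG] u0
    by simp
  also have "\<dots> = \<psi> r d (obj_map F G)" using u0 D.comp_idt[OF D.action_Hom[OF rc FG]] by simp
  finally show ?thesis .
qed

text \<open>Finitely many morphisms to \<open>Y\<close> are bundled into one on \<open>F\<close> of
  a biproduct. The object \<open>G\<close> only starts the induction, with the zero morphism for the
  empty family.\<close>

lemma finite_family_factors:
  assumes "finite I" "G \<in> Obj C" "Y \<in> Obj D"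
    and "\<And>X g. (X, g) \<in> I \<Longrightarrow> X \<in> Obj C \<and> g \<in> Hom D (obj_map F X) Y"
  shows "\<exists>A\<in>Obj C. \<exists>a\<in>Hom D (obj_map F A) Y. \<forall>(X, g)\<in>I. \<exists>x\<in>Hom C X A. g = a \<cdot>\<^bsub>D\<^esub> arr_map F x"
  using assms(1,4)
proof (induction I rule: finite_induct)
  case empty
  show ?case using D.zero_in_Hom[OF F_obj[OF assms(2)] assms(3)] assms(2) by blast
next
  case (insert Xg I)
  obtain X g where [simp]: "Xg = (X, g)" by (cases Xg)
  have X: "X \<in> Obj C" and g: "g \<in> Hom D (obj_map F X) Y" using insert.prems[of X g] by auto
  obtain A a where A: "A \<in> Obj C" and a: "a \<in> Hom D (obj_map F A) Y"
    and IH: "\<And>X g. (X, g) \<in> I \<Longrightarrow> \<exists>x\<in>Hom C X A. g = a \<cdot>\<^bsub>D\<^esub> arr_map F x"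
    using insert.IH insert.prems by blast
  obtain P i j p q where P: "P \<in> Obj C" "i \<in> Hom C A P" "j \<in> Hom C X P" "p \<in> Hom C P A" "q \<in> Hom C P X"
    "p \<cdot>\<^bsub>C\<^esub> i = idt C A" "q \<cdot>\<^bsub>C\<^esub> j = idt C X" "p \<cdot>\<^bsub>C\<^esub> j = zero_arr C X A" "q \<cdot>\<^bsub>C\<^esub> i = zero_arr C A X"
    using C.biproduct[OF A X] by metis
  have ap: "a \<cdot>\<^bsub>D\<^esub> arr_map F p \<in> Hom D (obj_map F P) Y" using D.comp_in_Hom[OF F_Hom[OF P(4)] a] .
  have gq: "g \<cdot>\<^bsub>D\<^esub> arr_map F q \<in> Hom D (obj_map F P) Y" using D.comp_in_Hom[OF F_Hom[OF P(5)] g] .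
  \<comment> \<open>The row (a, g) on the biproduct, written through the projections. It restricts
    to \<open>a\<close> along \<open>i\<close>, so old factorizations survive, and to
    \<open>g\<close> along \<open>j\<close>.\<close>
  let ?a = "a \<cdot>\<^bsub>D\<^esub> arr_map F p \<boxplus>\<^bsub>D\<^esub> g \<cdot>\<^bsub>D\<^esub> arr_map F q"
  have a': "?a \<in> Hom D (obj_map F P) Y" using D.add_in_Hom[OF ap gq] .
  have dist: "?a \<cdot>\<^bsub>D\<^esub> arr_map F x = a \<cdot>\<^bsub>D\<^esub> arr_map F (p \<cdot>\<^bsub>C\<^esub> x) \<boxplus>\<^bsub>D\<^esub> g \<cdot>\<^bsub>D\<^esub> arr_map F (q \<cdot>\<^bsub>C\<^esub> x)"
    if x: "x \<in> Hom C W P" for x W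
    using D.add_comp[OF F_Hom[OF x] ap gq] D.comp_assoc[OF F_Hom[OF x] F_Hom[OF P(4)] a]
      D.comp_assoc[OF F_Hom[OF x] F_Hom[OF P(5)] g] F_comp[OF x P(4)] F_comp[OF x P(5)] by simp
  have "?a \<cdot>\<^bsub>D\<^esub> arr_map F i = a"
    using dist[OF P(2)] P(6,9) F_idt[OF A] F_zero[OF A X] D.comp_idt[OF a]
      D.comp_zero[OF F_obj[OF A] g] D.add_zero[OF a] by simp
  moreover have j: "?a \<cdot>\<^bsub>D\<^esub> arr_map F j = g"
    using dist[OF P(3)] P(7,8) F_idt[OF X] F_zero[OF X A] D.comp_idt[OF g]
      D.comp_zero[OF F_obj[OF X] a] D.zero_add[OF g] by simp
  moreover have "\<exists>x\<in>Hom C X' P. g' = ?a \<cdot>\<^bsub>D\<^esub> arr_map F x" if I: "(X', g') \<in> I" for X' g'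
  proof -
    obtain x where x: "x \<in> Hom C X' A" "g' = a \<cdot>\<^bsub>D\<^esub> arr_map F x" using IH[OF I] by blast
    have "?a \<cdot>\<^bsub>D\<^esub> arr_map F (i \<cdot>\<^bsub>C\<^esub> x) = (?a \<cdot>\<^bsub>D\<^esub> arr_map F i) \<cdot>\<^bsub>D\<^esub> arr_map F x"
      using F_comp[OF x(1) P(2)] D.comp_assoc[OF F_Hom[OF x(1)] F_Hom[OF P(2)] a'] by simp
    then show ?thesis using calculation(1) x C.comp_in_Hom[OF x(1) P(2)] by metis
  qed
  ultimately have "\<exists>x\<in>Hom C X' P. g' = ?a \<cdot>\<^bsub>D\<^esub> arr_map F x" if "(X', g') \<in> insert Xg I" for X' g'
    using that P(3) j[symmetric] by (cases "(X', g') \<in> I") auto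
  then show ?case using P(1) a' by blast
qed

text \<open>The same bundling inside the source category; the combined map is still killed, since
  each of its two summands is.\<close>

lemma finite_kernel_factors:
  assumes "finite I" and a: "a \<in> Hom D (obj_map F A) Y" and A: "A \<in> Obj C"
    and "\<And>X k. (X, k) \<in> I \<Longrightarrow> k \<in> Hom C X A \<and> a \<cdot>\<^bsub>D\<^esub> arr_map F k = zero_arr D (obj_map F X) Y"
  shows "\<exists>B. \<exists>k'\<in>Hom C B A. a \<cdot>\<^bsub>D\<^esub> arr_map F k' = zero_arr D (obj_map F B) Y \<and>
    (\<forall>(X, k)\<in>I. \<exists>x\<in>Hom C X B. k = k' \<cdot>\<^bsub>C\<^esub> x)"
  using assms(1,4)
proof (induction I rule: finite_induct)
  case empty
  show ?case
    using C.zero_in_Hom[OF A A] F_zero[OF A A] D.comp_zero[OF F_obj[OF A] a]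
    by (intro exI[of _ A] bexI[of _ "zero_arr C A A"]) auto
next
  case (insert Xk I)
  obtain X k where [simp]: "Xk = (X, k)" by (cases Xk)
  have k: "k \<in> Hom C X A" and ak: "a \<cdot>\<^bsub>D\<^esub> arr_map F k = zero_arr D (obj_map F X) Y"
    using insert.prems[of X k] by auto
  have X: "X \<in> Obj C" using C.Hom_Obj[OF k] by blast
  obtain B l where l: "l \<in> Hom C B A" and al: "a \<cdot>\<^bsub>D\<^esub> arr_map F l = zero_arr D (obj_map F B) Y"
    and IH: "\<And>X k. (X, k) \<in> I \<Longrightarrow> \<exists>x\<in>Hom C X B. k = l \<cdot>\<^bsub>C\<^esub> x"
    using insert.IH insert.prems by blast
  have B: "B \<in> Obj C" using C.Hom_Obj[OF l] by blast
  have Y: "Y \<in> Obj D" using D.Hom_Obj[OF a] by blast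
  obtain P i j p q where P: "P \<in> Obj C" "i \<in> Hom C B P" "j \<in> Hom C X P" "p \<in> Hom C P B" "q \<in> Hom C P X"
    "p \<cdot>\<^bsub>C\<^esub> i = idt C B" "q \<cdot>\<^bsub>C\<^esub> j = idt C X" "p \<cdot>\<^bsub>C\<^esub> j = zero_arr C X B" "q \<cdot>\<^bsub>C\<^esub> i = zero_arr C B X"
    using C.biproduct[OF B X] by metis
  have lp: "l \<cdot>\<^bsub>C\<^esub> p \<in> Hom C P A" using C.comp_in_Hom[OF P(4) l] .
  have kq: "k \<cdot>\<^bsub>C\<^esub> q \<in> Hom C P A" using C.comp_in_Hom[OF P(5) k] .
  let ?l = "l \<cdot>\<^bsub>C\<^esub> p \<boxplus>\<^bsub>C\<^esub> k \<cdot>\<^bsub>C\<^esub> q"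
  have l': "?l \<in> Hom C P A" using C.add_in_Hom[OF lp kq] .
  have dist: "?l \<cdot>\<^bsub>C\<^esub> x = l \<cdot>\<^bsub>C\<^esub> (p \<cdot>\<^bsub>C\<^esub> x) \<boxplus>\<^bsub>C\<^esub> k \<cdot>\<^bsub>C\<^esub> (q \<cdot>\<^bsub>C\<^esub> x)"
    if x: "x \<in> Hom C W P" for x W
    using C.add_comp[OF x lp kq] C.comp_assoc[OF x P(4) l] C.comp_assoc[OF x P(5) k] by simp
  have i: "?l \<cdot>\<^bsub>C\<^esub> i = l"
    using dist[OF P(2)] P(6,9) C.comp_idt[OF l] C.comp_zero[OF B k] C.add_zero[OF l] by simp
  have j: "?l \<cdot>\<^bsub>C\<^esub> j = k"
    using dist[OF P(3)] P(7,8) C.comp_idt[OF k] C.comp_zero[OF X l] C.zero_add[OF k] by simp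
  have "a \<cdot>\<^bsub>D\<^esub> arr_map F (l \<cdot>\<^bsub>C\<^esub> p) = zero_arr D (obj_map F P) Y"
    using F_comp[OF P(4) l] D.comp_assoc[OF F_Hom[OF P(4)] F_Hom[OF l] a] al
      D.zero_comp[OF Y F_Hom[OF P(4)]] by simp
  moreover have "a \<cdot>\<^bsub>D\<^esub> arr_map F (k \<cdot>\<^bsub>C\<^esub> q) = zero_arr D (obj_map F P) Y"
    using F_comp[OF P(5) k] D.comp_assoc[OF F_Hom[OF P(5)] F_Hom[OF k] a] ak
      D.zero_comp[OF Y F_Hom[OF P(5)]] by simp
  ultimately have "a \<cdot>\<^bsub>D\<^esub> arr_map F ?l = zero_arr D (obj_map F P) Y"
    using F_add[OF lp kq] D.comp_add[OF F_Hom[OF lp] F_Hom[OF kq] a]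
      D.zero_add[OF D.zero_in_Hom[OF F_obj[OF P(1)] Y]] by simp
  moreover have "\<exists>x\<in>Hom C X' P. k' = ?l \<cdot>\<^bsub>C\<^esub> x" if I: "(X', k') \<in> I" for X' k'
  proof -
    obtain x where x: "x \<in> Hom C X' B" "k' = l \<cdot>\<^bsub>C\<^esub> x" using IH[OF I] by blast
    have "?l \<cdot>\<^bsub>C\<^esub> (i \<cdot>\<^bsub>C\<^esub> x) = k'" using C.comp_assoc[OF x(1) P(2) l'] i x(2) by simp
    then show ?thesis using C.comp_in_Hom[OF x(1) P(2)] by metis
  qed
  then have "\<exists>x\<in>Hom C X' P. k' = ?l \<cdot>\<^bsub>C\<^esub> x" if "(X', k') \<in> insert Xk I" for X' k'
    using that P(3) j[symmetric] by (cases "(X', k') \<in> I") auto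
  ultimately show ?case using l' by blast
qed

text \<open>A morphism \<open>h : F G \<rightarrow> \<Sigma>\<^sup>e Y\<close> corresponds to \<open>\<Sigma>\<^sup>-\<^sup>e h \<circ> \<Theta>\<^sup>-\<^sup>e : F \<Sigma>\<^sup>-\<^sup>e G \<rightarrow> Y\<close>. Under this
  correspondence the action of a ring element becomes precomposition with a morphism in the image
  of \<open>F\<close>.\<close>

lemma desuspend_act:
  assumes r: "r \<in> Rd d" and G: "G \<in> Obj C" and Y: "Y \<in> Obj D"
    and h: "h \<in> Hom D (obj_map F G) (shift_obj D e Y)"
  shows "shift_arr D (- (d + e)) (D.act Y d r e h) \<cdot>\<^bsub>D\<^esub> \<Theta> (- (d + e)) G =
    (shift_arr D (- e) h \<cdot>\<^bsub>D\<^esub> \<Theta> (- e) G) \<cdot>\<^bsub>D\<^esub> arr_map F (shift_arr C (- (d + e)) (\<phi> r d G))"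
proof -
  let ?n = "- (d + e)"
  have rc: "r \<in> carrier R" using C.homogeneous_closed[OF r] .
  note \<phi> = C.action_Hom[OF rc G, of d]
  note \<Theta>d = \<Theta>_Hom[OF G, of d]
  note sh = D.shift_arr_Hom[OF h, of d]
  have Gd: "shift_obj C d G \<in> Obj C" using C.shift_obj_closed[OF G] .
  have 1: "shift_arr D ?n (arr_map F (\<phi> r d G)) \<in>
      Hom D (shift_obj D ?n (obj_map F G)) (shift_obj D ?n (obj_map F (shift_obj C d G)))"
    using D.shift_arr_Hom[OF F_Hom[OF \<phi>]] .
  have 2: "shift_arr D ?n (\<Theta> d G) \<in>
      Hom D (shift_obj D ?n (obj_map F (shift_obj C d G))) (shift_obj D (- e) (obj_map F G))"
    using D.shift_arr_Hom[OF \<Theta>d, of ?n] D.shift_obj_add[OF F_obj[OF G], of ?n d] by simp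
  have 3: "shift_arr D (- e) h \<in> Hom D (shift_obj D (- e) (obj_map F G)) Y"
    using D.shift_arr_Hom[OF h, of "- e"] D.shift_obj_cancel[OF Y] by simp
  have 4: "\<Theta> ?n (shift_obj C d G) \<in>
      Hom D (obj_map F (shift_obj C (- e) G)) (shift_obj D ?n (obj_map F (shift_obj C d G)))"
    using \<Theta>_Hom[OF Gd, of ?n] C.shift_obj_add[OF G, of ?n d] by simp
  have 5: "arr_map F (shift_arr C ?n (\<phi> r d G)) \<in>
      Hom D (obj_map F (shift_obj C ?n G)) (obj_map F (shift_obj C (- e) G))"
    using F_Hom[OF C.shift_arr_Hom[OF \<phi>, of ?n]] C.shift_obj_add[OF G, of ?n d] by simp
  note 6 = \<Theta>_Hom[OF G, of ?n]
  \<comment> \<open>Linearity of \<open>F\<close> enters here: the action is moved to the source,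
    where \<open>\<psi> r\<close> at \<open>F G\<close> is \<open>F\<close> of
    \<open>\<phi> r\<close> at \<open>G\<close> up to \<open>\<Theta>\<close>. What follows only
    moves \<open>\<Theta>\<close> past by naturality and merges the two comparison maps by the
    cocycle rule.\<close>
  have "D.act Y d r e h = shift_arr D d h \<cdot>\<^bsub>D\<^esub> (\<Theta> d G \<cdot>\<^bsub>D\<^esub> arr_map F (\<phi> r d G))"
    using D.act_shift[OF r h] \<Theta>_action[OF r G] by simp
  then have "shift_arr D ?n (D.act Y d r e h) = shift_arr D (- e) h \<cdot>\<^bsub>D\<^esub>
      (shift_arr D ?n (\<Theta> d G) \<cdot>\<^bsub>D\<^esub> shift_arr D ?n (arr_map F (\<phi> r d G)))"
    using D.shift_comp[OF D.comp_in_Hom[OF F_Hom[OF \<phi>] \<Theta>d] sh, of ?n] D.shift_comp[OF F_Hom[OF \<phi>] \<Theta>d, of ?n]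
      D.shift_arr_shift[OF D.Hom_Arr[OF h], of ?n d] by simp
  then have "shift_arr D ?n (D.act Y d r e h) \<cdot>\<^bsub>D\<^esub> \<Theta> ?n G = shift_arr D (- e) h \<cdot>\<^bsub>D\<^esub>
      (shift_arr D ?n (\<Theta> d G) \<cdot>\<^bsub>D\<^esub> (shift_arr D ?n (arr_map F (\<phi> r d G)) \<cdot>\<^bsub>D\<^esub> \<Theta> ?n G))"
    using D.comp_assoc[OF 6 1 2] D.comp_assoc[OF 6 D.comp_in_Hom[OF 1 2] 3] by simp
  also have "\<dots> = shift_arr D (- e) h \<cdot>\<^bsub>D\<^esub>
      ((shift_arr D ?n (\<Theta> d G) \<cdot>\<^bsub>D\<^esub> \<Theta> ?n (shift_obj C d G)) \<cdot>\<^bsub>D\<^esub> arr_map F (shift_arr C ?n (\<phi> r d G)))"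
    using \<Theta>_natural[OF \<phi>, of ?n] D.comp_assoc[OF 5 4 2] by simp
  also have "shift_arr D ?n (\<Theta> d G) \<cdot>\<^bsub>D\<^esub> \<Theta> ?n (shift_obj C d G) = \<Theta> (- e) G"
    using \<Theta>_add[OF G, of ?n d] by simp
  finally show ?thesis using D.comp_assoc[OF 5 \<Theta>_Hom[OF G] 3] by simp
qed

text \<open>The desuspensions of finitely many homogeneous generators factor through one
  \<open>a\<close>. Elements whose desuspension factors through \<open>a\<close> are closed under
  sums and, by \<open>desuspend_act\<close>, under the ring action, so induction on the span reaches
  all of Ext.\<close>

lemma exists_approximation:
  assumes G: "G \<in> Obj C" and Y: "Y \<in> Obj D"
  shows "\<exists>A\<in>Obj C. \<exists>a\<in>Hom D (obj_map F A) Y. \<forall>m. \<forall>h\<in>Hom D (obj_map F (shift_obj C m G)) Y.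
    \<exists>x\<in>Hom C (shift_obj C m G) A. h = a \<cdot>\<^bsub>D\<^esub> arr_map F x"
proof -
  have FG: "obj_map F G \<in> Obj D" using F_obj[OF G] .
  interpret M: graded_module R Rd "\<lambda>e. Hom D (obj_map F G) (shift_obj D e Y)" "add_arr D"
    "\<lambda>e. zero_arr D (obj_map F G) (shift_obj D e Y)" "D.act Y"
    using D.graded_module_Hom[OF FG Y] .
  obtain \<G> where \<G>: "finite \<G>" "\<And>e g. (e, g) \<in> \<G> \<Longrightarrow> g \<in> Hom D (obj_map F G) (shift_obj D e Y)"
    and span: "\<And>e h. h \<in> Hom D (obj_map F G) (shift_obj D e Y) \<Longrightarrow> M.span \<G> e h"
    using D.Ext_finite_span[OF Ext_finite_D FG Y] by blast
  define des where "des e h = shift_arr D (- e) h \<cdot>\<^bsub>D\<^esub> \<Theta> (- e) G" for e h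
  have s: "shift_arr D (- e) h \<in> Hom D (shift_obj D (- e) (obj_map F G)) Y"
    if "h \<in> Hom D (obj_map F G) (shift_obj D e Y)" for e h
    using D.shift_arr_Hom[OF that, of "- e"] D.shift_obj_cancel[OF Y] by simp
  have des: "des e h \<in> Hom D (obj_map F (shift_obj C (- e) G)) Y"
    if "h \<in> Hom D (obj_map F G) (shift_obj D e Y)" for e h
    unfolding des_def using D.comp_in_Hom[OF \<Theta>_Hom[OF G] s[OF that]] .
  let ?I = "(\<lambda>(e, g). (shift_obj C (- e) G, des e g)) ` \<G>"
  have "\<exists>A\<in>Obj C. \<exists>a\<in>Hom D (obj_map F A) Y. \<forall>(X, g)\<in>?I. \<exists>x\<in>Hom C X A. g = a \<cdot>\<^bsub>D\<^esub> arr_map F x"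
    by (rule finite_family_factors[OF _ G Y]) (use \<G> des C.shift_obj_closed[OF G] in auto)
  then obtain A a where A: "A \<in> Obj C" and a: "a \<in> Hom D (obj_map F A) Y"
    and I: "\<forall>(X, g)\<in>?I. \<exists>x\<in>Hom C X A. g = a \<cdot>\<^bsub>D\<^esub> arr_map F x" by blast
  have main: "\<exists>x\<in>Hom C (shift_obj C (- e) G) A. des e h = a \<cdot>\<^bsub>D\<^esub> arr_map F x" if "M.span \<G> e h" for e h
    using that
  proof induction
    case (gen e g)
    then have "(shift_obj C (- e) G, des e g) \<in> ?I" by force
    then show ?case using I by blast
  next
    case (zero e)
    have Ge: "shift_obj C (- e) G \<in> Obj C" using C.shift_obj_closed[OF G] .
    have "shift_arr D (- e) (zero_arr D (obj_map F G) (shift_obj D e Y)) =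
        zero_arr D (shift_obj D (- e) (obj_map F G)) Y"
      using D.shift_zero[OF FG D.shift_obj_closed[OF Y]] D.shift_obj_cancel[OF Y] by simp
    then have "des e (zero_arr D (obj_map F G) (shift_obj D e Y)) = zero_arr D (obj_map F (shift_obj C (- e) G)) Y"
      unfolding des_def using D.zero_comp[OF Y \<Theta>_Hom[OF G]] by simp
    also have "\<dots> = a \<cdot>\<^bsub>D\<^esub> arr_map F (zero_arr C (shift_obj C (- e) G) A)"
      using F_zero[OF Ge A] D.comp_zero[OF F_obj[OF Ge] a] by simp
    finally show ?case using C.zero_in_Hom[OF Ge A] by blast
  next
    case (add e h h')
    then obtain x x' where x: "x \<in> Hom C (shift_obj C (- e) G) A" "des e h = a \<cdot>\<^bsub>D\<^esub> arr_map F x"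
      and x': "x' \<in> Hom C (shift_obj C (- e) G) A" "des e h' = a \<cdot>\<^bsub>D\<^esub> arr_map F x'" by blast
    have h: "h \<in> Hom D (obj_map F G) (shift_obj D e Y)" "h' \<in> Hom D (obj_map F G) (shift_obj D e Y)"
      using M.span_closed[OF _ \<G>(2)] add(1,2) by blast+
    have "des e (h \<boxplus>\<^bsub>D\<^esub> h') = des e h \<boxplus>\<^bsub>D\<^esub> des e h'"
      unfolding des_def using D.shift_add[OF h] D.add_comp[OF \<Theta>_Hom[OF G] s[OF h(1)] s[OF h(2)]] by simp
    also have "\<dots> = a \<cdot>\<^bsub>D\<^esub> arr_map F (x \<boxplus>\<^bsub>C\<^esub> x')"
      using x x' F_add[OF x(1) x'(1)] D.comp_add[OF F_Hom[OF x(1)] F_Hom[OF x'(1)] a] by simp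
    finally show ?case using C.add_in_Hom[OF x(1) x'(1)] by blast
  next
    case (act r d e h)
    then obtain x where x: "x \<in> Hom C (shift_obj C (- e) G) A" "des e h = a \<cdot>\<^bsub>D\<^esub> arr_map F x" by blast
    have h: "h \<in> Hom D (obj_map F G) (shift_obj D e Y)"
      using M.span_closed[OF _ \<G>(2)] act(2) by blast
    let ?y = "shift_arr C (- (d + e)) (\<phi> r d G)"
    have y: "?y \<in> Hom C (shift_obj C (- (d + e)) G) (shift_obj C (- e) G)"
      using C.shift_arr_Hom[OF C.action_Hom[OF C.homogeneous_closed[OF act(1)] G], of "- (d + e)" d]
        C.shift_obj_add[OF G, of "- (d + e)" d] by simp
    have "des (d + e) (D.act Y d r e h) = (a \<cdot>\<^bsub>D\<^esub> arr_map F x) \<cdot>\<^bsub>D\<^esub> arr_map F ?y"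
      using desuspend_act[OF act(1) G Y h] x(2) unfolding des_def by simp
    also have "\<dots> = a \<cdot>\<^bsub>D\<^esub> arr_map F (x \<cdot>\<^bsub>C\<^esub> ?y)"
      using F_comp[OF y x(1)] D.comp_assoc[OF F_Hom[OF y] F_Hom[OF x(1)] a] by simp
    finally show ?case using C.comp_in_Hom[OF y x(1)] by blast
  qed
  have "\<exists>x\<in>Hom C (shift_obj C m G) A. h = a \<cdot>\<^bsub>D\<^esub> arr_map F x"
    if h: "h \<in> Hom D (obj_map F (shift_obj C m G)) Y" for m h
  proof -
    obtain j where j: "j \<in> Hom D (shift_obj D m (obj_map F G)) (obj_map F (shift_obj C m G))"
      "j \<cdot>\<^bsub>D\<^esub> \<Theta> m G = idt D (obj_map F (shift_obj C m G))" using \<Theta>_left_inverse[OF G] by blast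
    \<comment> \<open>The homogeneous element whose desuspension is \<open>h\<close>. Its degree is
      \<open>- m\<close> because \<open>des\<close> shifts back by the degree, and the left inverse
      \<open>j\<close> cancels the comparison map in \<open>des\<close>.\<close>
    let ?k = "shift_arr D (- m) (h \<cdot>\<^bsub>D\<^esub> j)"
    have hj: "h \<cdot>\<^bsub>D\<^esub> j \<in> Hom D (shift_obj D m (obj_map F G)) Y" using D.comp_in_Hom[OF j(1) h] .
    have k: "?k \<in> Hom D (obj_map F G) (shift_obj D (- m) Y)"
      using D.shift_arr_Hom[OF hj, of "- m"] D.shift_obj_cancel[OF FG] by simp
    have "des (- m) ?k = (h \<cdot>\<^bsub>D\<^esub> j) \<cdot>\<^bsub>D\<^esub> \<Theta> m G"
      unfolding des_def using D.shift_arr_cancel[OF D.Hom_Arr[OF hj], of m] by simp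
    also have "\<dots> = h" using D.comp_assoc[OF \<Theta>_Hom[OF G] j(1) h] j(2) D.comp_idt[OF h] by simp
    finally show ?thesis using main[OF span[OF k]] by simp
  qed
  then show ?thesis using A a by blast
qed

text \<open>Up to shifts, the morphisms killed by \<open>a\<close> form a graded submodule of the
  finitely generated module Ext from \<open>G\<close> to \<open>A\<close>. Noetherianity makes it
  finitely generated, and its generators are bundled into one map.\<close>

lemma exists_kernel_cover:
  assumes G: "G \<in> Obj C" and A: "A \<in> Obj C" and a: "a \<in> Hom D (obj_map F A) Y"
  shows "\<exists>B. \<exists>k\<in>Hom C B A. a \<cdot>\<^bsub>D\<^esub> arr_map F k = zero_arr D (obj_map F B) Y \<and>
    (\<forall>m. \<forall>x\<in>Hom C (shift_obj C m G) A.
      a \<cdot>\<^bsub>D\<^esub> arr_map F x = zero_arr D (obj_map F (shift_obj C m G)) Y \<longrightarrow>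
      (\<exists>y\<in>Hom C (shift_obj C m G) B. x = k \<cdot>\<^bsub>C\<^esub> y))"
proof -
  have Y: "Y \<in> Obj D" using D.Hom_Obj[OF a] by blast
  interpret M: graded_module R Rd "\<lambda>e. Hom C G (shift_obj C e A)" "add_arr C"
    "\<lambda>e. zero_arr C G (shift_obj C e A)" "C.act A"
    using C.graded_module_Hom[OF G A] .
  obtain \<G> where \<G>: "finite \<G>" "\<And>e g. (e, g) \<in> \<G> \<Longrightarrow> g \<in> Hom C G (shift_obj C e A)"
    and span: "\<And>e h. h \<in> Hom C G (shift_obj C e A) \<Longrightarrow> M.span \<G> e h"
    using C.Ext_finite_span[OF Ext_finite_C G A] by blast
  have Ge: "shift_obj C e G \<in> Obj C" for e using C.shift_obj_closed[OF G] .
  have s: "shift_arr C (- e) h \<in> Hom C (shift_obj C (- e) G) A"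
    if "h \<in> Hom C G (shift_obj C e A)" for e h
    using C.shift_arr_Hom[OF that, of "- e"] C.shift_obj_cancel[OF A] by simp
  have s0: "shift_arr C (- e) (zero_arr C G (shift_obj C e A)) = zero_arr C (shift_obj C (- e) G) A" for e
    using C.shift_zero[OF G C.shift_obj_closed[OF A]] C.shift_obj_cancel[OF A] by simp
  \<comment> \<open>After desuspension the ring acts by precomposition. Hence being killed by
    \<open>a\<close>, and later factoring through \<open>k\<close>, are both stable under the
    action.\<close>
  have sact: "shift_arr C (- (d + e)) (\<phi> r d G) \<in> Hom C (shift_obj C (- (d + e)) G) (shift_obj C (- e) G)"
    "shift_arr C (- (d + e)) (C.act A d r e h) =
      shift_arr C (- e) h \<cdot>\<^bsub>C\<^esub> shift_arr C (- (d + e)) (\<phi> r d G)"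
    if r: "r \<in> Rd d" and h: "h \<in> Hom C G (shift_obj C e A)" for r d e h
  proof -
    note \<phi> = C.action_Hom[OF C.homogeneous_closed[OF r] G, of d]
    show "shift_arr C (- (d + e)) (\<phi> r d G) \<in> Hom C (shift_obj C (- (d + e)) G) (shift_obj C (- e) G)"
      using C.shift_arr_Hom[OF \<phi>, of "- (d + e)"] C.shift_obj_add[OF G, of "- (d + e)" d] by simp
    show "shift_arr C (- (d + e)) (C.act A d r e h) =
        shift_arr C (- e) h \<cdot>\<^bsub>C\<^esub> shift_arr C (- (d + e)) (\<phi> r d G)"
      using C.act_shift[OF r h] C.shift_comp[OF \<phi> C.shift_arr_Hom[OF h, of d], of "- (d + e)"]
        C.shift_arr_shift[OF C.Hom_Arr[OF h], of "- (d + e)" d] by simp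
  qed
  define N where "N e = {h \<in> Hom C G (shift_obj C e A).
    a \<cdot>\<^bsub>D\<^esub> arr_map F (shift_arr C (- e) h) = zero_arr D (obj_map F (shift_obj C (- e) G)) Y}" for e
  have "M.submodule N"
    unfolding graded_submodule_def
  proof (intro conjI allI ballI)
    show "N e \<subseteq> Hom C G (shift_obj C e A)" for e unfolding N_def by blast
    show "zero_arr C G (shift_obj C e A) \<in> N e" for e
      unfolding N_def using M.z_closed s0 F_zero[OF Ge A] D.comp_zero[OF F_obj[OF Ge] a] by simp
    show "h \<boxplus>\<^bsub>C\<^esub> h' \<in> N e" if "h \<in> N e" "h' \<in> N e" for e h h'
    proof -
      have h: "h \<in> Hom C G (shift_obj C e A)" "h' \<in> Hom C G (shift_obj C e A)"
        using that unfolding N_def by auto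
      have "a \<cdot>\<^bsub>D\<^esub> arr_map F (shift_arr C (- e) (h \<boxplus>\<^bsub>C\<^esub> h')) =
          a \<cdot>\<^bsub>D\<^esub> arr_map F (shift_arr C (- e) h) \<boxplus>\<^bsub>D\<^esub> a \<cdot>\<^bsub>D\<^esub> arr_map F (shift_arr C (- e) h')"
        using C.shift_add[OF h] F_add[OF s[OF h(1)] s[OF h(2)]]
          D.comp_add[OF F_Hom[OF s[OF h(1)]] F_Hom[OF s[OF h(2)]] a] by simp
      then show ?thesis
        using that C.add_in_Hom[OF h] D.zero_add[OF D.zero_in_Hom[OF F_obj[OF Ge] Y]] unfolding N_def by simp
    qed
    show "C.act A d r e h \<in> N (d + e)" if r: "r \<in> Rd d" and N: "h \<in> N e" for d r e h
    proof -
      have h: "h \<in> Hom C G (shift_obj C e A)" using N unfolding N_def by auto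
      note y = sact[OF r h]
      have "a \<cdot>\<^bsub>D\<^esub> arr_map F (shift_arr C (- (d + e)) (C.act A d r e h)) =
          (a \<cdot>\<^bsub>D\<^esub> arr_map F (shift_arr C (- e) h)) \<cdot>\<^bsub>D\<^esub> arr_map F (shift_arr C (- (d + e)) (\<phi> r d G))"
        unfolding y(2) using F_comp[OF y(1) s[OF h]] D.comp_assoc[OF F_Hom[OF y(1)] F_Hom[OF s[OF h]] a] by simp
      also have "\<dots> = zero_arr D (obj_map F (shift_obj C (- (d + e)) G)) Y"
        using N D.zero_comp[OF Y F_Hom[OF y(1)]] unfolding N_def by simp
      finally show ?thesis using M.act_closed[OF r h] unfolding N_def by simp
    qed
  qed
  from M.submodule_finitely_generated[OF noetherian \<G> this span] obtain \<H> where
    \<H>: "finite \<H>" "\<And>e h. (e, h) \<in> \<H> \<Longrightarrow> h \<in> N e" "\<And>e h. h \<in> N e \<Longrightarrow> M.span \<H> e h"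
    unfolding N_def by fastforce
  have \<H>H: "h \<in> Hom C G (shift_obj C e A)" if "(e, h) \<in> \<H>" for e h using \<H>(2)[OF that] unfolding N_def by blast
  let ?I = "(\<lambda>(e, h). (shift_obj C (- e) G, shift_arr C (- e) h)) ` \<H>"
  have "\<exists>B. \<exists>k\<in>Hom C B A. a \<cdot>\<^bsub>D\<^esub> arr_map F k = zero_arr D (obj_map F B) Y \<and>
      (\<forall>(X, x)\<in>?I. \<exists>y\<in>Hom C X B. x = k \<cdot>\<^bsub>C\<^esub> y)"
    by (rule finite_kernel_factors[OF _ a A]) (use \<H>(1,2) s in \<open>auto simp: N_def\<close>)
  then obtain B k where k: "k \<in> Hom C B A" "a \<cdot>\<^bsub>D\<^esub> arr_map F k = zero_arr D (obj_map F B) Y"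
    and I: "\<forall>(X, x)\<in>?I. \<exists>y\<in>Hom C X B. x = k \<cdot>\<^bsub>C\<^esub> y" by blast
  have B: "B \<in> Obj C" using C.Hom_Obj[OF k(1)] by blast
  have main: "\<exists>y\<in>Hom C (shift_obj C (- e) G) B. shift_arr C (- e) h = k \<cdot>\<^bsub>C\<^esub> y" if "M.span \<H> e h" for e h
    using that
  proof induction
    case (gen e h)
    then have "(shift_obj C (- e) G, shift_arr C (- e) h) \<in> ?I" by force
    then show ?case using I by blast
  next
    case (zero e)
    show ?case using s0 C.comp_zero[OF Ge k(1)] C.zero_in_Hom[OF Ge B] by metis
  next
    case (add e h h')
    then obtain y y' where y: "y \<in> Hom C (shift_obj C (- e) G) B" "shift_arr C (- e) h = k \<cdot>\<^bsub>C\<^esub> y"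
      and y': "y' \<in> Hom C (shift_obj C (- e) G) B" "shift_arr C (- e) h' = k \<cdot>\<^bsub>C\<^esub> y'" by blast
    have h: "h \<in> Hom C G (shift_obj C e A)" "h' \<in> Hom C G (shift_obj C e A)"
      using M.span_closed[OF _ \<H>H] add(1,2) by blast+
    have "shift_arr C (- e) (h \<boxplus>\<^bsub>C\<^esub> h') = k \<cdot>\<^bsub>C\<^esub> (y \<boxplus>\<^bsub>C\<^esub> y')"
      using C.shift_add[OF h] y y' C.comp_add[OF y(1) y'(1) k(1)] by simp
    then show ?case using C.add_in_Hom[OF y(1) y'(1)] by blast
  next
    case (act r d e h)
    then obtain y where y: "y \<in> Hom C (shift_obj C (- e) G) B" "shift_arr C (- e) h = k \<cdot>\<^bsub>C\<^esub> y" by blast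
    have h: "h \<in> Hom C G (shift_obj C e A)" using M.span_closed[OF _ \<H>H] act(2) by blast
    note z = sact[OF act(1) h]
    have "shift_arr C (- (d + e)) (C.act A d r e h) = k \<cdot>\<^bsub>C\<^esub> (y \<cdot>\<^bsub>C\<^esub> shift_arr C (- (d + e)) (\<phi> r d G))"
      using z(2) y(2) C.comp_assoc[OF z(1) y(1) k(1)] by simp
    then show ?case using C.comp_in_Hom[OF z(1) y(1)] by blast
  qed
  have "\<exists>y\<in>Hom C (shift_obj C m G) B. x = k \<cdot>\<^bsub>C\<^esub> y"
    if x: "x \<in> Hom C (shift_obj C m G) A"
      and ax: "a \<cdot>\<^bsub>D\<^esub> arr_map F x = zero_arr D (obj_map F (shift_obj C m G)) Y" for m x
  proof -
    have h: "shift_arr C (- m) x \<in> Hom C G (shift_obj C (- m) A)"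
      using C.shift_arr_Hom[OF x, of "- m"] C.shift_obj_cancel[OF G] by simp
    have unshift: "shift_arr C (- (- m)) (shift_arr C (- m) x) = x"
      using C.shift_arr_cancel[OF C.Hom_Arr[OF x], of m] by simp
    then have "shift_arr C (- m) x \<in> N (- m)" unfolding N_def using h ax by simp
    from main[OF \<H>(3)[OF this]] show ?thesis unfolding unshift by simp
  qed
  then show ?thesis using k by blast
qed

lemma exists_approximation_step:
  assumes G: "G \<in> Obj C" and A: "A \<in> Obj C" and a: "a \<in> Hom D (obj_map F A) Y"
  shows "\<exists>A'\<in>Obj C. \<exists>u\<in>Hom C A A'. \<exists>a'\<in>Hom D (obj_map F A') Y. a = a' \<cdot>\<^bsub>D\<^esub> arr_map F u \<and>
    (\<forall>m. \<forall>x\<in>Hom C (shift_obj C m G) A.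
      a \<cdot>\<^bsub>D\<^esub> arr_map F x = zero_arr D (obj_map F (shift_obj C m G)) Y \<longrightarrow>
      u \<cdot>\<^bsub>C\<^esub> x = zero_arr C (shift_obj C m G) A')"
proof -
  obtain B k where k: "k \<in> Hom C B A" "a \<cdot>\<^bsub>D\<^esub> arr_map F k = zero_arr D (obj_map F B) Y"
    and cover: "\<And>m x. \<lbrakk>x \<in> Hom C (shift_obj C m G) A;
      a \<cdot>\<^bsub>D\<^esub> arr_map F x = zero_arr D (obj_map F (shift_obj C m G)) Y\<rbrakk> \<Longrightarrow>
      \<exists>y\<in>Hom C (shift_obj C m G) B. x = k \<cdot>\<^bsub>C\<^esub> y"
    using exists_kernel_cover[OF G A a] by blast
  have B: "B \<in> Obj C" using C.Hom_Obj[OF k(1)] by blast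
  obtain A' u w where t: "is_exact_triangle C B A A' k u w" using C.TR1_cone[OF B A k(1)] by blast
  have A': "A' \<in> Obj C" and u: "u \<in> Hom C A A'"
    using t unfolding is_exact_triangle_def is_triangle_def by auto
  obtain a' where a': "a' \<in> Hom D (obj_map F A') Y" "a = a' \<cdot>\<^bsub>D\<^esub> arr_map F u"
    using D.triangle_factor[OF F_triangle[OF t] a k(2)] by blast
  have "u \<cdot>\<^bsub>C\<^esub> x = zero_arr C (shift_obj C m G) A'"
    if x: "x \<in> Hom C (shift_obj C m G) A"
      "a \<cdot>\<^bsub>D\<^esub> arr_map F x = zero_arr D (obj_map F (shift_obj C m G)) Y" for m x
  proof -
    obtain y where y: "y \<in> Hom C (shift_obj C m G) B" "x = k \<cdot>\<^bsub>C\<^esub> y" using cover[OF x] by blast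
    show ?thesis
      unfolding y(2) using C.comp_assoc[OF y(1) k(1) u] C.triangle_comp_zero[OF t] C.zero_comp[OF A' y(1)] by simp
  qed
  then show ?thesis using A' u a' by blast
qed

end

section \<open>Strong generation\<close>

text \<open>Transports the description of coproducts to all shifts without showing that a shift of a
  coproduct is again a coproduct.\<close>

lemma (in triangulated_category) shift_factor_sums:
  assumes X: "X \<in> Obj C" and Y: "Y \<in> Obj C" and f: "f \<in> factor_sums C \<X> X Y"
  shows "shift_arr C d f \<in> factor_sums C (shift_obj C d ` \<X>) (shift_obj C d X) (shift_obj C d Y)"
  using f
proof induction
  case zero
  show ?case unfolding shift_zero[OF X Y] by (rule factor_sums.zero)
next
  case (add y W x f)
  note xy = comp_in_Hom[OF add(1,3)]
  have "shift_arr C d (f \<boxplus> x \<cdot> y) = shift_arr C d f \<boxplus> shift_arr C d x \<cdot> shift_arr C d y"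
    using shift_add[OF factor_sums_Hom[OF add(4) X Y] xy] shift_comp[OF add(1,3)] by simp
  then show ?case
    using factor_sums.add[OF shift_arr_Hom[OF add(1)] imageI[OF add(2)] shift_arr_Hom[OF add(3)] add(5)]
    by simp
qed

text \<open>An enlargement of \<open>thick C G (Suc n)\<close> whose closure under suspension is immediate.\<close>

primrec iterated_extensions ::
    "('o, 'm, 'x) triangulated_category_scheme \<Rightarrow> 'o \<Rightarrow> nat \<Rightarrow> 'o set" where
  "iterated_extensions C G 0 = thick_one C G"
| "iterated_extensions C G (Suc n) = {X. \<exists>P Y Z f g h. is_retract C X P \<and>
     is_exact_triangle C Y P Z f g h \<and> Y \<in> iterated_extensions C G n \<and> Z \<in> thick_one C G}"

lemma (in triangulated_category) thick_subset_iterated_extensions: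
  "thick C G (Suc n) \<subseteq> iterated_extensions C G n"
proof (induction n)
  case (Suc n)
  show ?case
  proof
    fix X assume "X \<in> thick C G (Suc (Suc n))"
    then obtain X' P \<iota> Y Z f g h where "is_coproduct C [X, X'] P \<iota>" and
      "is_exact_triangle C Y P Z f g h" "Y \<in> thick C G (Suc n)" "Z \<in> thick_one C G"
      unfolding thick.simps by blast
    then show "X \<in> iterated_extensions C G (Suc n)"
      using coproduct_summand_retract Suc.IH unfolding iterated_extensions.simps by blast
  qed
qed simp

text \<open>Needed because the killing half for an extension asks for lifts on the suspension of its
  first term.\<close>

lemma (in triangulated_category) iterated_extensions_susp:
  "X \<in> iterated_extensions C G n \<Longrightarrow> obj_map (susp C) X \<in> iterated_extensions C G n"
proof (induction n arbitrary: X)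
  case 0
  then show ?case using thick_one.suspension[of X C G 1] by (simp add: shift_obj_1)
next
  case (Suc n)
  obtain P Y Z f g h where "is_retract C X P" "is_exact_triangle C Y P Z f g h"
    "Y \<in> iterated_extensions C G n" "Z \<in> thick_one C G"
    using Suc.prems unfolding iterated_extensions.simps by blast
  moreover have "is_retract C (obj_map (susp C) X) (obj_map (susp C) P)"
    using shift_retract[OF calculation(1), of 1] by (simp add: shift_obj_1)
  moreover have "obj_map (susp C) Z \<in> thick_one C G"
    using thick_one.suspension[OF calculation(4), of 1] by (simp add: shift_obj_1)
  ultimately show ?case
    using triangle_susp[OF \<open>is_exact_triangle C Y P Z f g h\<close>] Suc.IH
    unfolding iterated_extensions.simps by blast
qed

text \<open>The tower of the A_i, isolated from the ring: the linear structure serves to construct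
  it, while the arguments below use only exactness of \<open>F\<close> and the behaviour on shifts
  of \<open>G\<close>.\<close>

locale approximation = exact_functor C D F \<theta>
  for C :: "('o, 'm, 'x) triangulated_category_scheme"
    and D :: "('p, 'n, 'y) triangulated_category_scheme"
    and F :: "('o, 'm, 'p, 'n) functor_data" and \<theta> :: "'o \<Rightarrow> 'n" +
  fixes G :: 'o and Y :: 'p and A :: "nat \<Rightarrow> 'o" and a :: "nat \<Rightarrow> 'n" and u :: "nat \<Rightarrow> 'm"
  assumes G: "G \<in> Obj C" and A: "A i \<in> Obj C"
    and a: "a i \<in> Hom D (obj_map F (A i)) Y"
    and u: "u i \<in> Hom C (A i) (A (Suc i))"
    and a_u: "a i = a (Suc i) \<cdot>\<^bsub>D\<^esub> arr_map F (u i)"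
    and surj: "h \<in> Hom D (obj_map F (shift_obj C m G)) Y \<Longrightarrow>
      \<exists>x\<in>Hom C (shift_obj C m G) (A i). h = a i \<cdot>\<^bsub>D\<^esub> arr_map F x"
    and kill: "\<lbrakk>x \<in> Hom C (shift_obj C m G) (A i);
        a i \<cdot>\<^bsub>D\<^esub> arr_map F x = zero_arr D (obj_map F (shift_obj C m G)) Y\<rbrakk> \<Longrightarrow>
      u i \<cdot>\<^bsub>C\<^esub> x = zero_arr C (shift_obj C m G) (A (Suc i))"
begin

lemma Y: "Y \<in> Obj D"
  using D.Hom_Obj[OF a] by blast

primrec transition :: "nat \<Rightarrow> nat \<Rightarrow> 'm" where
  "transition i 0 = idt C (A i)"
| "transition i (Suc k) = u (i + k) \<cdot>\<^bsub>C\<^esub> transition i k"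

lemma transition_Hom: "transition i k \<in> Hom C (A i) (A (i + k))"
proof (induction k)
  case 0
  show ?case using C.idt_in_Hom[OF A] by simp
next
  case (Suc k)
  show ?case using C.comp_in_Hom[OF Suc u] by simp
qed

lemma a_transition: "a (i + k) \<cdot>\<^bsub>D\<^esub> arr_map F (transition i k) = a i"
proof (induction k)
  case 0
  show ?case using F_idt[OF A] D.comp_idt[OF a] by simp
next
  case (Suc k)
  show ?case
    using F_comp[OF transition_Hom u] D.comp_assoc[OF F_Hom[OF transition_Hom] F_Hom[OF u] a]
      a_u[of "i + k"] Suc by simp
qed

definition surj_at :: "nat \<Rightarrow> 'o \<Rightarrow> bool" where
  "surj_at i X \<longleftrightarrow> (\<forall>h\<in>Hom D (obj_map F X) Y. \<exists>x\<in>Hom C X (A i). h = a i \<cdot>\<^bsub>D\<^esub> arr_map F x)"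

text \<open>Unlike \<open>surj_at\<close>, this demands one lag for all stages \<open>i\<close>,
  since an extension applies the property of its third term at the later stage reached after killing
  on the first.\<close>

definition kill_at :: "nat \<Rightarrow> 'o \<Rightarrow> bool" where
  "kill_at k X \<longleftrightarrow> (\<forall>i. \<forall>x\<in>Hom C X (A i). a i \<cdot>\<^bsub>D\<^esub> arr_map F x = zero_arr D (obj_map F X) Y \<longrightarrow>
     transition i k \<cdot>\<^bsub>C\<^esub> x = zero_arr C X (A (i + k)))"

lemma surj_atD: "\<lbrakk>surj_at i X; h \<in> Hom D (obj_map F X) Y\<rbrakk> \<Longrightarrow>
    \<exists>x\<in>Hom C X (A i). h = a i \<cdot>\<^bsub>D\<^esub> arr_map F x"
  unfolding surj_at_def by blast

lemma kill_atD: "\<lbrakk>kill_at k X; x \<in> Hom C X (A i);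
    a i \<cdot>\<^bsub>D\<^esub> arr_map F x = zero_arr D (obj_map F X) Y\<rbrakk> \<Longrightarrow>
    transition i k \<cdot>\<^bsub>C\<^esub> x = zero_arr C X (A (i + k))"
  unfolding kill_at_def by blast

lemma transition_1: "transition i (Suc 0) = u i"
  using C.comp_idt[OF u] by simp

lemma a_comp: "\<lbrakk>y \<in> Hom C X W; x \<in> Hom C W (A i)\<rbrakk> \<Longrightarrow>
    a i \<cdot>\<^bsub>D\<^esub> arr_map F (x \<cdot>\<^bsub>C\<^esub> y) = (a i \<cdot>\<^bsub>D\<^esub> arr_map F x) \<cdot>\<^bsub>D\<^esub> arr_map F y"
  using F_comp[of y X W x "A i"] D.comp_assoc[OF F_Hom F_Hom a] by simp

lemma a_add: "\<lbrakk>x \<in> Hom C X (A i); x' \<in> Hom C X (A i)\<rbrakk> \<Longrightarrow>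
    a i \<cdot>\<^bsub>D\<^esub> arr_map F (x \<boxplus>\<^bsub>C\<^esub> x') = a i \<cdot>\<^bsub>D\<^esub> arr_map F x \<boxplus>\<^bsub>D\<^esub> a i \<cdot>\<^bsub>D\<^esub> arr_map F x'"
  using F_add[of x X "A i" x'] D.comp_add[OF F_Hom F_Hom a] by simp

lemma a_neg: "x \<in> Hom C X (A i) \<Longrightarrow>
    a i \<cdot>\<^bsub>D\<^esub> arr_map F (neg_arr C x) = neg_arr D (a i \<cdot>\<^bsub>D\<^esub> arr_map F x)"
  using F_neg[of x X "A i"] D.comp_neg[OF F_Hom a] by simp

lemma a_Hom: "x \<in> Hom C X (A i) \<Longrightarrow> a i \<cdot>\<^bsub>D\<^esub> arr_map F x \<in> Hom D (obj_map F X) Y"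
  using D.comp_in_Hom[OF F_Hom a] .

lemma a_advance: "x \<in> Hom C X (A i) \<Longrightarrow>
    a (i + k) \<cdot>\<^bsub>D\<^esub> arr_map F (transition i k \<cdot>\<^bsub>C\<^esub> x) = a i \<cdot>\<^bsub>D\<^esub> arr_map F x"
  using a_comp[OF _ transition_Hom] a_transition by simp

text \<open>Write \<open>h\<close> as \<open>h\<close> composed with \<open>F\<close> of the
  identity and expand the identity: each summand is a morphism on some \<open>W\<close>, which
  lifts, composed with a morphism in the image of \<open>F\<close>.\<close>

lemma surj_at_factor_sums:
  assumes X: "X \<in> Obj C" and id: "idt C X \<in> factor_sums C \<X> X X" and \<X>: "\<And>W. W \<in> \<X> \<Longrightarrow> surj_at i W"
  shows "surj_at i X"
  unfolding surj_at_def
proof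
  fix h assume h: "h \<in> Hom D (obj_map F X) Y"
  have "\<exists>x\<in>Hom C X (A i). h \<cdot>\<^bsub>D\<^esub> arr_map F e = a i \<cdot>\<^bsub>D\<^esub> arr_map F x" if "e \<in> factor_sums C \<X> X X" for e
    using that
  proof induction
    case zero
    have "h \<cdot>\<^bsub>D\<^esub> arr_map F (zero_arr C X X) = a i \<cdot>\<^bsub>D\<^esub> arr_map F (zero_arr C X (A i))"
      using F_zero[OF X X] F_zero[OF X A] D.comp_zero[OF F_obj[OF X] h] D.comp_zero[OF F_obj[OF X] a] by simp
    then show ?case using C.zero_in_Hom[OF X A] by blast
  next
    case (add y W w f)
    then obtain x where x: "x \<in> Hom C X (A i)" "h \<cdot>\<^bsub>D\<^esub> arr_map F f = a i \<cdot>\<^bsub>D\<^esub> arr_map F x" by blast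
    obtain x' where x': "x' \<in> Hom C W (A i)" "h \<cdot>\<^bsub>D\<^esub> arr_map F w = a i \<cdot>\<^bsub>D\<^esub> arr_map F x'"
      using surj_atD[OF \<X>[OF add(2)] D.comp_in_Hom[OF F_Hom[OF add(3)] h]] by blast
    note f = C.factor_sums_Hom[OF add(4) X X] and wy = C.comp_in_Hom[OF add(1,3)]
    note x'y = C.comp_in_Hom[OF add(1) x'(1)]
    have "h \<cdot>\<^bsub>D\<^esub> arr_map F (f \<boxplus>\<^bsub>C\<^esub> w \<cdot>\<^bsub>C\<^esub> y) =
        h \<cdot>\<^bsub>D\<^esub> arr_map F f \<boxplus>\<^bsub>D\<^esub> h \<cdot>\<^bsub>D\<^esub> (arr_map F w \<cdot>\<^bsub>D\<^esub> arr_map F y)"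
      using F_add[OF f wy] D.comp_add[OF F_Hom[OF f] F_Hom[OF wy] h] F_comp[OF add(1,3)] by simp
    also have "h \<cdot>\<^bsub>D\<^esub> (arr_map F w \<cdot>\<^bsub>D\<^esub> arr_map F y) = (h \<cdot>\<^bsub>D\<^esub> arr_map F w) \<cdot>\<^bsub>D\<^esub> arr_map F y"
      using D.comp_assoc[OF F_Hom[OF add(1)] F_Hom[OF add(3)] h] .
    also have "\<dots> = a i \<cdot>\<^bsub>D\<^esub> arr_map F (x' \<cdot>\<^bsub>C\<^esub> y)" using x'(2) a_comp[OF add(1) x'(1)] by simp
    also have "h \<cdot>\<^bsub>D\<^esub> arr_map F f \<boxplus>\<^bsub>D\<^esub> a i \<cdot>\<^bsub>D\<^esub> arr_map F (x' \<cdot>\<^bsub>C\<^esub> y) =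
        a i \<cdot>\<^bsub>D\<^esub> arr_map F (x \<boxplus>\<^bsub>C\<^esub> x' \<cdot>\<^bsub>C\<^esub> y)"
      using x(2) a_add[OF x(1) x'y] by simp
    finally show ?case using C.add_in_Hom[OF x(1) x'y] by blast
  qed
  from this[OF id] show "\<exists>x\<in>Hom C X (A i). h = a i \<cdot>\<^bsub>D\<^esub> arr_map F x"
    using F_idt[OF X] D.comp_idt[OF h] by simp
qed

lemma kill_at_factor_sums:
  assumes X: "X \<in> Obj C" and id: "idt C X \<in> factor_sums C \<X> X X" and \<X>: "\<And>W. W \<in> \<X> \<Longrightarrow> kill_at k W"
  shows "kill_at k X"
  unfolding kill_at_def
proof (intro allI ballI impI)
  fix i x assume x: "x \<in> Hom C X (A i)" and ax: "a i \<cdot>\<^bsub>D\<^esub> arr_map F x = zero_arr D (obj_map F X) Y"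
  have tx: "transition i k \<cdot>\<^bsub>C\<^esub> x \<in> Hom C X (A (i + k))" using C.comp_in_Hom[OF x transition_Hom] .
  have "(transition i k \<cdot>\<^bsub>C\<^esub> x) \<cdot>\<^bsub>C\<^esub> e = zero_arr C X (A (i + k))" if "e \<in> factor_sums C \<X> X X" for e
    using that
  proof induction
    case zero
    show ?case using C.comp_zero[OF X tx] .
  next
    case (add y W w f)
    note f = C.factor_sums_Hom[OF add(4) X X] and wy = C.comp_in_Hom[OF add(1,3)]
    have "a i \<cdot>\<^bsub>D\<^esub> arr_map F (x \<cdot>\<^bsub>C\<^esub> w) = zero_arr D (obj_map F W) Y"
      using a_comp[OF add(3) x] ax D.zero_comp[OF Y F_Hom[OF add(3)]] by simp
    from kill_atD[OF \<X>[OF add(2)] C.comp_in_Hom[OF add(3) x] this]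
    have "(transition i k \<cdot>\<^bsub>C\<^esub> x) \<cdot>\<^bsub>C\<^esub> w = zero_arr C W (A (i + k))"
      using C.comp_assoc[OF add(3) x transition_Hom] by simp
    then have "(transition i k \<cdot>\<^bsub>C\<^esub> x) \<cdot>\<^bsub>C\<^esub> (w \<cdot>\<^bsub>C\<^esub> y) = zero_arr C X (A (i + k))"
      using C.comp_assoc[OF add(1,3) tx] C.zero_comp[OF A add(1)] by simp
    then show ?case
      using C.comp_add[OF f wy tx] add(5) C.zero_add[OF C.zero_in_Hom[OF X A]] by simp
  qed
  from this[OF id] show "transition i k \<cdot>\<^bsub>C\<^esub> x = zero_arr C X (A (i + k))"
    using C.comp_idt[OF tx] by simp
qed

text \<open>Sums of factorizations change neither stage nor lag, so all of \<open>thick_one\<close>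
  behaves like \<open>G\<close>. All shifts are treated at once so that the suspension rule is
  immediate.\<close>

lemma thick_one_surj_kill:
  assumes "X \<in> thick_one C G"
  shows "X \<in> Obj C \<and> (\<forall>d. surj_at i (shift_obj C d X) \<and> kill_at (Suc 0) (shift_obj C d X))"
  using assms
proof induction
  case generator
  have "surj_at i (shift_obj C d G)" for d
    unfolding surj_at_def using surj by blast
  moreover have "kill_at (Suc 0) (shift_obj C d G)" for d
    unfolding kill_at_def transition_1 using kill by simp
  ultimately show ?case using G by blast
next
  case (coproduct Xs P \<iota>)
  have P: "P \<in> Obj C" using coproduct(2) unfolding is_coproduct_def by blast
  have Pd: "shift_obj C d P \<in> Obj C" for d using C.shift_obj_closed[OF P] .
  have id: "idt C (shift_obj C d P) \<in> factor_sums C (shift_obj C d ` set Xs) (shift_obj C d P) (shift_obj C d P)" for d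
    using C.shift_factor_sums[OF P P C.coproduct_factor_sums[OF coproduct(2)]] C.shift_idt[OF P] by simp
  have "surj_at i (shift_obj C d P)" for d
    by (rule surj_at_factor_sums[OF Pd id]) (use coproduct(1) in blast)
  moreover have "kill_at (Suc 0) (shift_obj C d P)" for d
    by (rule kill_at_factor_sums[OF Pd id]) (use coproduct(1) in blast)
  ultimately show ?case using P by blast
next
  case (retract W X)
  have X: "X \<in> Obj C" using retract(2) unfolding is_retract_def by blast
  have Xd: "shift_obj C d X \<in> Obj C" for d using C.shift_obj_closed[OF X] .
  note id = C.retract_factor_sums[OF C.shift_retract[OF retract(2)]]
  have "surj_at i (shift_obj C d X)" for d
    by (rule surj_at_factor_sums[OF Xd id]) (use retract(3) in blast)
  moreover have "kill_at (Suc 0) (shift_obj C d X)" for d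
    by (rule kill_at_factor_sums[OF Xd id]) (use retract(3) in blast)
  ultimately show ?case using X by blast
next
  case (suspension X e)
  have X: "X \<in> Obj C" using suspension(2) by blast
  have "shift_obj C d (shift_obj C e X) = shift_obj C (d + e) X" for d
    using C.shift_obj_add[OF X] by simp
  then show ?case using suspension(2) C.shift_obj_closed[OF X] by simp
qed

text \<open>Surjective half of the five lemma. The lift on \<open>X\<close> extends over
  \<open>P\<close> only after the obstruction on the desuspension of \<open>Z\<close> has been
  killed, which costs one stage; the remaining error comes from \<open>Z\<close> and is lifted
  there.\<close>

lemma surj_at_extension:
  assumes t: "is_exact_triangle C X P Z f g h" and X: "surj_at i X"
    and Z: "surj_at (Suc i) Z" and Z': "kill_at (Suc 0) (shift_obj C (- 1) Z)"
  shows "surj_at (Suc i) P"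
  unfolding surj_at_def
proof
  fix w assume w: "w \<in> Hom D (obj_map F P) Y"
  have f: "f \<in> Hom C X P" and g: "g \<in> Hom C P Z"
    using t unfolding is_exact_triangle_def is_triangle_def by auto
  obtain y where y: "y \<in> Hom C X (A i)" "w \<cdot>\<^bsub>D\<^esub> arr_map F f = a i \<cdot>\<^bsub>D\<^esub> arr_map F y"
    using surj_atD[OF X D.comp_in_Hom[OF F_Hom[OF f] w]] by blast
  obtain k where t': "is_exact_triangle C (shift_obj C (- 1) Z) X P k f g"
    using C.triangle_rotate_back[OF t] by blast
  have k: "k \<in> Hom C (shift_obj C (- 1) Z) X" and Zo: "shift_obj C (- 1) Z \<in> Obj C" and P: "P \<in> Obj C"
    using t' unfolding is_exact_triangle_def is_triangle_def by auto
  \<comment> \<open>The obstruction to extending \<open>y\<close> along \<open>f\<close> is its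
    composite with \<open>k\<close>. It is killed by \<open>a i\<close> because \<open>y\<close>
    lifts a morphism that comes from \<open>P\<close>.\<close>
  have "a i \<cdot>\<^bsub>D\<^esub> arr_map F (y \<cdot>\<^bsub>C\<^esub> k) = (w \<cdot>\<^bsub>D\<^esub> arr_map F f) \<cdot>\<^bsub>D\<^esub> arr_map F k"
    using a_comp[OF k y(1)] y(2) by simp
  also have "\<dots> = w \<cdot>\<^bsub>D\<^esub> arr_map F (f \<cdot>\<^bsub>C\<^esub> k)"
    using D.comp_assoc[OF F_Hom[OF k] F_Hom[OF f] w] F_comp[OF k f] by simp
  also have "\<dots> = zero_arr D (obj_map F (shift_obj C (- 1) Z)) Y"
    using C.triangle_comp_zero[OF t'] F_zero[OF Zo P] D.comp_zero[OF F_obj[OF Zo] w] by simp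
  finally have "u i \<cdot>\<^bsub>C\<^esub> (y \<cdot>\<^bsub>C\<^esub> k) = zero_arr C (shift_obj C (- 1) Z) (A (Suc i))"
    using kill_atD[OF Z' C.comp_in_Hom[OF k y(1)]] unfolding transition_1 by simp
  then have "(u i \<cdot>\<^bsub>C\<^esub> y) \<cdot>\<^bsub>C\<^esub> k = zero_arr C (shift_obj C (- 1) Z) (A (Suc i))"
    using C.comp_assoc[OF k y(1) u] by simp
  then obtain p where p: "p \<in> Hom C P (A (Suc i))" "u i \<cdot>\<^bsub>C\<^esub> y = p \<cdot>\<^bsub>C\<^esub> f"
    using C.triangle_factor[OF t' C.comp_in_Hom[OF y(1) u]] by blast
  let ?b = "a (Suc i) \<cdot>\<^bsub>D\<^esub> arr_map F p"
  have b: "?b \<in> Hom D (obj_map F P) Y" using a_Hom[OF p(1)] .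
  have "?b \<cdot>\<^bsub>D\<^esub> arr_map F f = w \<cdot>\<^bsub>D\<^esub> arr_map F f"
    using a_comp[OF f p(1)] p(2) a_comp[OF y(1) u] a_u y(2) by metis
  then have "(w \<boxplus>\<^bsub>D\<^esub> neg_arr D ?b) \<cdot>\<^bsub>D\<^esub> arr_map F f = zero_arr D (obj_map F X) Y"
    using D.add_comp[OF F_Hom[OF f] w D.neg_in_Hom[OF b]] D.neg_comp[OF F_Hom[OF f] b]
      D.add_neg[OF D.comp_in_Hom[OF F_Hom[OF f] w]] by simp
  \<comment> \<open>\<open>w\<close> and \<open>?b\<close> agree on \<open>F X\<close>, so their
    difference factors through \<open>F Z\<close>.\<close>
  from D.triangle_factor[OF F_triangle[OF t] D.add_in_Hom[OF w D.neg_in_Hom[OF b]] this]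
  obtain z where z: "z \<in> Hom D (obj_map F Z) Y" "w \<boxplus>\<^bsub>D\<^esub> neg_arr D ?b = z \<cdot>\<^bsub>D\<^esub> arr_map F g" by blast
  obtain z' where z': "z' \<in> Hom C Z (A (Suc i))" "z = a (Suc i) \<cdot>\<^bsub>D\<^esub> arr_map F z'"
    using surj_atD[OF Z z(1)] by blast
  note z'g = C.comp_in_Hom[OF g z'(1)]
  have "w = (w \<boxplus>\<^bsub>D\<^esub> neg_arr D ?b) \<boxplus>\<^bsub>D\<^esub> ?b" using D.diff_add_cancel[OF w b] by simp
  also have "\<dots> = a (Suc i) \<cdot>\<^bsub>D\<^esub> arr_map F (z' \<cdot>\<^bsub>C\<^esub> g \<boxplus>\<^bsub>C\<^esub> p)"
    using z(2) z'(2) a_comp[OF g z'(1)] a_add[OF z'g p(1)] by simp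
  finally show "\<exists>x\<in>Hom C P (A (Suc i)). w = a (Suc i) \<cdot>\<^bsub>D\<^esub> arr_map F x"
    using C.add_in_Hom[OF z'g p(1)] by blast
qed

text \<open>Injective half of the five lemma. After \<open>k\<close> stages the morphism vanishes on
  \<open>X\<close> and factors as \<open>z\<close> after \<open>g\<close>; modifying
  \<open>z\<close> by a morphism that factors through \<open>h\<close> does not change this
  composite, and makes \<open>z\<close> a morphism that dies one stage later.\<close>

lemma kill_at_extension:
  assumes t: "is_exact_triangle C X P Z f g h" and X: "kill_at k X" and Z: "kill_at (Suc 0) Z"
    and X': "\<And>i. surj_at (i + k) (obj_map (susp C) X)"
  shows "kill_at (Suc k) P"
  unfolding kill_at_def
proof (intro allI ballI impI)
  fix i x assume x: "x \<in> Hom C P (A i)" and ax: "a i \<cdot>\<^bsub>D\<^esub> arr_map F x = zero_arr D (obj_map F P) Y"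
  have f: "f \<in> Hom C X P" and g: "g \<in> Hom C P Z" and h: "h \<in> Hom C Z (obj_map (susp C) X)"
    and Xo: "X \<in> Obj C"
    using t unfolding is_exact_triangle_def is_triangle_def by auto
  let ?t = "transition i k" and ?j = "i + k"
  note tx = C.comp_in_Hom[OF x transition_Hom[of i k]]
  have "a i \<cdot>\<^bsub>D\<^esub> arr_map F (x \<cdot>\<^bsub>C\<^esub> f) = zero_arr D (obj_map F X) Y"
    using a_comp[OF f x] ax D.zero_comp[OF Y F_Hom[OF f]] by simp
  from kill_atD[OF X C.comp_in_Hom[OF f x] this]
  have "(?t \<cdot>\<^bsub>C\<^esub> x) \<cdot>\<^bsub>C\<^esub> f = zero_arr C X (A ?j)" using C.comp_assoc[OF f x transition_Hom] by simp
  then obtain z where z: "z \<in> Hom C Z (A ?j)" "?t \<cdot>\<^bsub>C\<^esub> x = z \<cdot>\<^bsub>C\<^esub> g"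
    using C.triangle_factor[OF t tx] by blast
  let ?az = "a ?j \<cdot>\<^bsub>D\<^esub> arr_map F z"
  have "?az \<cdot>\<^bsub>D\<^esub> arr_map F g = zero_arr D (obj_map F P) Y"
    using a_comp[OF g z(1)] z(2) a_advance[OF x, of k] ax by simp
  \<comment> \<open>Exactness at \<open>F Z\<close> for the rotated image triangle, whose next map
    is \<open>\<theta> X\<close> after \<open>F\<close> of \<open>h\<close>. The factor
    \<open>v\<close> lives on the suspension of \<open>F X\<close>; composing with
    \<open>\<theta> X\<close> makes it a morphism on \<open>F\<close> of the suspension of
    \<open>X\<close>, where it can be lifted.\<close>
  from D.triangle_factor[OF D.triangle_rotate[OF F_triangle[OF t]] a_Hom[OF z(1)] this]
  obtain v where v: "v \<in> Hom D (obj_map (susp D) (obj_map F X)) Y"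
    "?az = v \<cdot>\<^bsub>D\<^esub> (\<theta> X \<cdot>\<^bsub>D\<^esub> arr_map F h)" by blast
  note \<theta>X = \<theta>_Hom[OF Xo]
  obtain w where w: "w \<in> Hom C (obj_map (susp C) X) (A ?j)" "v \<cdot>\<^bsub>D\<^esub> \<theta> X = a ?j \<cdot>\<^bsub>D\<^esub> arr_map F w"
    using surj_atD[OF X' D.comp_in_Hom[OF \<theta>X v(1)]] by blast
  note wh = C.comp_in_Hom[OF h w(1)]
  have eq: "?az = a ?j \<cdot>\<^bsub>D\<^esub> arr_map F (w \<cdot>\<^bsub>C\<^esub> h)"
    using v(2) D.comp_assoc[OF F_Hom[OF h] \<theta>X v(1)] w(2) a_comp[OF h w(1)] by simp
  let ?d = "z \<boxplus>\<^bsub>C\<^esub> neg_arr C (w \<cdot>\<^bsub>C\<^esub> h)"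
  have d: "?d \<in> Hom C Z (A ?j)" using C.add_in_Hom[OF z(1) C.neg_in_Hom[OF wh]] .
  have "a ?j \<cdot>\<^bsub>D\<^esub> arr_map F ?d = zero_arr D (obj_map F Z) Y"
    using a_add[OF z(1) C.neg_in_Hom[OF wh]] a_neg[OF wh] eq D.add_neg[OF a_Hom[OF wh]] by simp
  from kill_atD[OF Z d this] have ud: "u ?j \<cdot>\<^bsub>C\<^esub> ?d = zero_arr C Z (A (Suc ?j))"
    unfolding transition_1 by simp
  note uz = C.comp_in_Hom[OF z(1) u] and uwh = C.comp_in_Hom[OF wh u]
  have "u ?j \<cdot>\<^bsub>C\<^esub> z \<boxplus>\<^bsub>C\<^esub> neg_arr C (u ?j \<cdot>\<^bsub>C\<^esub> (w \<cdot>\<^bsub>C\<^esub> h)) = zero_arr C Z (A (Suc ?j))"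
    using ud C.comp_add[OF z(1) C.neg_in_Hom[OF wh] u] C.comp_neg[OF wh u] by simp
  then have "u ?j \<cdot>\<^bsub>C\<^esub> z = u ?j \<cdot>\<^bsub>C\<^esub> (w \<cdot>\<^bsub>C\<^esub> h)" using C.eq_of_diff_zero[OF uz uwh] by blast
  then have "(u ?j \<cdot>\<^bsub>C\<^esub> z) \<cdot>\<^bsub>C\<^esub> g = (u ?j \<cdot>\<^bsub>C\<^esub> (w \<cdot>\<^bsub>C\<^esub> h)) \<cdot>\<^bsub>C\<^esub> g" by simp
  also have "\<dots> = u ?j \<cdot>\<^bsub>C\<^esub> (w \<cdot>\<^bsub>C\<^esub> (h \<cdot>\<^bsub>C\<^esub> g))"
    using C.comp_assoc[OF g wh u] C.comp_assoc[OF g h w(1)] by simp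
  also have "h \<cdot>\<^bsub>C\<^esub> g = zero_arr C P (obj_map (susp C) X)"
    using C.triangle_comp_zero[OF C.triangle_rotate[OF t]] .
  also have "u ?j \<cdot>\<^bsub>C\<^esub> (w \<cdot>\<^bsub>C\<^esub> zero_arr C P (obj_map (susp C) X)) = zero_arr C P (A (Suc ?j))"
    using C.Hom_Obj[OF x] C.comp_zero[OF _ w(1)] C.comp_zero[OF _ u] by simp
  finally have "u ?j \<cdot>\<^bsub>C\<^esub> (?t \<cdot>\<^bsub>C\<^esub> x) = zero_arr C P (A (Suc ?j))"
    using z(2) C.comp_assoc[OF g z(1) u] by simp
  then show "transition i (Suc k) \<cdot>\<^bsub>C\<^esub> x = zero_arr C P (A (i + Suc k))"
    using C.comp_assoc[OF x transition_Hom u] by simp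
qed

text \<open>Both claims are carried together because killing on an extension uses lifting on the
  suspension of its first term. \<open>thick_one\<close> costs nothing for lifting and one stage for
  killing, and each extension adds one stage to both.\<close>

lemma iterated_extensions_surj_kill:
  "X \<in> iterated_extensions C G n \<Longrightarrow> surj_at (i + n) X \<and> kill_at (Suc n) X"
proof (induction n arbitrary: X i)
  case 0
  then have X: "X \<in> thick_one C G" by simp
  show ?case using thick_one_surj_kill[OF X, of i] C.shift_obj_0 by (metis add_0_right)
next
  case (Suc n)
  obtain P W Z f g h where r: "is_retract C X P" and t: "is_exact_triangle C W P Z f g h"
    and W: "W \<in> iterated_extensions C G n" and Z: "Z \<in> thick_one C G"
    using Suc.prems unfolding iterated_extensions.simps by blast
  have X: "X \<in> Obj C" using r unfolding is_retract_def by blast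
  have Z0: "surj_at j Z" "kill_at (Suc 0) Z" and Z1: "kill_at (Suc 0) (shift_obj C (- 1) Z)" for j
    using thick_one_surj_kill[OF Z, of j] C.shift_obj_0 by metis+
  have "surj_at (Suc (i + n)) P"
    using surj_at_extension[OF t _ Z0(1) Z1] Suc.IH[OF W] by blast
  moreover have "kill_at (Suc (Suc n)) P"
  proof (rule kill_at_extension[OF t _ Z0(2)])
    show "kill_at (Suc n) W" using Suc.IH[OF W] by blast
    show "surj_at (j + Suc n) (obj_map (susp C) W)" for j
      \<comment> \<open>The lift must exist at the stage where \<open>W\<close> has been killed,
        \<open>Suc n\<close> steps after \<open>j\<close>; the induction hypothesis started at
        \<open>Suc j\<close> ends exactly there.\<close>
      using Suc.IH[OF C.iterated_extensions_susp[OF W], of "Suc j"] by simp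
  qed
  ultimately show ?case
    using surj_at_factor_sums[OF X C.retract_factor_sums[OF r]]
      kill_at_factor_sums[OF X C.retract_factor_sums[OF r]] by simp
qed

text \<open>If every morphism to \<open>Y\<close> lifts to \<open>A\<^sub>N\<close>, and those lifts are unique after passing to
  \<open>A\<^sub>N\<^sub>+\<^sub>k\<close>, then lifting \<open>a\<^sub>N\<^sub>+\<^sub>k\<close> itself produces an idempotent of \<open>A\<^sub>N\<^sub>+\<^sub>k\<close>, whose image
  represents the functor.\<close>

lemma representing_object:
  assumes surj: "\<And>X. X \<in> Obj C \<Longrightarrow> surj_at N X" and kill: "\<And>X. X \<in> Obj C \<Longrightarrow> kill_at k X"
    and split: "idempotent_complete C"
  shows "\<exists>Q\<in>Obj C. \<exists>b\<in>Hom D (obj_map F Q) Y.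
    \<forall>X\<in>Obj C. bij_betw (\<lambda>x. b \<cdot>\<^bsub>D\<^esub> arr_map F x) (Hom C X Q) (Hom D (obj_map F X) Y)"
proof -
  define B where "B = A (N + k)"
  define t where "t = transition N k"
  define c where "c = a (N + k)"
  have B: "B \<in> Obj C" and t: "t \<in> Hom C (A N) B" and c: "c \<in> Hom D (obj_map F B) Y"
    and ct: "c \<cdot>\<^bsub>D\<^esub> arr_map F t = a N"
    unfolding B_def t_def c_def by (rule A transition_Hom a a_transition)+
  have c_comp: "c \<cdot>\<^bsub>D\<^esub> arr_map F (x \<cdot>\<^bsub>C\<^esub> y) = (c \<cdot>\<^bsub>D\<^esub> arr_map F x) \<cdot>\<^bsub>D\<^esub> arr_map F y"
    if "y \<in> Hom C X W" "x \<in> Hom C W B" for x y X W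
    using F_comp[OF that] D.comp_assoc[OF F_Hom[OF that(1)] F_Hom[OF that(2)] c] by simp
  have killed: "t \<cdot>\<^bsub>C\<^esub> y = t \<cdot>\<^bsub>C\<^esub> y'" if y: "y \<in> Hom C X (A N)" and y': "y' \<in> Hom C X (A N)"
    and eq: "a N \<cdot>\<^bsub>D\<^esub> arr_map F y = a N \<cdot>\<^bsub>D\<^esub> arr_map F y'" for y y' X
  proof -
    have X: "X \<in> Obj C" using C.Hom_Obj[OF y] by blast
    note n = C.neg_in_Hom[OF y']
    have "a N \<cdot>\<^bsub>D\<^esub> arr_map F (y \<boxplus>\<^bsub>C\<^esub> neg_arr C y') = zero_arr D (obj_map F X) Y"
      using a_add[OF y n] a_neg[OF y'] eq D.add_neg[OF a_Hom[OF y']] by simp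
    from kill_atD[OF kill[OF X] C.add_in_Hom[OF y n] this]
    have "t \<cdot>\<^bsub>C\<^esub> (y \<boxplus>\<^bsub>C\<^esub> neg_arr C y') = zero_arr C X B" unfolding t_def B_def .
    then have "t \<cdot>\<^bsub>C\<^esub> y \<boxplus>\<^bsub>C\<^esub> neg_arr C (t \<cdot>\<^bsub>C\<^esub> y') = zero_arr C X B"
      using C.comp_add[OF y n t] C.comp_neg[OF y' t] by simp
    then show ?thesis using C.eq_of_diff_zero[OF C.comp_in_Hom[OF y t] C.comp_in_Hom[OF y' t]] by blast
  qed
  obtain x where x: "x \<in> Hom C B (A N)" and ax: "c = a N \<cdot>\<^bsub>D\<^esub> arr_map F x"
    using surj_atD[OF surj[OF B] c] by blast
  note tx = C.comp_in_Hom[OF x t] and xt = C.comp_in_Hom[OF t x]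
  \<comment> \<open>Composing \<open>x\<close> with \<open>t\<close> is invisible to
    \<open>a N\<close>, so \<open>t\<close> cannot distinguish the result from the identity of
    \<open>A N\<close>; this gives the idempotent.\<close>
  have "a N \<cdot>\<^bsub>D\<^esub> arr_map F (x \<cdot>\<^bsub>C\<^esub> t) = a N \<cdot>\<^bsub>D\<^esub> arr_map F (idt C (A N))"
    using a_comp[OF t x] ax[symmetric] ct F_idt[OF A] D.comp_idt[OF a] by simp
  from killed[OF xt C.idt_in_Hom[OF A] this] have txt_eq: "t \<cdot>\<^bsub>C\<^esub> (x \<cdot>\<^bsub>C\<^esub> t) = t"
    using C.comp_idt[OF t] by simp
  have "(t \<cdot>\<^bsub>C\<^esub> x) \<cdot>\<^bsub>C\<^esub> (t \<cdot>\<^bsub>C\<^esub> x) = (t \<cdot>\<^bsub>C\<^esub> (x \<cdot>\<^bsub>C\<^esub> t)) \<cdot>\<^bsub>C\<^esub> x"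
    using C.comp_assoc[OF tx x t] C.comp_assoc[OF x t x] C.comp_assoc[OF x xt t] by simp
  then have idem: "(t \<cdot>\<^bsub>C\<^esub> x) \<cdot>\<^bsub>C\<^esub> (t \<cdot>\<^bsub>C\<^esub> x) = t \<cdot>\<^bsub>C\<^esub> x" using txt_eq by simp
  have "\<exists>Q\<in>Obj C. \<exists>r\<in>Hom C B Q. \<exists>s\<in>Hom C Q B. s \<cdot>\<^bsub>C\<^esub> r = t \<cdot>\<^bsub>C\<^esub> x \<and> r \<cdot>\<^bsub>C\<^esub> s = idt C Q"
    using split B tx idem unfolding idempotent_complete_def by simp
  then obtain Q r s where Q: "Q \<in> Obj C" and r: "r \<in> Hom C B Q" and s: "s \<in> Hom C Q B"
    and sr: "s \<cdot>\<^bsub>C\<^esub> r = t \<cdot>\<^bsub>C\<^esub> x" and rs: "r \<cdot>\<^bsub>C\<^esub> s = idt C Q" by blast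
  define b where "b = c \<cdot>\<^bsub>D\<^esub> arr_map F s"
  have b: "b \<in> Hom D (obj_map F Q) Y" unfolding b_def using D.comp_in_Hom[OF F_Hom[OF s] c] .
  have bF: "b \<cdot>\<^bsub>D\<^esub> arr_map F y = c \<cdot>\<^bsub>D\<^esub> arr_map F (s \<cdot>\<^bsub>C\<^esub> y)" if "y \<in> Hom C X Q" for X y
    unfolding b_def using c_comp[OF that s] by simp
  have "bij_betw (\<lambda>y. b \<cdot>\<^bsub>D\<^esub> arr_map F y) (Hom C X Q) (Hom D (obj_map F X) Y)" if X: "X \<in> Obj C" for X
  proof (rule bij_betw_imageI)
    show "inj_on (\<lambda>y. b \<cdot>\<^bsub>D\<^esub> arr_map F y) (Hom C X Q)"
    proof (rule inj_onI)
      fix y y' assume y: "y \<in> Hom C X Q" and y': "y' \<in> Hom C X Q"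
        and eq: "b \<cdot>\<^bsub>D\<^esub> arr_map F y = b \<cdot>\<^bsub>D\<^esub> arr_map F y'"
      \<comment> \<open>Thus \<open>b\<close> composed with \<open>F\<close> of \<open>y\<close>
        determines the lift \<open>x s y\<close> up to what \<open>t\<close> kills, and the next
        identity recovers \<open>y\<close> from its image under \<open>t\<close>.\<close>
      have aN: "a N \<cdot>\<^bsub>D\<^esub> arr_map F (x \<cdot>\<^bsub>C\<^esub> (s \<cdot>\<^bsub>C\<^esub> y)) = b \<cdot>\<^bsub>D\<^esub> arr_map F y" if y: "y \<in> Hom C X Q" for y
        using a_comp[OF C.comp_in_Hom[OF y s] x] ax[symmetric] bF[OF y] by simp
      have txs: "r \<cdot>\<^bsub>C\<^esub> (t \<cdot>\<^bsub>C\<^esub> (x \<cdot>\<^bsub>C\<^esub> (s \<cdot>\<^bsub>C\<^esub> y))) = y" if y: "y \<in> Hom C X Q" for y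
      proof -
        note sy = C.comp_in_Hom[OF y s]
        have "r \<cdot>\<^bsub>C\<^esub> (t \<cdot>\<^bsub>C\<^esub> (x \<cdot>\<^bsub>C\<^esub> (s \<cdot>\<^bsub>C\<^esub> y))) = r \<cdot>\<^bsub>C\<^esub> (s \<cdot>\<^bsub>C\<^esub> (r \<cdot>\<^bsub>C\<^esub> (s \<cdot>\<^bsub>C\<^esub> y)))"
          using C.comp_assoc[OF sy x t] sr C.comp_assoc[OF sy r s] by simp
        moreover have "r \<cdot>\<^bsub>C\<^esub> (s \<cdot>\<^bsub>C\<^esub> y) = y" using C.comp_assoc[OF y s r] rs C.idt_comp[OF y] by simp
        ultimately show ?thesis by simp
      qed
      have "a N \<cdot>\<^bsub>D\<^esub> arr_map F (x \<cdot>\<^bsub>C\<^esub> (s \<cdot>\<^bsub>C\<^esub> y)) = a N \<cdot>\<^bsub>D\<^esub> arr_map F (x \<cdot>\<^bsub>C\<^esub> (s \<cdot>\<^bsub>C\<^esub> y'))"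
        using aN[OF y] aN[OF y'] eq by simp
      then have "t \<cdot>\<^bsub>C\<^esub> (x \<cdot>\<^bsub>C\<^esub> (s \<cdot>\<^bsub>C\<^esub> y)) = t \<cdot>\<^bsub>C\<^esub> (x \<cdot>\<^bsub>C\<^esub> (s \<cdot>\<^bsub>C\<^esub> y'))"
        using killed C.comp_in_Hom[OF C.comp_in_Hom[OF y s] x] C.comp_in_Hom[OF C.comp_in_Hom[OF y' s] x] by blast
      then have "r \<cdot>\<^bsub>C\<^esub> (t \<cdot>\<^bsub>C\<^esub> (x \<cdot>\<^bsub>C\<^esub> (s \<cdot>\<^bsub>C\<^esub> y))) = r \<cdot>\<^bsub>C\<^esub> (t \<cdot>\<^bsub>C\<^esub> (x \<cdot>\<^bsub>C\<^esub> (s \<cdot>\<^bsub>C\<^esub> y')))"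
        by (rule arg_cong)
      then show "y = y'" unfolding txs[OF y] txs[OF y'] .
    qed
    show "(\<lambda>y. b \<cdot>\<^bsub>D\<^esub> arr_map F y) ` Hom C X Q = Hom D (obj_map F X) Y"
    proof (intro equalityI subsetI)
      fix h assume "h \<in> (\<lambda>y. b \<cdot>\<^bsub>D\<^esub> arr_map F y) ` Hom C X Q"
      then obtain y where y: "y \<in> Hom C X Q" "h = b \<cdot>\<^bsub>D\<^esub> arr_map F y" by blast
      show "h \<in> Hom D (obj_map F X) Y" unfolding y(2) using D.comp_in_Hom[OF F_Hom[OF y(1)] b] .
    next
      fix h assume "h \<in> Hom D (obj_map F X) Y"
      then obtain y where y: "y \<in> Hom C X (A N)" "h = a N \<cdot>\<^bsub>D\<^esub> arr_map F y"
        using surj_atD[OF surj[OF X]] by blast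
      note ty = C.comp_in_Hom[OF y(1) t]
      note rty = C.comp_in_Hom[OF ty r]
      \<comment> \<open>The idempotent fixes every morphism that factors through \<open>t\<close>,
        so a lift pushed to \<open>B\<close> already lies in the summand \<open>Q\<close>.\<close>
      have "s \<cdot>\<^bsub>C\<^esub> (r \<cdot>\<^bsub>C\<^esub> (t \<cdot>\<^bsub>C\<^esub> y)) = (t \<cdot>\<^bsub>C\<^esub> x) \<cdot>\<^bsub>C\<^esub> (t \<cdot>\<^bsub>C\<^esub> y)"
        using C.comp_assoc[OF ty r s] sr by simp
      also have "\<dots> = (t \<cdot>\<^bsub>C\<^esub> (x \<cdot>\<^bsub>C\<^esub> t)) \<cdot>\<^bsub>C\<^esub> y"
        unfolding C.comp_assoc[OF y(1) xt t, symmetric] C.comp_assoc[OF y(1) t x, symmetric]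
        by (rule C.comp_assoc[OF ty x t, symmetric])
      also have "\<dots> = t \<cdot>\<^bsub>C\<^esub> y" using txt_eq by simp
      finally have "b \<cdot>\<^bsub>D\<^esub> arr_map F (r \<cdot>\<^bsub>C\<^esub> (t \<cdot>\<^bsub>C\<^esub> y)) = h"
        using bF[OF rty] c_comp[OF y(1) t] ct y(2) by simp
      then show "h \<in> (\<lambda>y. b \<cdot>\<^bsub>D\<^esub> arr_map F y) ` Hom C X Q" using rty by blast
    qed
  qed
  then show ?thesis using Q b by blast
qed

end

text \<open>Iterates \<open>exists_approximation_step\<close> by dependent choice. The lifting
  property of the first stage is inherited by all later ones, by composing lifts with
  \<open>u\<close>.\<close>

lemma (in graded_linear_functor) exists_approximation_sequence:
  assumes G: "G \<in> Obj C" and Y: "Y \<in> Obj D"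
  shows "\<exists>A a u. approximation C D F \<theta> G Y A a u"
proof -
  define good where "good A a \<longleftrightarrow> A \<in> Obj C \<and> a \<in> Hom D (obj_map F A) Y \<and>
    (\<forall>m. \<forall>h\<in>Hom D (obj_map F (shift_obj C m G)) Y. \<exists>x\<in>Hom C (shift_obj C m G) A. h = a \<cdot>\<^bsub>D\<^esub> arr_map F x)"
    for A a
  define step where "step A a A' a' u \<longleftrightarrow> u \<in> Hom C A A' \<and> a = a' \<cdot>\<^bsub>D\<^esub> arr_map F u \<and>
    (\<forall>m. \<forall>x\<in>Hom C (shift_obj C m G) A.
      a \<cdot>\<^bsub>D\<^esub> arr_map F x = zero_arr D (obj_map F (shift_obj C m G)) Y \<longrightarrow>
      u \<cdot>\<^bsub>C\<^esub> x = zero_arr C (shift_obj C m G) A')" for A a A' a' u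
  have base: "\<exists>x. good (fst x) (snd x)"
  proof -
    obtain A a where "good A a" unfolding good_def using exists_approximation[OF G Y] by blast
    then have "good (fst (A, a)) (snd (A, a))" by simp
    then show ?thesis by (rule exI)
  qed
  have next_stage: "\<exists>A' a'. good A' a' \<and> (\<exists>u. step A a A' a' u)" if good: "good A a" for A a
  proof -
    have A: "A \<in> Obj C" and a: "a \<in> Hom D (obj_map F A) Y" using good unfolding good_def by auto
    obtain A' u a' where A': "A' \<in> Obj C" "u \<in> Hom C A A'" "a' \<in> Hom D (obj_map F A') Y" "step A a A' a' u"
      using exists_approximation_step[OF G A a] unfolding step_def by blast
    have "\<exists>x'\<in>Hom C (shift_obj C m G) A'. h = a' \<cdot>\<^bsub>D\<^esub> arr_map F x'"
      if h: "h \<in> Hom D (obj_map F (shift_obj C m G)) Y" for m h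
    proof -
      obtain x where x: "x \<in> Hom C (shift_obj C m G) A" "h = a \<cdot>\<^bsub>D\<^esub> arr_map F x"
        using good h unfolding good_def by blast
      have "h = a' \<cdot>\<^bsub>D\<^esub> arr_map F (u \<cdot>\<^bsub>C\<^esub> x)"
        using x A'(4) F_comp[OF x(1) A'(2)] D.comp_assoc[OF F_Hom[OF x(1)] F_Hom[OF A'(2)] A'(3)]
        unfolding step_def by simp
      then show ?thesis using C.comp_in_Hom[OF x(1) A'(2)] by blast
    qed
    then have "good A' a'" unfolding good_def using A'(1,3) by (intro conjI allI ballI) simp_all
    then show ?thesis using A'(4) by blast
  qed
  let ?step = "\<lambda>x y. \<exists>u. step (fst x) (snd x) (fst y) (snd y) u"
  have "\<exists>y. good (fst y) (snd y) \<and> ?step x y" if good: "good (fst x) (snd x)" for x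
  proof -
    obtain A' a' u where "good A' a'" "step (fst x) (snd x) A' a' u" using next_stage[OF good] by blast
    then have "good (fst (A', a')) (snd (A', a')) \<and> ?step x (A', a')" by auto
    then show ?thesis by (rule exI)
  qed
  from dependent_nat_choice[of "\<lambda>_ x. good (fst x) (snd x)" "\<lambda>_. ?step", OF base this]
  obtain f where good: "\<And>n. good (fst (f n)) (snd (f n))" and f: "\<And>n. ?step (f n) (f (Suc n))"
    by blast
  \<comment> \<open>The connecting maps involve two consecutive stages, so they are selected only
    after the sequence of pairs has been fixed.\<close>
  have "\<exists>u. \<forall>n. step (fst (f n)) (snd (f n)) (fst (f (Suc n))) (snd (f (Suc n))) (u n)"
    by (rule choice) (rule allI, rule f)
  then obtain u where u: "\<And>n. step (fst (f n)) (snd (f n)) (fst (f (Suc n))) (snd (f (Suc n))) (u n)"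
    by blast
  have "approximation C D F \<theta> G Y (\<lambda>n. fst (f n)) (\<lambda>n. snd (f n)) u"
  proof unfold_locales
    show "G \<in> Obj C" by (rule G)
  qed (use good u in \<open>unfold good_def step_def, blast+\<close>)
  then show ?thesis by blast
qed

text \<open>An object of \<open>thick C G (Suc n)\<close> takes n extensions. Starting the tower at
  stage 0, every object then lifts at stage \<open>n\<close> and kills with lag
  \<open>Suc n\<close>, which are the constants passed to
  \<open>representing_object\<close>.\<close>

lemma (in graded_linear_functor) has_right_adjoint:
  assumes "strongly_generated C" "idempotent_complete C"
  shows "has_right_adjoint C D F"
proof (rule right_adjoint_of_universal_arrows[OF C.category_axioms D.category_axioms])
  show "is_functor C D F" using additive unfolding is_additive_functor_def by blast
  fix Y assume Y: "Y \<in> Obj D"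
  obtain G n where G: "G \<in> Obj C" and n: "Obj C = thick C G (Suc n)"
    using assms(1) unfolding strongly_generated_def by (metis One_nat_def Suc_le_D)
  obtain A a u where approx: "approximation C D F \<theta> G Y A a u"
    using exists_approximation_sequence[OF G Y] by blast
  interpret approximation C D F \<theta> G Y A a u by fact
  have "surj_at n X \<and> kill_at (Suc n) X" if "X \<in> Obj C" for X
    using iterated_extensions_surj_kill[of X n 0] C.thick_subset_iterated_extensions[of G n] that n by auto
  then show "\<exists>Q\<in>Obj C. \<exists>b\<in>Hom D (obj_map F Q) Y.
      \<forall>X\<in>Obj C. bij_betw (\<lambda>x. b \<cdot>\<^bsub>D\<^esub> arr_map F x) (Hom C X Q) (Hom D (obj_map F X) Y)"
    using representing_object[OF _ _ assms(2)] by blast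
qed

theorem corollary3p2:
  fixes R :: "'r ring" and Rd :: "int \<Rightarrow> 'r set"
    and S :: "('o, 'm) triangulated_category" and \<phi> :: "'r \<Rightarrow> int \<Rightarrow> 'o \<Rightarrow> 'm"
    and T :: "('p, 'n) triangulated_category" and \<psi> :: "'r \<Rightarrow> int \<Rightarrow> 'p \<Rightarrow> 'n"
    and F :: "('o, 'm, 'p, 'n) functor_data" and \<theta> :: "'o \<Rightarrow> 'n"
  assumes "graded_commutative_ring R Rd" and "noetherian_ring R"
    and "graded_linear_category R Rd S \<phi>" and "Ext_finite R S \<phi>"
    and "graded_linear_category R Rd T \<psi>" and "Ext_finite R T \<psi>"
    and "strongly_generated S" and "idempotent_complete S"
    and "is_graded_linear_functor R S \<phi> T \<psi> F \<theta>"
  shows "has_right_adjoint S T F"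
proof -
  interpret S: graded_linear_category R Rd S \<phi> by fact
  interpret T: graded_linear_category R Rd T \<psi> by fact
  interpret graded_linear_functor R Rd S \<phi> T \<psi> F \<theta>
  proof unfold_locales
    show "is_exact_functor S T F \<theta>" using assms(9) unfolding is_graded_linear_functor_def by (rule conjunct1)
    show "\<And>I. ideal I R \<Longrightarrow> \<exists>A\<subseteq>carrier R. finite A \<and> I = Idl\<^bsub>R\<^esub> A"
      by (rule noetherian_ring.finetely_gen[OF assms(2)])
  qed fact+
  show ?thesis using has_right_adjoint[OF assms(7,8)] .
qed

end
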